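(* If $M$ is a matroid of rank $3$ on a finite set, then $\omega(M)\ge0$. Among loop-free matroids $M$ of rank $3$, equality $\omega(M)=0$ occurs if and only if the simplification of $M$ is either isomorphic to the uniform matroid $\mathrm U_{3,5}$ of rank $3$ on $5$ elements or has a rank $2$ flat containing all but two of its points.
   Context: The simplification of a matroid is obtained by deleting loops and keeping one element from each parallel class; its elements are called points. Let $M$ be a matroid of rank $r$ on a finite set $E$, $|E|=n$, and let $c(M)$ be its number of connected components. Speyer's $g$-polynomial $g_M(t)\in\mathbb Z[t]$ is given as follows (in the form of Berget–Eur–Spink–Tseng, equivalent to the original $K$-theoretic definition). If $E=\emptyset$, $g_M=1$. If $M$ has a loop or a coloop, $g_M=0$. Otherwise, for each total ordering $w=(w_1,\dots,w_n)$ of $E$, let $B_w$ be the basis with $w_k\in B_w$ iff $\operatorname{rank}\{w_1,\dots,w_k\}>\operatorname{rank}\{w_1,\dots,w_{k-1}\}$. In $\mathbb Z[z_e:e\in E]$, let $x^w$ be the list of the $z_b$, $b\in B_w$; let $y^w$ be the list of the $-z_c$, $c\in E\setminus B_w$; let $\alpha^w=-z_{w_n}$. For a family $f=(f_w)_w$ put $\deg f=\sum_w f_w/\prod_{i=1}^{n-1}(z_{w_i}-z_{w_{i+1}})$. With $\boldsymbol e_k$ the $k$-th elementary symmetric polynomial, $$g_M(t)=(-1)^{c(M)}\sum_{i=1}^{r}(-t)^i\sum_{j=0}^{i-1}\deg\big(\alpha^j\,\boldsymbol e_{i-j-1}(-y)\,\boldsymbol e_{r-i}(x)\,\boldsymbol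 e_{n-r}(y)\big).$$ $\omega(M)$ is the coefficient of $t^r$ in $g_M(t)$.
   Formalization: The equality criterion also lists "M has a coloop" as a case of ω(M)=0: since g_M=0 for matroids with a coloop, the printed "only if" fails, e.g. for U_{3,3}. For loop-free M without coloops the printed equivalence is proved unchanged. *)

theory Defs
  imports
    "HOL-Library.Poly_Mapping"
    "HOL-Computational_Algebra.Polynomial"
    "HOL-Computational_Algebra.Fraction_Field"
    "HOL-Combinatorics.Multiset_Permutations"
begin

section \<open>Matroids\<close>

record 'a set_system =
  ground :: "'a set"
  indeps :: "'a set set"

locale matroid =
  fixes M :: "'a set_system"
  assumes finite_ground: "finite (ground M)"
    and indeps_subset: "I \<in> indeps M \<Longrightarrow> I \<subseteq> ground M"
    and empty_indep: "{} \<in> indeps M"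
    and indep_mono: "I \<in> indeps M \<Longrightarrow> J \<subseteq> I \<Longrightarrow> J \<in> indeps M"
    and augmentation: "I \<in> indeps M \<Longrightarrow> J \<in> indeps M \<Longrightarrow> card I < card J \<Longrightarrow>
      \<exists>e\<in>J - I. insert e I \<in> indeps M"

definition rk :: "'a set_system \<Rightarrow> 'a set \<Rightarrow> nat" where
  "rk M X = Max (card ` {I \<in> indeps M. I \<subseteq> X})"

definition matroid_rank :: "'a set_system \<Rightarrow> nat" where
  "matroid_rank M = rk M (ground M)"

definition is_basis :: "'a set_system \<Rightarrow> 'a set \<Rightarrow> bool" where
  "is_basis M B \<longleftrightarrow> B \<in> indeps M \<and> (\<forall>I\<in>indeps M. B \<subseteq> I \<longrightarrow> I = B)"

definition is_circuit :: "'a set_system \<Rightarrow> 'a set \<Rightarrow> bool" where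
  "is_circuit M C \<longleftrightarrow> C \<subseteq> ground M \<and> C \<notin> indeps M \<and> (\<forall>D. D \<subset> C \<longrightarrow> D \<in> indeps M)"

definition is_flat :: "'a set_system \<Rightarrow> 'a set \<Rightarrow> bool" where
  "is_flat M F \<longleftrightarrow> F \<subseteq> ground M \<and> (\<forall>e\<in>ground M - F. rk M F < rk M (insert e F))"

definition is_loop :: "'a set_system \<Rightarrow> 'a \<Rightarrow> bool" where
  "is_loop M e \<longleftrightarrow> e \<in> ground M \<and> {e} \<notin> indeps M"

definition is_coloop :: "'a set_system \<Rightarrow> 'a \<Rightarrow> bool" where
  "is_coloop M e \<longleftrightarrow> e \<in> ground M \<and> (\<forall>B. is_basis M B \<longrightarrow> e \<in> B)"

definition loop_free :: "'a set_system \<Rightarrow> bool" where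
  "loop_free M \<longleftrightarrow> (\<forall>e. \<not> is_loop M e)"

definition connected_rel :: "'a set_system \<Rightarrow> ('a \<times> 'a) set" where
  "connected_rel M = {(e, f) \<in> ground M \<times> ground M.
     e = f \<or> (\<exists>C. is_circuit M C \<and> e \<in> C \<and> f \<in> C)}"

definition num_components :: "'a set_system \<Rightarrow> nat" where
  "num_components M = card (ground M // connected_rel M)"

definition matroid_restrict :: "'a set_system \<Rightarrow> 'a set \<Rightarrow> 'a set_system" where
  "matroid_restrict M S = \<lparr>ground = S, indeps = {I \<in> indeps M. I \<subseteq> S}\<rparr>"

definition matroid_iso :: "'a set_system \<Rightarrow> 'b set_system \<Rightarrow> bool" where
  "matroid_iso M N \<longleftrightarrow> (\<exists>\<phi>. bij_betw \<phi> (ground M) (ground N) \<and>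
     (\<forall>X. X \<subseteq> ground M \<longrightarrow> (X \<in> indeps M \<longleftrightarrow> \<phi> ` X \<in> indeps N)))"

definition uniform_matroid :: "nat \<Rightarrow> nat \<Rightarrow> nat set_system" where
  "uniform_matroid r n = \<lparr>ground = {..<n}, indeps = {I. I \<subseteq> {..<n} \<and> card I \<le> r}\<rparr>"

definition parallel :: "'a set_system \<Rightarrow> 'a \<Rightarrow> 'a \<Rightarrow> bool" where
  "parallel M e f \<longleftrightarrow> e = f \<or> is_circuit M {e, f}"

text \<open>
  A simplification depends on the chosen representatives of the parallel classes, hence is
  unique only up to isomorphism; this is a predicate on \<open>N\<close> rather than a function of \<open>M\<close>.
  The points of \<open>M\<close> are the elements of \<open>ground N\<close>.
\<close>

definition is_simplification :: "'a set_system \<Rightarrow> 'a set_system \<Rightarrow> bool" where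
  "is_simplification M N \<longleftrightarrow> (\<exists>S \<subseteq> {e \<in> ground M. \<not> is_loop M e}.
     (\<forall>e\<in>ground M. \<not> is_loop M e \<longrightarrow> (\<exists>!s. s \<in> S \<and> parallel M e s)) \<and>
     N = matroid_restrict M S)"

lemma (in matroid) parallel_trans:
  assumes "parallel M a b" "parallel M b c"
    "\<not> is_loop M a" "\<not> is_loop M b" "\<not> is_loop M c"
  shows "parallel M a c"
proof (rule ccontr)
  assume n: "\<not> parallel M a c"
  then have ab: "is_circuit M {a, b}" and bc: "is_circuit M {b, c}" and "a \<noteq> c"
    using assms unfolding parallel_def by metis+
  then have g: "a \<in> ground M" "b \<in> ground M" "c \<in> ground M"
    by (auto simp: is_circuit_def)
  then have s: "{a} \<in> indeps M" "{b} \<in> indeps M" "{c} \<in> indeps M"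
    using assms by (auto simp: is_loop_def)
  have d: "a \<noteq> b" "b \<noteq> c"
    using ab bc s unfolding is_circuit_def by (metis insert_absorb2)+
  have "{a, c} \<in> indeps M"
  proof (rule ccontr)
    assume "{a, c} \<notin> indeps M"
    moreover have "D \<in> indeps M" if "D \<subset> {a, c}" for D
    proof -
      have "D = {} \<or> D = {a} \<or> D = {c}" using that by blast
      then show ?thesis using s empty_indep by auto
    qed
    ultimately show False using n g by (auto simp: parallel_def is_circuit_def)
  qed
  from augmentation[OF s(2) this] \<open>a \<noteq> c\<close>
  obtain e where "e = a \<or> e = c" "{e, b} \<in> indeps M" by auto
  then have "{a, b} \<in> indeps M \<or> {b, c} \<in> indeps M"
    by (metis insert_commute)
  then show False using ab bc unfolding is_circuit_def by blast
qed

lemma (in matroid) simplification_exists: "\<exists>N. is_simplification M N"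
proof -
  define P where "P = {e \<in> ground M. \<not> is_loop M e}"
  define h where "h e = (SOME s. s \<in> P \<and> parallel M e s)" for e
  have sym: "parallel M e f \<longleftrightarrow> parallel M f e" for e f
    by (auto simp: parallel_def insert_commute)
  have h: "h e \<in> P \<and> parallel M e (h e)" if "e \<in> P" for e
    unfolding h_def by (rule someI[of _ e]) (use that in \<open>auto simp: parallel_def\<close>)
  have tr: "parallel M a c" if "parallel M a b" "parallel M b c" "a \<in> P" "b \<in> P" "c \<in> P" for a b c
    using parallel_trans that unfolding P_def by blast
  have eq: "h e = h f" if "parallel M e f" "e \<in> P" "f \<in> P" for e f
  proof -
    have "(s \<in> P \<and> parallel M e s) = (s \<in> P \<and> parallel M f s)" for s
      using tr sym that by metis
    then show ?thesis by (simp add: h_def)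
  qed
  have "\<exists>!s. s \<in> h ` P \<and> parallel M e s" if e: "e \<in> P" for e
  proof (rule ex1I[of _ "h e"])
    show "h e \<in> h ` P \<and> parallel M e (h e)" using h e by blast
  next
    fix s assume "s \<in> h ` P \<and> parallel M e s"
    then obtain f where f: "f \<in> P" "s = h f" "parallel M e (h f)" by auto
    then have "parallel M e f" using tr[of e "h f" f] sym h e by blast
    then show "s = h e" using eq f e by metis
  qed
  then have "\<forall>e\<in>ground M. \<not> is_loop M e \<longrightarrow> (\<exists>!s. s \<in> h ` P \<and> parallel M e s)"
    by (simp add: P_def)
  moreover have "h ` P \<subseteq> {e \<in> ground M. \<not> is_loop M e}" using h P_def by blast
  ultimately have "is_simplification M (matroid_restrict M (h ` P))"
    unfolding is_simplification_def by (intro exI[of _ "h ` P"] conjI refl)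
  then show ?thesis by blast
qed

section \<open>The polynomial ring and its fraction field\<close>

text \<open>
  The library proves that polynomials with variables in a type \<open>'v\<close> form an integral domain
  only for linearly ordered \<open>'v\<close>.  The variables \<open>z\<^sub>e\<close> therefore get a type of their own,
  carrying an arbitrary linear order that has no other purpose.
\<close>

datatype 'a var = Var (unvar: 'a)

definition var_order :: "('a \<times> 'a) set" where
  "var_order = (SOME r. well_order_on UNIV r)"

lemma var_order: "linear_order_on UNIV var_order"
proof -
  have "\<exists>r :: ('a \<times> 'a) set. well_order_on UNIV r" by (rule well_order_on)
  then have "well_order_on UNIV (var_order :: ('a \<times> 'a) set)"
    unfolding var_order_def by (rule someI_ex)
  then show ?thesis by (simp add: well_order_on_def)
qed

instantiation var :: (type) linorder
begin

definition less_eq_var :: "'a var \<Rightarrow> 'a var \<Rightarrow> bool" where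
  "x \<le> y \<longleftrightarrow> (unvar x, unvar y) \<in> var_order"

definition less_var :: "'a var \<Rightarrow> 'a var \<Rightarrow> bool" where
  "x < y \<longleftrightarrow> x \<le> y \<and> \<not> y \<le> (x :: 'a var)"

instance
proof
  have o: "refl (var_order :: ('a \<times> 'a) set)" "trans (var_order :: ('a \<times> 'a) set)"
    "antisym (var_order :: ('a \<times> 'a) set)" "total (var_order :: ('a \<times> 'a) set)"
    using var_order[where ?'a = 'a] by (simp_all add: order_on_defs)
  fix x y z :: "'a var"
  show "x < y \<longleftrightarrow> x \<le> y \<and> \<not> y \<le> x" by (rule less_var_def)
  show "x \<le> x" unfolding less_eq_var_def by (rule reflD[OF o(1)])
  show "x \<le> y \<Longrightarrow> y \<le> z \<Longrightarrow> x \<le> z"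
    unfolding less_eq_var_def by (rule transD[OF o(2)])
  show "x \<le> y \<Longrightarrow> y \<le> x \<Longrightarrow> x = y"
    unfolding less_eq_var_def by (rule var.expand) (rule antisymD[OF o(3)])
  show "x \<le> y \<or> y \<le> x"
    unfolding less_eq_var_def using o(1,4) by (metis refl_onD total_on_def UNIV_I)
qed

end

type_synonym 'a zpoly = "('a var \<Rightarrow>\<^sub>0 nat) \<Rightarrow>\<^sub>0 int"
type_synonym 'a zfrac = "'a zpoly fract"

definition zvar :: "'a \<Rightarrow> 'a zpoly" where
  "zvar e = Poly_Mapping.single (Poly_Mapping.single (Var e) 1) 1"

definition frac_of :: "'a zpoly \<Rightarrow> 'a zfrac" where
  "frac_of p = Fract p 1"

definition int_of_frac :: "'a zfrac \<Rightarrow> int" where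
  "int_of_frac q = (THE d. of_int d = q)"

lemma int_of_frac_of_int: "int_of_frac (of_int d :: 'a zfrac) = d"
proof -
  have nat: "(of_nat k :: 'a zfrac) = Fract (of_nat k) 1" for k
    by (induction k) (auto simp: Zero_fract_def One_fract_def)
  have int: "(of_int k :: 'a zfrac) = Fract (of_int k) 1" for k
    by (cases k rule: int_cases2) (auto simp: nat)
  have "k = l" if "(of_int k :: 'a zfrac) = of_int l" for k l
    using that by (simp add: int eq_fract)
  then show ?thesis unfolding int_of_frac_def by (intro the_equality) auto
qed

text \<open>The \<open>k\<close>-th elementary symmetric polynomial in the list \<open>v a\<close>, \<open>a \<in> A\<close>.\<close>

definition esym :: "nat \<Rightarrow> 'b set \<Rightarrow> ('b \<Rightarrow> 'c::comm_ring_1) \<Rightarrow> 'c" where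
  "esym k A v = (\<Sum>S | S \<subseteq> A \<and> card S = k. \<Prod>a\<in>S. v a)"

section \<open>The \<open>g\<close>-polynomial\<close>

text \<open>
  A total ordering of \<open>E\<close> is an element \<open>w\<close> of \<open>permutations_of_set E\<close>; list positions count
  from \<open>0\<close>, so \<open>w ! k\<close> is $w_{k+1}$.
\<close>

definition degree_of_family :: "'a set \<Rightarrow> ('a list \<Rightarrow> 'a zpoly) \<Rightarrow> 'a zfrac" where
  "degree_of_family E f = (\<Sum>w\<in>permutations_of_set E.
     frac_of (f w) / (\<Prod>i<card E - 1. frac_of (zvar (w ! i) - zvar (w ! Suc i))))"

definition greedy_basis :: "'a set_system \<Rightarrow> 'a list \<Rightarrow> 'a set" where
  "greedy_basis M w =
     {w ! k | k. k < length w \<and> rk M (set (take (Suc k) w)) > rk M (set (take k w))}"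

text \<open>
  \<open>g_class M i j\<close> is the family $\alpha^j e_{i-j-1}(-y) e_{r-i}(x) e_{n-r}(y)$, where \<open>x\<close> lists
  \<open>zvar b\<close> for \<open>b\<close> in the basis and \<open>y\<close> lists \<open>- zvar c\<close> for \<open>c\<close> outside it, so that \<open>-y\<close> lists \<open>zvar c\<close>.
\<close>

definition g_class :: "'a set_system \<Rightarrow> nat \<Rightarrow> nat \<Rightarrow> 'a list \<Rightarrow> 'a zpoly" where
  "g_class M i j w =
     (let r = matroid_rank M; n = card (ground M);
          B = greedy_basis M w; C = ground M - B;
          \<alpha> = - zvar (last w); x = zvar; y = (\<lambda>c. - zvar c)
      in \<alpha> ^ j * esym (i - j - 1) C (\<lambda>c. - y c) * esym (r - i) B x * esym (n - r) C y)"

text \<open>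
  The sum of degrees below is a rational function that is in fact an integer constant,
  which \<open>int_of_frac\<close> reads off.

  Since \<open>g_poly\<close> is \<open>0\<close> by convention in the presence of a coloop, \<open>omega M\<close> does not depend on
  the simplification of \<open>M\<close> alone: it is \<open>0\<close> for the uniform matroid of rank \<open>3\<close> on \<open>3\<close> elements,
  but \<open>1\<close> once each element is doubled.  A criterion for \<open>omega M = 0\<close> in terms of the
  simplification therefore has to list coloops separately.
\<close>

definition g_poly :: "'a set_system \<Rightarrow> int poly" where
  "g_poly M =
     (if ground M = {} then 1
      else if (\<exists>e. is_loop M e) \<or> (\<exists>e. is_coloop M e) then 0
      else (- 1) ^ num_components M *
        (\<Sum>i = 1..matroid_rank M. (- [:0, 1:]) ^ i *
           [: int_of_frac (\<Sum>j = 0..i - 1. degree_of_family (ground M) (g_class M i j)) :]))"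

definition omega :: "'a set_system \<Rightarrow> int" where
  "omega M = coeff (g_poly M) (matroid_rank M)"

end

theory Submission
  imports Defs
begin

text \<open>
  Since \<open>M\<close> has no coloop, the last element \<open>l\<close> of an ordering \<open>w\<close> lies outside \<open>B\<^sub>w\<close>, and
  $\sum_j \alpha^j e_{r-1-j}(-y)$ is $e_{r-1}$ of the remaining elements outside \<open>B\<^sub>w\<close>, the coefficient
  of $u^{r-1}$ in $\prod (1 + u z_c)$.  For fixed \<open>u\<close>, the sum over all orderings is computed recursively: processing
  the ordering from the end, partial fractions collapse the elements in the span of an initial segment,
  and only a sum over complete flags of flats remains.  In rank 3 the flag sum is again evaluated by
  partial fractions, and \<open>\<omega>\<close> becomes, up to the sign given by the number of components, an
  explicit integer.

  In terms of the \<open>p\<close> points and the line sizes $m_L$ of the simplification, this integer is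
  $\binom{p-4}{2} - \sum_L \binom{m_L-2}{2}$.  When every line misses at least two points, \<open>M\<close> is
  connected.  For a line of size \<open>m\<close>, counting the pairs of points off it bounds the integer below by
  \<open>(m - 3) (p - m - 2)\<close>, so that it vanishes only if \<open>m = p - 2\<close> once \<open>m \<ge> 4\<close>; if all lines have size
  at most 3, it is $\binom{p-4}{2}$.  The remaining cases, a line missing one point, are the
  disconnected matroids, where the number of components enters the sign.
\<close>

section \<open>Partial fractions\<close>

text \<open>The parameter \<open>u\<close> is a scalar of the field, not a polynomial variable,
  because the factor \<open>1 + u * z l\<close> of the last element \<open>l\<close> must be divided
  out; \<open>u\<close> ranges over the values where no such factor vanishes, and over an infinite
  field these determine the polynomial. What keeps the recursion closed is a degree count. A set
  \<open>X\<close> of spanned elements, each contributing the numerator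
  \<open>- z q * (1 + u * z q)\<close>, is absorbed by the element \<open>y\<close> before it and
  leaves \<open>(1 + u * z y) ^ card X * pole_prod z X (z y)\<close>, which has the right shape to
  be absorbed in turn. Partial fractions allow a numerator of degree at most the number of poles.
  This bound is met exactly: either the generator of the next flat supplies one more pole, or the
  ordering ends within the span and the missing factor of its last element lowers the degree by one.
  The variables disappear at the very end because \<open>pole_prod\<close> is normalised at 0: over
  the elements of any nonempty finite set, the pole products of the remaining elements sum to 1. The
  sizes of the parallel classes survive this and have to be eliminated by double counting.\<close>

lemma partial_fractions:
  fixes A :: "'k::field set"
  assumes fin: "finite A" and y: "y \<notin> A" and deg: "degree p < card A"
  shows "poly p y / (\<Prod>a\<in>A. y - a) = (\<Sum>a\<in>A. poly p a / ((y - a) * (\<Prod>b\<in>A - {a}. a - b)))"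
proof -
  define d where "d a = (\<Prod>b\<in>A - {a}. a - b)" for a
  have d: "d a \<noteq> 0" for a unfolding d_def using fin by (subst prod_zero_iff) auto
  \<comment> \<open>\<open>q\<close> is the Lagrange interpolant of \<open>p\<close> at the nodes
    \<open>A\<close>. Both polynomials have degree below \<open>card A\<close> and agree on
    \<open>A\<close>, so they coincide; dividing by the product of all \<open>y - a\<close> gives
    the claim.\<close>
  define q where "q = (\<Sum>a\<in>A. smult (poly p a / d a) (\<Prod>b\<in>A - {a}. [:- b, 1:]))"
  have pq: "poly q x = (\<Sum>a\<in>A. poly p a / d a * (\<Prod>b\<in>A - {a}. x - b))" for x
    by (simp add: q_def poly_sum poly_prod)
  have "degree (smult (poly p a / d a) (\<Prod>b\<in>A - {a}. [:- b, 1:])) < card A" if "a \<in> A" for a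
  proof -
    have "degree (smult (poly p a / d a) (\<Prod>b\<in>A - {a}. [:- b, 1:]))
        \<le> degree (\<Prod>b\<in>A - {a}. [:- b, 1:])" by (rule degree_smult_le)
    also have "\<dots> \<le> sum (degree \<circ> (\<lambda>b. [:- b, 1:])) (A - {a})"
      using fin by (intro degree_prod_sum_le) auto
    also have "\<dots> = card (A - {a})" by (simp add: o_def)
    also have "\<dots> < card A" using fin that by (rule card_Diff1_less)
    finally show ?thesis .
  qed
  then have "degree q < card A"
    unfolding q_def using deg by (intro degree_sum_less) auto
  moreover have "poly p x = poly q x" if x: "x \<in> A" for x
  proof -
    have "(\<Prod>b\<in>A - {a}. x - b) = (if a = x then d x else 0)" if "a \<in> A" for a
      using x that fin unfolding d_def by (auto intro!: prod_zero)
    then have "poly q x = (\<Sum>a\<in>A. if a = x then poly p x else 0)"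
      unfolding pq using d by (intro sum.cong) auto
    then show ?thesis using fin x by simp
  qed
  ultimately have "p = q" using deg by (intro poly_eqI_degree[of A]) auto
  then have "poly p y / (\<Prod>a\<in>A. y - a)
      = (\<Sum>a\<in>A. poly p a / d a * (\<Prod>b\<in>A - {a}. y - b) / (\<Prod>a\<in>A. y - a))"
    using pq[of y] by (simp add: sum_divide_distrib)
  also have "\<dots> = (\<Sum>a\<in>A. poly p a / ((y - a) * d a))"
  proof (rule sum.cong[OF refl])
    fix a assume a: "a \<in> A"
    have "(\<Prod>b\<in>A. y - b) = (y - a) * (\<Prod>b\<in>A - {a}. y - b)"
      using fin a by (rule prod.remove)
    moreover have "(\<Prod>b\<in>A - {a}. y - b) \<noteq> 0" using fin y by (subst prod_zero_iff) auto
    moreover have "y - a \<noteq> 0" using a y by auto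
    ultimately show "poly p a / d a * (\<Prod>b\<in>A - {a}. y - b) / (\<Prod>a\<in>A. y - a)
        = poly p a / ((y - a) * d a)" using d[of a] by simp
  qed
  finally show ?thesis by (simp add: d_def)
qed

text \<open>The reciprocal of the product of all \<open>z a - y\<close>, scaled to take the value 1
  at \<open>y = 0\<close> when the \<open>z a\<close> are nonzero.\<close>

definition pole_prod :: "('a \<Rightarrow> 'k::field) \<Rightarrow> 'a set \<Rightarrow> 'k \<Rightarrow> 'k" where
  "pole_prod z A y = (\<Prod>a\<in>A. z a / (z a - y))"

lemma pole_prod_eq:
  "finite A \<Longrightarrow> pole_prod (\<lambda>a. a) A y = (\<Prod>a\<in>A. - a) / (\<Prod>a\<in>A. y - a)" for A :: "'k::field set"
  unfolding pole_prod_def prod_dividef[symmetric]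
  by (intro prod.cong refl) (metis minus_diff_eq minus_divide_divide)

text \<open>Partial fractions with the node 0 adjoined to \<open>A\<close>: the additional pole
  admits numerators of degree up to \<open>card A\<close> and produces the term
  \<open>poly p 0 / y\<close>.\<close>

lemma pole_prod_pole_set:
  fixes A :: "'k::field set"
  assumes fin: "finite A" and 0: "0 \<notin> A" and y: "y \<notin> A" "y \<noteq> 0" and deg: "degree p \<le> card A"
  shows "(\<Sum>a\<in>A. poly p a * pole_prod (\<lambda>a. a) (A - {a}) a / (y - a)) = (poly p 0 - poly p y * pole_prod (\<lambda>a. a) A y) / y"
proof -
  define N where "N = (\<Prod>a\<in>A. - a)"
  have N: "N \<noteq> 0" unfolding N_def using fin 0 by (subst prod_zero_iff) auto
  have D: "(\<Prod>a\<in>A. y - a) \<noteq> 0" using fin y by (subst prod_zero_iff) auto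
  have "poly p y / (\<Prod>a\<in>insert 0 A. y - a)
      = (\<Sum>a\<in>insert 0 A. poly p a / ((y - a) * (\<Prod>b\<in>insert 0 A - {a}. a - b)))"
    using fin 0 y deg by (intro partial_fractions) auto
  also have "\<dots> = poly p 0 / (y * N)
      + (\<Sum>a\<in>A. poly p a / ((y - a) * (\<Prod>b\<in>insert 0 A - {a}. a - b)))"
    using fin 0 by (simp add: N_def)
  also have "(\<Sum>a\<in>A. poly p a / ((y - a) * (\<Prod>b\<in>insert 0 A - {a}. a - b)))
      = (\<Sum>a\<in>A. - (poly p a * pole_prod (\<lambda>a. a) (A - {a}) a / (y - a)) / N)"
  proof (rule sum.cong[OF refl])
    fix a assume a: "a \<in> A"
    have nz: "(\<Prod>b\<in>A - {a}. a - b) \<noteq> 0" "(\<Prod>b\<in>A - {a}. - b) \<noteq> 0" "a \<noteq> 0" "y - a \<noteq> 0"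
      using fin 0 a y by (auto simp: prod_zero_iff)
    have "insert 0 A - {a} = insert 0 (A - {a})" using 0 a by auto
    then have "(\<Prod>b\<in>insert 0 A - {a}. a - b) = a * (\<Prod>b\<in>A - {a}. a - b)"
      using fin 0 by simp
    moreover have "N = - a * (\<Prod>b\<in>A - {a}. - b)"
      unfolding N_def using fin a by (rule prod.remove)
    moreover have "pole_prod (\<lambda>a. a) (A - {a}) a = (\<Prod>b\<in>A - {a}. - b) / (\<Prod>b\<in>A - {a}. a - b)"
      using fin by (intro pole_prod_eq) auto
    ultimately show "poly p a / ((y - a) * (\<Prod>b\<in>insert 0 A - {a}. a - b))
        = - (poly p a * pole_prod (\<lambda>a. a) (A - {a}) a / (y - a)) / N"
      using nz by (simp add: field_simps)
  qed
  also have "\<dots> = - (\<Sum>a\<in>A. poly p a * pole_prod (\<lambda>a. a) (A - {a}) a / (y - a)) / N"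
    by (simp add: sum_negf sum_divide_distrib)
  finally have *: "poly p y / (y * (\<Prod>a\<in>A. y - a))
      = poly p 0 / (y * N) - (\<Sum>a\<in>A. poly p a * pole_prod (\<lambda>a. a) (A - {a}) a / (y - a)) / N"
    using fin 0 by simp
  have "pole_prod (\<lambda>a. a) A y = N / (\<Prod>a\<in>A. y - a)" unfolding N_def using fin by (rule pole_prod_eq)
  then have "(poly p 0 - poly p y * pole_prod (\<lambda>a. a) A y) / y
      = N * (poly p 0 / (y * N) - poly p y / (y * (\<Prod>a\<in>A. y - a)))"
    using N y by (simp add: field_simps)
  then show ?thesis unfolding * using N by simp
qed

lemma coeff_1_prod_linear:
  "finite A \<Longrightarrow> coeff (\<Prod>a\<in>A. [:1, c a:]) (Suc 0) = (\<Sum>a\<in>A. c a) \<and> coeff (\<Prod>a\<in>A. [:1, c a:]) 0 = 1"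
  for c :: "'b \<Rightarrow> 'k::comm_ring_1"
  by (induction A rule: finite_induct) (auto simp: coeff_pCons split: nat.splits)

text \<open>The extra factor \<open>1 / a\<close> is absorbed by dividing the numerator by the
  variable, once the numerator has been changed, without affecting its values on \<open>A\<close>,
  so that it vanishes at 0.\<close>

lemma pole_prod_double_pole_set:
  fixes A :: "'k::field set"
  assumes fin: "finite A" and 0: "0 \<notin> A" and y: "y \<notin> A" "y \<noteq> 0"
    and deg: "degree p \<le> Suc (card A)"
  shows "(\<Sum>a\<in>A. poly p a * pole_prod (\<lambda>a. a) (A - {a}) a / (a * (y - a)))
    = (poly p 0 - poly p y * pole_prod (\<lambda>a. a) A y) / y\<^sup>2 + (coeff p 1 + poly p 0 * (\<Sum>a\<in>A. 1 / a)) / y"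
proof -
  \<comment> \<open>The polynomial whose value at \<open>y\<close> is the inverse of the pole
    product: it vanishes on \<open>A\<close>, is 1 at 0, and its linear coefficient is the origin of
    the sum of reciprocals in the result.\<close>
  define D where "D = (\<Prod>a\<in>A. [:1, - 1 / a:])"
  have c1: "coeff D (Suc 0) = - (\<Sum>a\<in>A. 1 / a)" and c0: "coeff D 0 = 1"
    using coeff_1_prod_linear[OF fin, of "\<lambda>a. - 1 / a"] by (simp_all add: D_def sum_negf)
  have Da: "poly D a = 0" if "a \<in> A" for a
    unfolding D_def poly_prod using that fin 0 by (intro prod_zero) (auto intro!: bexI[of _ a])
  have Dy: "poly D y * pole_prod (\<lambda>a. a) A y = 1"
  proof -
    have "poly D y * pole_prod (\<lambda>a. a) A y = (\<Prod>a\<in>A. (1 - y / a) * (a / (a - y)))"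
      unfolding D_def poly_prod pole_prod_def prod.distrib by simp
    also have "\<dots> = (\<Prod>a\<in>A. 1)"
      using 0 y by (intro prod.cong) (auto simp: field_simps)
    finally show ?thesis by simp
  qed
  have dD: "degree D \<le> card A"
  proof -
    have "degree D \<le> sum (degree \<circ> (\<lambda>a. [:1, - 1 / a:])) A"
      unfolding D_def using fin by (rule degree_prod_sum_le)
    also have "\<dots> \<le> (\<Sum>a\<in>A. 1)" by (intro sum_mono) simp
    finally show ?thesis by simp
  qed
  \<comment> \<open>\<open>h\<close> agrees with \<open>p\<close> on \<open>A\<close> and vanishes
    at 0, so \<open>h\<close> is the variable times some \<open>g\<close> of degree at most
    \<open>card A\<close>, to which the simple-pole formula applies.\<close>
  define h where "h = p - smult (poly p 0) D"
  have "coeff h 0 = 0" by (simp add: h_def c0 poly_0_coeff_0)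
  then obtain g where g: "h = pCons 0 g" by (metis coeff_pCons_0 pCons_cases)
  have "degree h \<le> Suc (card A)"
    unfolding h_def using deg dD by (intro degree_diff_le) (auto intro: le_trans[OF degree_smult_le])
  then have dg: "degree g \<le> card A" unfolding g by (cases "g = 0") auto
  have hx: "x * poly g x = poly p x - poly p 0 * poly D x" for x
  proof -
    have "poly h x = x * poly g x" by (simp add: g)
    then show ?thesis by (simp add: h_def)
  qed
  have "(\<Sum>a\<in>A. poly p a * pole_prod (\<lambda>a. a) (A - {a}) a / (a * (y - a)))
      = (\<Sum>a\<in>A. poly g a * pole_prod (\<lambda>a. a) (A - {a}) a / (y - a))"
  proof (rule sum.cong[OF refl])
    fix a assume a: "a \<in> A"
    then have "poly p a = a * poly g a" using hx[of a] Da by simp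
    moreover have "a \<noteq> 0" using a 0 by auto
    ultimately show "poly p a * pole_prod (\<lambda>a. a) (A - {a}) a / (a * (y - a))
        = poly g a * pole_prod (\<lambda>a. a) (A - {a}) a / (y - a)" by simp
  qed
  also have "\<dots> = (poly g 0 - poly g y * pole_prod (\<lambda>a. a) A y) / y"
    using assms dg by (intro pole_prod_pole_set)
  also have "poly g 0 = coeff p 1 + poly p 0 * (\<Sum>a\<in>A. 1 / a)"
  proof -
    have "poly g 0 = coeff h (Suc 0)" by (simp add: g poly_0_coeff_0)
    then show ?thesis by (simp add: h_def c1)
  qed
  also have "poly g y * pole_prod (\<lambda>a. a) A y = (poly p y * pole_prod (\<lambda>a. a) A y - poly p 0) / y"
  proof -
    have "y * (poly g y * pole_prod (\<lambda>a. a) A y) = (y * poly g y) * pole_prod (\<lambda>a. a) A y" by simp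
    also have "\<dots> = poly p y * pole_prod (\<lambda>a. a) A y - poly p 0 * (poly D y * pole_prod (\<lambda>a. a) A y)"
      unfolding hx by (simp add: algebra_simps)
    finally have "y * (poly g y * pole_prod (\<lambda>a. a) A y) = poly p y * pole_prod (\<lambda>a. a) A y - poly p 0"
      using Dy by simp
    then show ?thesis using y by (metis nonzero_mult_div_cancel_left)
  qed
  also have "(c - (P - q) / y) / y = (q - P) / y\<^sup>2 + c / y" for c P q
    using y by (simp add: field_simps power2_eq_square)
  finally show ?thesis .
qed

text \<open>Partial fractions of the constant 1, evaluated at the point 0.\<close>

lemma sum_pole_prod_set:
  fixes A :: "'k::field set"
  assumes fin: "finite A" and 0: "0 \<notin> A" and ne: "A \<noteq> {}"
  shows "(\<Sum>a\<in>A. pole_prod (\<lambda>a. a) (A - {a}) a) = 1"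
proof -
  define N where "N = (\<Prod>a\<in>A. - a)"
  have N: "N \<noteq> 0" unfolding N_def using fin 0 by (subst prod_zero_iff) auto
  have "(\<Sum>a\<in>A. pole_prod (\<lambda>a. a) (A - {a}) a)
      = (\<Sum>a\<in>A. N * (poly 1 a / ((0 - a) * (\<Prod>b\<in>A - {a}. a - b))))"
  proof (rule sum.cong[OF refl])
    fix a assume a: "a \<in> A"
    have "N = - a * (\<Prod>b\<in>A - {a}. - b)" unfolding N_def using fin a by (rule prod.remove)
    moreover have "a \<noteq> 0" using a 0 by auto
    ultimately show "pole_prod (\<lambda>a. a) (A - {a}) a = N * (poly 1 a / ((0 - a) * (\<Prod>b\<in>A - {a}. a - b)))"
      using fin by (subst pole_prod_eq) (auto simp: field_simps)
  qed
  also have "\<dots> = N * (poly 1 0 / (\<Prod>a\<in>A. 0 - a))"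
    unfolding sum_distrib_left[symmetric] using assms
    by (subst partial_fractions) (auto simp: card_gt_0_iff)
  finally show ?thesis using N by (simp add: N_def)
qed

context
  fixes z :: "'a \<Rightarrow> 'k::field" and A :: "'a set"
  assumes fin: "finite A" and inj: "inj_on z A" and nz: "0 \<notin> z ` A"
begin

lemma pole_prod_image: "B \<subseteq> A \<Longrightarrow> pole_prod (\<lambda>a. a) (z ` B) y = pole_prod z B y"
  unfolding pole_prod_def using inj by (subst prod.reindex) (auto intro: inj_on_subset)

lemma pole_prod_image_remove: "a \<in> A \<Longrightarrow> pole_prod (\<lambda>a. a) (z ` A - {z a}) y = pole_prod z (A - {a}) y"
  using inj by (subst pole_prod_image[symmetric]) (auto simp: inj_on_image_set_diff[of z A])

lemma sum_pole_prod_pole: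
  assumes "y \<notin> z ` A" "y \<noteq> 0" "degree p \<le> card A"
  shows "(\<Sum>a\<in>A. poly p (z a) * pole_prod z (A - {a}) (z a) / (y - z a))
    = (poly p 0 - poly p y * pole_prod z A y) / y"
  using pole_prod_pole_set[of "z ` A" y p] assms fin nz inj
  by (simp add: sum.reindex card_image pole_prod_image pole_prod_image_remove)

lemma sum_pole_prod_double_pole:
  assumes "y \<notin> z ` A" "y \<noteq> 0" "degree p \<le> Suc (card A)"
  shows "(\<Sum>a\<in>A. poly p (z a) * pole_prod z (A - {a}) (z a) / (z a * (y - z a)))
    = (poly p 0 - poly p y * pole_prod z A y) / y\<^sup>2 + (coeff p 1 + poly p 0 * (\<Sum>a\<in>A. 1 / z a)) / y"
  using pole_prod_double_pole_set[of "z ` A" y p] assms fin nz inj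
  by (simp add: sum.reindex card_image pole_prod_image pole_prod_image_remove)

lemma sum_pole_prod: "A \<noteq> {} \<Longrightarrow> (\<Sum>a\<in>A. pole_prod z (A - {a}) (z a)) = 1"
  using sum_pole_prod_set[of "z ` A"] fin nz inj
  by (simp add: sum.reindex pole_prod_image_remove)

end

section \<open>Rank and closure\<close>

context matroid
begin

definition closure :: "'a set \<Rightarrow> 'a set" where
  "closure X = {e \<in> ground M. rk M (insert e X) = rk M X}"

lemma finite_indeps: "finite {I \<in> indeps M. I \<subseteq> X}"
  by (rule finite_subset[of _ "Pow (ground M)"]) (use indeps_subset finite_ground in auto)

lemma card_le_rk: "I \<in> indeps M \<Longrightarrow> I \<subseteq> X \<Longrightarrow> card I \<le> rk M X"
  unfolding rk_def using finite_indeps[of X] by (intro Max_ge) auto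

lemma rk_witness: obtains I where "I \<in> indeps M" "I \<subseteq> X" "card I = rk M X"
proof -
  have "rk M X \<in> card ` {I \<in> indeps M. I \<subseteq> X}"
    unfolding rk_def using finite_indeps[of X] empty_indep by (intro Max_in) auto
  then show ?thesis using that by auto
qed

lemma finite_indep: "I \<in> indeps M \<Longrightarrow> finite I"
  using indeps_subset[of I] finite_subset[OF _ finite_ground] by simp

lemma indep_extend:
  assumes "I \<in> indeps M" "I \<subseteq> X"
  obtains J where "J \<in> indeps M" "I \<subseteq> J" "J \<subseteq> X" "card J = rk M X"
proof -
  have "\<exists>J\<in>indeps M. I \<subseteq> J \<and> J \<subseteq> X \<and> card J = rk M X"
    using assms
  proof (induction "rk M X - card I" arbitrary: I rule: less_induct)
    case less
    show ?case
    proof (cases "card I = rk M X")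
      case True
      then show ?thesis using less(2,3) by blast
    next
      case False
      then have lt: "card I < rk M X" using card_le_rk[OF less(2,3)] by simp
      obtain K where K: "K \<in> indeps M" "K \<subseteq> X" "card K = rk M X" by (rule rk_witness)
      obtain e where e: "e \<in> K - I" "insert e I \<in> indeps M"
        using augmentation[of I K] less(2) K lt by auto
      have "card (insert e I) = Suc (card I)"
        using e finite_indep[OF less(2)] by auto
      then have "rk M X - card (insert e I) < rk M X - card I" using lt by simp
      from less(1)[OF this e(2)] e(1) K(2) less(3) show ?thesis by blast
    qed
  qed
  then show ?thesis using that by auto
qed

lemma rk_mono:
  assumes "X \<subseteq> Y"
  shows "rk M X \<le> rk M Y"
proof -
  obtain I where "I \<in> indeps M" "I \<subseteq> X" "card I = rk M X" by (rule rk_witness)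
  then show ?thesis using card_le_rk[of I Y] assms by auto
qed

lemma rk_le_card:
  assumes "finite X"
  shows "rk M X \<le> card X"
proof -
  obtain I where "I \<in> indeps M" "I \<subseteq> X" "card I = rk M X" by (rule rk_witness)
  then show ?thesis using card_mono[OF assms, of I] by auto
qed

lemma rk_indep: "I \<in> indeps M \<Longrightarrow> rk M I = card I"
  using card_le_rk[of I I] rk_le_card[of I] finite_indep by fastforce

lemma indep_iff_rk: "X \<subseteq> ground M \<Longrightarrow> X \<in> indeps M \<longleftrightarrow> rk M X = card X"
proof
  assume X: "X \<subseteq> ground M" "rk M X = card X"
  then have fin: "finite X" using finite_subset[OF _ finite_ground] by simp
  obtain I where I: "I \<in> indeps M" "I \<subseteq> X" "card I = rk M X" by (rule rk_witness)
  then have "I = X" using fin X card_subset_eq by metis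
  then show "X \<in> indeps M" using I by simp
qed (rule rk_indep)

lemma rk_empty [simp]: "rk M {} = 0"
  using rk_indep[OF empty_indep] by simp

lemma rk_insert_le: "rk M (insert e X) \<le> Suc (rk M X)"
proof -
  obtain I where I: "I \<in> indeps M" "I \<subseteq> insert e X" "card I = rk M (insert e X)"
    by (rule rk_witness)
  have "card (I - {e}) \<le> rk M X"
    using I indep_mono[of I "I - {e}"] by (intro card_le_rk) auto
  moreover have "card I \<le> Suc (card (I - {e}))"
    by (simp add: card_Diff_singleton_if) linarith
  ultimately show ?thesis using I by simp
qed

lemma rk_insert_cases:
  assumes "e \<in> ground M"
  shows "rk M (insert e X) = (if e \<in> closure X then rk M X else Suc (rk M X))"
  using rk_insert_le[of e X] rk_mono[OF subset_insertI[of X e]] assms by (auto simp: closure_def)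

lemma closure_subset_ground: "closure X \<subseteq> ground M"
  by (auto simp: closure_def)

lemma finite_closure [simp]: "finite (closure X)"
  using finite_subset[OF closure_subset_ground finite_ground] .

lemma subset_closure: "X \<subseteq> ground M \<Longrightarrow> X \<subseteq> closure X"
  by (auto simp: closure_def insert_absorb)

text \<open>If \<open>e\<close> raised the rank of \<open>Y\<close> but not of \<open>X\<close>,
  then a maximal independent subset of \<open>Y\<close> extending one of \<open>X\<close> could be
  augmented only by \<open>e\<close>; restricting to \<open>X\<close> shows that \<open>e\<close>
  raises the rank of \<open>X\<close> as well.\<close>

lemma closure_mono:
  assumes "X \<subseteq> Y"
  shows "closure X \<subseteq> closure Y"
proof
  fix e assume e: "e \<in> closure X"
  then have eg: "e \<in> ground M" and r: "rk M (insert e X) = rk M X" by (auto simp: closure_def)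
  show "e \<in> closure Y"
  proof (rule ccontr)
    assume "e \<notin> closure Y"
    then have r2: "rk M (insert e Y) = Suc (rk M Y)" using rk_insert_cases eg by simp
    obtain I where I: "I \<in> indeps M" "I \<subseteq> X" "card I = rk M X" by (rule rk_witness)
    then obtain J where J: "J \<in> indeps M" "I \<subseteq> J" "J \<subseteq> Y" "card J = rk M Y"
      using indep_extend[of I Y] assms by blast
    obtain K where K: "K \<in> indeps M" "K \<subseteq> insert e Y" "card K = rk M (insert e Y)"
      by (rule rk_witness)
    obtain f where f: "f \<in> K - J" "insert f J \<in> indeps M"
      using augmentation[of J K] J K r2 by auto
    have "card (insert f J) = Suc (rk M Y)" using f J finite_indep by auto
    then have "\<not> insert f J \<subseteq> Y" using card_le_rk[OF f(2)] by fastforce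
    then have "f = e" using f K J by auto
    then have "insert e I \<in> indeps M" using f indep_mono J by (metis insert_mono)
    moreover have "e \<notin> I" using f \<open>f = e\<close> J by auto
    ultimately show False
      using card_le_rk[of "insert e I" "insert e X"] I r finite_indep[OF I(1)] by auto
  qed
qed

lemma rk_subset_closure:
  assumes "X \<subseteq> Y" "Y \<subseteq> X \<union> closure X"
  shows "rk M Y = rk M X"
proof -
  have fin: "finite (Y - X)" using assms(2) by (intro finite_subset[OF _ finite_closure[of X]]) auto
  have "rk M (X \<union> D) = rk M X" if "finite D" "D \<subseteq> closure X" for D
    using that
  proof (induction D rule: finite_induct)
    case (insert d D)
    then have "d \<in> closure (X \<union> D)" using closure_mono[of X "X \<union> D"] by auto
    then show ?case using insert by (simp add: closure_def)
  qed simp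
  from this[OF fin] assms have "rk M (X \<union> (Y - X)) = rk M X" by blast
  moreover have "X \<union> (Y - X) = Y" using assms by auto
  ultimately show ?thesis by simp
qed

lemma rk_closure [simp]: "X \<subseteq> ground M \<Longrightarrow> rk M (closure X) = rk M X"
  using subset_closure by (intro rk_subset_closure) auto

lemma closure_closure [simp]:
  assumes X: "X \<subseteq> ground M"
  shows "closure (closure X) = closure X"
proof
  show "closure (closure X) \<subseteq> closure X"
  proof
    fix e assume e: "e \<in> closure (closure X)"
    then have "e \<in> ground M \<and> rk M (insert e (closure X)) = rk M (closure X)"
      unfolding closure_def[of "closure X"] by blast
    then have r: "e \<in> ground M" "rk M (insert e (closure X)) = rk M X"
      using rk_closure[OF X] by auto
    moreover have "rk M (insert e X) \<le> rk M (insert e (closure X))"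
      using subset_closure[OF X] by (intro rk_mono) auto
    ultimately show "e \<in> closure X"
      using r rk_mono[OF subset_insertI[of X e]] by (auto simp: closure_def)
  qed
  show "closure X \<subseteq> closure (closure X)" using subset_closure[OF X] by (rule closure_mono)
qed

lemma closure_insert_closure:
  assumes "X \<subseteq> ground M" "b \<in> ground M"
  shows "closure (insert b (closure X)) = closure (insert b X)"
proof
  have g: "insert b X \<subseteq> ground M" using assms by simp
  have "insert b (closure X) \<subseteq> closure (insert b X)"
    using subset_closure[OF g] closure_mono[OF subset_insertI[of X b]] by blast
  from closure_mono[OF this] show "closure (insert b (closure X)) \<subseteq> closure (insert b X)"
    unfolding closure_closure[OF g] .
  show "closure (insert b X) \<subseteq> closure (insert b (closure X))"
    using subset_closure[OF assms(1)] by (intro closure_mono) auto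
qed

lemma closure_insert_mem:
  assumes "X \<subseteq> ground M" "b \<in> closure X"
  shows "closure (insert b X) = closure X"
proof
  have "closure (insert b X) \<subseteq> closure (closure X)"
    using assms subset_closure by (intro closure_mono) auto
  then show "closure (insert b X) \<subseteq> closure X" using assms by simp
qed (rule closure_mono[OF subset_insertI])

lemma closure_eq_ground:
  assumes "rk M X = matroid_rank M" "X \<subseteq> ground M"
  shows "closure X = ground M"
proof
  show "ground M \<subseteq> closure X"
  proof
    fix e assume e: "e \<in> ground M"
    then have "rk M (insert e X) \<le> rk M X"
      using assms rk_mono[of "insert e X" "ground M"] by (simp add: matroid_rank_def)
    then show "e \<in> closure X" using e rk_mono[OF subset_insertI[of X e]] by (auto simp: closure_def)
  qed
qed (rule closure_subset_ground)

lemma rk_le_matroid_rank: "X \<subseteq> ground M \<Longrightarrow> rk M X \<le> matroid_rank M"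
  unfolding matroid_rank_def by (rule rk_mono)

lemma is_flat_iff_closure: "is_flat M F \<longleftrightarrow> F \<subseteq> ground M \<and> closure F = F"
proof
  assume F: "is_flat M F"
  then have "F \<subseteq> ground M" by (simp add: is_flat_def)
  moreover have "closure F \<subseteq> F" using F by (force simp: is_flat_def closure_def)
  ultimately show "F \<subseteq> ground M \<and> closure F = F" using subset_closure by auto
next
  assume F: "F \<subseteq> ground M \<and> closure F = F"
  then show "is_flat M F"
    unfolding is_flat_def using rk_insert_cases[of _ F] by auto
qed

lemma closure_eq_flat:
  assumes "is_flat M F" "X \<subseteq> F" "rk M F \<le> rk M X"
  shows "closure X = F"
proof
  have F: "F \<subseteq> ground M" "closure F = F" using assms(1) is_flat_iff_closure by auto
  show "closure X \<subseteq> F" using closure_mono[OF assms(2)] F by simp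
  show "F \<subseteq> closure X"
  proof
    fix e assume e: "e \<in> F"
    have "rk M (insert e X) \<le> rk M F" using e assms(2) by (intro rk_mono) auto
    then show "e \<in> closure X"
      using assms(3) rk_mono[OF subset_insertI[of X e]] e F by (auto simp: closure_def)
  qed
qed

end

section \<open>Sums over greedy orderings\<close>

lemma pole_prod_insert: "finite A \<Longrightarrow> a \<notin> A \<Longrightarrow> pole_prod z (insert a A) y = z a / (z a - y) * pole_prod z A y"
  by (simp add: pole_prod_def)

lemma pole_prod_Un_disjoint:
  "finite A \<Longrightarrow> finite B \<Longrightarrow> A \<inter> B = {} \<Longrightarrow> pole_prod z (A \<union> B) y = pole_prod z A y * pole_prod z B y"
  by (simp add: pole_prod_def prod.union_disjoint)

lemma sum_permutations_of_set_Cons: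
  assumes "finite A" "A \<noteq> {}"
  shows "(\<Sum>w\<in>permutations_of_set A. f w)
    = (\<Sum>q\<in>A. \<Sum>w\<in>permutations_of_set (A - {q}). f (q # w))"
proof -
  have "(\<Sum>w\<in>permutations_of_set A. f w)
      = (\<Sum>q\<in>A. sum f ((#) q ` permutations_of_set (A - {q})))"
    unfolding permutations_of_set_nonempty[OF assms(2)]
    using assms by (intro sum.UNION_disjoint) auto
  also have "\<dots> = (\<Sum>q\<in>A. \<Sum>w\<in>permutations_of_set (A - {q}). f (q # w))"
    by (rule sum.cong[OF refl]) (simp add: sum.reindex)
  finally show ?thesis .
qed

lemma degree_linear_power: "degree ([:1, u:] ^ k) \<le> k" for u :: "'k::field"
proof -
  have "degree ([:1, u:] ^ k) \<le> degree [:1, u:] * k" by (rule degree_power_le)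
  also have "\<dots> \<le> 1 * k" by (intro mult_le_mono1) simp
  finally show ?thesis by simp
qed

text \<open>The numerator \<open>- x * (1 + u * x) ^ m\<close> vanishes at 0, so the adjoined pole
  contributes nothing; \<open>m < card X\<close> is exactly the degree bound. The identity moves the
  factors of the elements \<open>X\<close> onto the element \<open>y\<close> preceding them.\<close>

lemma sum_pole_prod_shift:
  fixes z :: "'a \<Rightarrow> 'k::field"
  assumes fin: "finite X" and inj: "inj_on z X" and nz: "0 \<notin> z ` X"
    and y: "y \<notin> z ` X" "y \<noteq> 0" and m: "m < card X"
  shows "(\<Sum>q\<in>X. - z q * (1 + u * z q) ^ m * pole_prod z (X - {q}) (z q) / (y - z q))
    = (1 + u * y) ^ m * pole_prod z X y"
proof -
  define p where "p = - pCons 0 ([:1, u:] ^ m)"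
  have pp: "poly p x = - (x * (1 + u * x) ^ m)" for x by (simp add: p_def mult.commute)
  have "degree p \<le> Suc (degree ([:1, u:] ^ m))"
    unfolding p_def degree_minus by (rule degree_pCons_le)
  also have "\<dots> \<le> Suc m" using degree_linear_power by simp
  finally have "degree p \<le> card X" using m by simp
  from sum_pole_prod_pole[OF fin inj nz y this] show ?thesis
    using y unfolding pp by simp
qed

text \<open>The previous identity for \<open>insert b X\<close>, with the common factor
  \<open>- z b\<close> cancelled. Here \<open>b\<close> stands for the generator of the next flat:
  its pole admits the exponent \<open>card X\<close>, and its own summand is the case where
  \<open>b\<close> follows \<open>y\<close> directly.\<close>

lemma sum_pole_prod_shift_two:
  fixes z :: "'a \<Rightarrow> 'k::field"
  assumes fin: "finite X" and inj: "inj_on z X" and nz: "0 \<notin> z ` X"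
    and y: "y \<notin> z ` X" "y \<noteq> 0"
    and b: "b \<notin> X" "z b \<noteq> 0" "z b \<notin> z ` X" "z b \<noteq> y"
  shows "(\<Sum>q\<in>X. - z q * (1 + u * z q) ^ card X * pole_prod z (X - {q}) (z q) / ((y - z q) * (z q - z b)))
    + (1 + u * z b) ^ card X * pole_prod z X (z b) / (y - z b)
    = (1 + u * y) ^ card X * pole_prod z X y / (y - z b)"
proof -
  have "(\<Sum>q\<in>insert b X. - z q * (1 + u * z q) ^ card X * pole_prod z (insert b X - {q}) (z q) / (y - z q))
      = (1 + u * y) ^ card X * pole_prod z (insert b X) y"
    using fin inj nz y b by (intro sum_pole_prod_shift[of "insert b X"]) auto
  also have "pole_prod z (insert b X) y = - z b * (pole_prod z X y / (y - z b))"
    using fin b by (subst pole_prod_insert) (auto simp: field_simps)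
  also have "(\<Sum>q\<in>insert b X. - z q * (1 + u * z q) ^ card X * pole_prod z (insert b X - {q}) (z q) / (y - z q))
      = - z b * ((1 + u * z b) ^ card X * pole_prod z X (z b) / (y - z b))
      + (\<Sum>q\<in>X. - z q * (1 + u * z q) ^ card X * pole_prod z (insert b X - {q}) (z q) / (y - z q))"
    using fin b by (simp add: mult.assoc)
  also have "(\<Sum>q\<in>X. - z q * (1 + u * z q) ^ card X * pole_prod z (insert b X - {q}) (z q) / (y - z q))
      = (\<Sum>q\<in>X. - z b * (- z q * (1 + u * z q) ^ card X * pole_prod z (X - {q}) (z q)
          / ((y - z q) * (z q - z b))))"
  proof (rule sum.cong[OF refl])
    fix q assume q: "q \<in> X"
    have "insert b X - {q} = insert b (X - {q})" using q b by auto
    then have "pole_prod z (insert b X - {q}) (z q) = z b / (z b - z q) * pole_prod z (X - {q}) (z q)"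
      using fin b by (simp add: pole_prod_insert)
    also have "z b / (z b - z q) = - z b / (z q - z b)"
      by (metis minus_diff_eq minus_divide_right minus_divide_left)
    finally show "- z q * (1 + u * z q) ^ card X * pole_prod z (insert b X - {q}) (z q) / (y - z q)
        = - z b * (- z q * (1 + u * z q) ^ card X * pole_prod z (X - {q}) (z q)
          / ((y - z q) * (z q - z b)))"
      by (simp add: mult_ac)
  qed
  also have "\<dots> = - z b * (\<Sum>q\<in>X. - z q * (1 + u * z q) ^ card X * pole_prod z (X - {q}) (z q)
          / ((y - z q) * (z q - z b)))"
    by (simp add: sum_distrib_left)
  finally have eq: "- z b * ((1 + u * z b) ^ card X * pole_prod z X (z b) / (y - z b))
    + - z b * (\<Sum>q\<in>X. - z q * (1 + u * z q) ^ card X * pole_prod z (X - {q}) (z q) / ((y - z q) * (z q - z b)))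
    = (1 + u * y) ^ card X * (- z b * (pole_prod z X y / (y - z b)))" .
  have cancel: "s + t = p * r" if "c \<noteq> 0" "- c * t + - c * s = p * (- c * r)" for c s t p r :: 'k
  proof -
    have "- c * (s + t) = - c * (p * r)" using that(2) by (simp add: algebra_simps)
    then show ?thesis using that(1) by (simp only: mult_cancel_left neg_equal_0_iff_equal simp_thms)
  qed
  show ?thesis unfolding times_divide_eq_right[of _ "pole_prod z X y", symmetric]
    by (rule cancel[OF b(2) eq])
qed

text \<open>The contribution of the rest of an ordering after the elements \<open>T\<close>, of
  which \<open>y\<close> came last. An element outside the greedy basis contributes
  \<open>- z q\<close> from the top elementary symmetric polynomial of the y-list and
  \<open>1 + u * z q\<close> from the generating function. The division at the end takes back the
  latter factor for the last element.\<close>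

primrec tail_weight :: "'a set_system \<Rightarrow> ('a \<Rightarrow> 'k::field) \<Rightarrow> 'k \<Rightarrow> 'a set \<Rightarrow> 'a \<Rightarrow> 'a list \<Rightarrow> 'k" where
  "tail_weight M z u T y [] = 1 / (1 + u * z y)"
| "tail_weight M z u T y (q # w) =
    (if rk M (insert q T) = rk M T then - z q * (1 + u * z q) else 1) / (z y - z q)
      * tail_weight M z u (insert q T) q w"

context matroid
begin

text \<open>
  A sum over the complete flags of flats above the flat \<open>F\<close> of corank \<open>k\<close>, each step with a chosen
  generator \<open>b\<close>; \<open>y\<close> is the generator chosen last.
\<close>

primrec flag_sum :: "('a \<Rightarrow> 'k::field) \<Rightarrow> 'k \<Rightarrow> nat \<Rightarrow> 'a set \<Rightarrow> 'a \<Rightarrow> 'k" where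
  "flag_sum z u 0 F y = 1 / (1 + u * z y)"
| "flag_sum z u (Suc k) F y = (\<Sum>b\<in>ground M - F.
    (1 + u * z b) ^ card (closure (insert b F) - F - {b}) * pole_prod z (closure (insert b F) - F - {b}) (z b)
      * flag_sum z u k (closure (insert b F)) b / (z y - z b))"

text \<open>Induction on the number of remaining elements, splitting by the next element
  \<open>q\<close>: inside the closure of \<open>T\<close> the flat stays and \<open>q\<close>
  replaces \<open>y\<close>, outside it \<open>q\<close> generates the next flat. For positive
  corank, \<open>flag_sum\<close> depends on \<open>y\<close> only through the factors
  \<open>1 / (z y - z b)\<close>, so both kinds of terms can be collected by
  \<open>b\<close>.\<close>

lemma sum_tail_weight:
  fixes z :: "'a \<Rightarrow> 'k::field"
  assumes inj: "inj_on z (ground M)" and nz: "0 \<notin> z ` ground M"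
    and nu: "\<And>e. e \<in> ground M \<Longrightarrow> 1 + u * z e \<noteq> 0"
    and T: "T \<subseteq> ground M" "y \<in> T"
  shows "(\<Sum>w\<in>permutations_of_set (ground M - T). tail_weight M z u T y w)
    = (1 + u * z y) ^ card (closure T - T) * pole_prod z (closure T - T) (z y)
      * flag_sum z u (matroid_rank M - rk M T) (closure T) y"
  using T
proof (induction "card (ground M - T)" arbitrary: T y rule: less_induct)
  case less
  note T = less(2,3)
  show ?case
  proof (cases "ground M - T = {}")
    case True
    then have TE: "T = ground M" using T by auto
    then have "closure T = T" using closure_subset_ground[of T] subset_closure[OF T(1)] by auto
    then show ?thesis using TE by (simp add: pole_prod_def matroid_rank_def)
  next
    case False
    define F where "F = closure T"
    define X where "X = F - T"
    define k where "k = matroid_rank M - rk M T"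
    define W where "W q w = tail_weight M z u T y (q # w)" for q w
    have TF: "T \<subseteq> F" "F \<subseteq> ground M"
      using subset_closure[OF T(1)] closure_subset_ground by (auto simp: F_def)
    have finX: "finite X" unfolding X_def F_def by simp
    have yE: "y \<in> ground M" "y \<notin> X" using T by (auto simp: X_def)
    have XE: "X \<subseteq> ground M" using TF by (auto simp: X_def)
    have Xinj: "inj_on z X" and Xnz: "0 \<notin> z ` X" and yX: "z y \<notin> z ` X" "z y \<noteq> 0"
      using inj XE yE nz by (auto intro: inj_on_subset simp: inj_on_image_mem_iff)
    have IH: "(\<Sum>w\<in>permutations_of_set (ground M - T - {q}). tail_weight M z u (insert q T) q w)
       = (1 + u * z q) ^ card (closure (insert q T) - T - {q})
         * pole_prod z (closure (insert q T) - T - {q}) (z q)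
         * flag_sum z u (matroid_rank M - rk M (insert q T)) (closure (insert q T)) q"
      if q: "q \<in> ground M - T" for q
    proof -
      have "card (ground M - insert q T) < card (ground M - T)"
        using q finite_ground by (intro psubset_card_mono) auto
      from less(1)[OF this, of q] q T show ?thesis
        by (simp add: Diff_insert[of _ q T])
    qed
    have W: "(\<Sum>w\<in>V. W q w) = (if rk M (insert q T) = rk M T then - z q * (1 + u * z q) else 1) / (z y - z q)
        * (\<Sum>w\<in>V. tail_weight M z u (insert q T) q w)" for q V
      unfolding W_def tail_weight.simps sum_distrib_left[symmetric] ..
    have IHX: "(\<Sum>w\<in>permutations_of_set (ground M - T - {q}). W q w)
       = - z q * (1 + u * z q) ^ card X * pole_prod z (X - {q}) (z q) / (z y - z q) * flag_sum z u k F q"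
      if q: "q \<in> X" for q
    proof -
      have qc: "q \<in> closure T" and qE: "q \<in> ground M - T" using q XE by (auto simp: X_def F_def)
      then have c: "closure (insert q T) = F"
        unfolding F_def using T by (intro closure_insert_mem)
      have r: "rk M (insert q T) = rk M T" using qc by (simp add: closure_def)
      have "card X = Suc (card (X - {q}))" using finX q by (rule card.remove)
      moreover have "(\<Sum>w\<in>permutations_of_set (ground M - T - {q}). tail_weight M z u (insert q T) q w)
          = (1 + u * z q) ^ card (X - {q}) * pole_prod z (X - {q}) (z q) * flag_sum z u k F q"
        using IH[OF qE] unfolding c r X_def k_def .
      ultimately show ?thesis
        by (simp add: W r)
    qed
    have split: "ground M - T = X \<union> (ground M - F)" "X \<inter> (ground M - F) = {}"
      using TF by (auto simp: X_def)
    have "(\<Sum>w\<in>permutations_of_set (ground M - T). tail_weight M z u T y w)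
        = (\<Sum>q\<in>ground M - T. \<Sum>w\<in>permutations_of_set (ground M - T - {q}). W q w)"
      unfolding W_def using False finite_ground by (intro sum_permutations_of_set_Cons) auto
    also have "\<dots> = (\<Sum>q\<in>X. \<Sum>w\<in>permutations_of_set (ground M - T - {q}). W q w)
        + (\<Sum>q\<in>ground M - F. \<Sum>w\<in>permutations_of_set (ground M - T - {q}). W q w)"
      unfolding split(1) using split(2) finX finite_ground by (intro sum.union_disjoint) auto
    also have "(\<Sum>q\<in>X. \<Sum>w\<in>permutations_of_set (ground M - T - {q}). W q w)
      = (\<Sum>q\<in>X. - z q * (1 + u * z q) ^ card X * pole_prod z (X - {q}) (z q) / (z y - z q) * flag_sum z u k F q)"
      using IHX by (intro sum.cong) auto
    also have "\<dots> + (\<Sum>q\<in>ground M - F. \<Sum>w\<in>permutations_of_set (ground M - T - {q}). W q w)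
      = (1 + u * z y) ^ card X * pole_prod z X (z y) * flag_sum z u k F y"
    proof (cases k)
      case 0
      then have "rk M T = matroid_rank M" using rk_le_matroid_rank[OF T(1)] by (simp add: k_def)
      then have FE: "F = ground M" unfolding F_def using T by (intro closure_eq_ground) auto
      then have cX: "card X > 0" using False finX by (auto simp: X_def card_gt_0_iff)
      \<comment> \<open>At corank 0 \<open>flag_sum\<close> is \<open>1 / (1 + u * z q)\<close>,
        which lowers the exponent to \<open>card X - 1\<close>, the largest one that
        \<open>sum_pole_prod_shift\<close> admits.\<close>
      have "(\<Sum>q\<in>X. - z q * (1 + u * z q) ^ card X * pole_prod z (X - {q}) (z q) / (z y - z q) * flag_sum z u k F q)
        = (\<Sum>q\<in>X. - z q * (1 + u * z q) ^ (card X - 1) * pole_prod z (X - {q}) (z q) / (z y - z q))"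
      proof (rule sum.cong[OF refl])
        fix q assume "q \<in> X"
        then have "1 + u * z q \<noteq> 0" using XE nu by auto
        moreover have "(1 + u * z q) ^ card X = (1 + u * z q) * (1 + u * z q) ^ (card X - 1)"
          using cX by (metis power_eq_if less_numeral_extra(3))
        ultimately show "- z q * (1 + u * z q) ^ card X * pole_prod z (X - {q}) (z q) / (z y - z q) * flag_sum z u k F q
            = - z q * (1 + u * z q) ^ (card X - 1) * pole_prod z (X - {q}) (z q) / (z y - z q)"
          by (simp add: 0)
      qed
      also have "\<dots> = (1 + u * z y) ^ (card X - 1) * pole_prod z X (z y)"
        using cX by (intro sum_pole_prod_shift finX Xinj Xnz yX) auto
      also have "\<dots> = (1 + u * z y) ^ card X * pole_prod z X (z y) * flag_sum z u k F y"
        using nu[OF yE(1)] cX by (cases "card X") (auto simp: 0)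
      finally show ?thesis by (simp add: FE)
    next
      case (Suc k')
      define g where "g b = (1 + u * z b) ^ card (closure (insert b F) - F - {b})
         * pole_prod z (closure (insert b F) - F - {b}) (z b) * flag_sum z u k' (closure (insert b F)) b" for b
      have fs: "flag_sum z u k F x = (\<Sum>b\<in>ground M - F. g b / (z x - z b))" for x
        by (simp add: Suc g_def)
      have new: "(\<Sum>w\<in>permutations_of_set (ground M - T - {b}). W b w)
          = (1 + u * z b) ^ card X * pole_prod z X (z b) / (z y - z b) * g b"
        if b: "b \<in> ground M - F" for b
      proof -
        have bE: "b \<in> ground M - T" using b TF by auto
        have bc: "b \<notin> closure T" using b by (simp add: F_def)
        have r: "rk M (insert b T) = Suc (rk M T)" using rk_insert_cases[of b T] b bc by simp
        define G where "G = closure (insert b F)"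
        have c: "closure (insert b T) = G"
          unfolding F_def G_def using T b by (subst closure_insert_closure) auto
        have FG: "F \<subseteq> G"
          unfolding G_def using subset_closure[of "insert b F"] b TF by auto
        have k': "matroid_rank M - Suc (rk M T) = k'" using Suc by (simp add: k_def)
        \<comment> \<open>The elements of \<open>X\<close> that have not occurred when
          \<open>b\<close> arrives remain in the span and are absorbed by \<open>b\<close>, together
          with the new elements of the next flat.\<close>
        have GT: "G - T - {b} = X \<union> (G - F - {b})" "X \<inter> (G - F - {b}) = {}"
          using FG TF b by (auto simp: X_def)
        have finG: "finite (G - F - {b})" by (simp add: G_def)
        have "(\<Sum>w\<in>permutations_of_set (ground M - T - {b}). tail_weight M z u (insert b T) b w)
            = (1 + u * z b) ^ card X * pole_prod z X (z b) * g b"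
          using IH[OF bE] unfolding c r k' GT(1)
          using finX finG GT(2)
          by (simp add: card_Un_disjoint pole_prod_Un_disjoint power_add g_def G_def[symmetric])
        then show ?thesis using r by (simp add: W)
      qed
      have "(\<Sum>q\<in>X. - z q * (1 + u * z q) ^ card X * pole_prod z (X - {q}) (z q) / (z y - z q) * flag_sum z u k F q)
          = (\<Sum>q\<in>X. \<Sum>b\<in>ground M - F. g b * (- z q * (1 + u * z q) ^ card X * pole_prod z (X - {q}) (z q)
              / ((z y - z q) * (z q - z b))))"
        unfolding fs sum_distrib_left by (intro sum.cong refl) (simp add: mult_ac)
      also have "\<dots> = (\<Sum>b\<in>ground M - F. g b * (\<Sum>q\<in>X. - z q * (1 + u * z q) ^ card X * pole_prod z (X - {q}) (z q)
              / ((z y - z q) * (z q - z b))))"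
        unfolding sum_distrib_left by (rule sum.swap)
      \<comment> \<open>After the exchange of summation the coefficient of each \<open>g b\<close>
        is the left side of \<open>sum_pole_prod_shift_two\<close>: either some \<open>q\<close> of
        \<open>X\<close> comes between \<open>y\<close> and \<open>b\<close>, or none does.\<close>
      finally have "(\<Sum>q\<in>X. - z q * (1 + u * z q) ^ card X * pole_prod z (X - {q}) (z q) / (z y - z q) * flag_sum z u k F q)
          + (\<Sum>q\<in>ground M - F. \<Sum>w\<in>permutations_of_set (ground M - T - {q}). W q w)
          = (\<Sum>b\<in>ground M - F. g b * ((\<Sum>q\<in>X. - z q * (1 + u * z q) ^ card X * pole_prod z (X - {q}) (z q)
              / ((z y - z q) * (z q - z b))) + (1 + u * z b) ^ card X * pole_prod z X (z b) / (z y - z b)))"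
        using new by (simp add: sum.distrib[symmetric] distrib_left mult_ac)
      also have "\<dots> = (\<Sum>b\<in>ground M - F. g b * ((1 + u * z y) ^ card X * pole_prod z X (z y) / (z y - z b)))"
      proof (rule sum.cong[OF refl])
        fix b assume b: "b \<in> ground M - F"
        then have "b \<notin> X" "z b \<noteq> 0" "z b \<notin> z ` X" "z b \<noteq> z y"
          using nz inj XE yE T TF by (auto simp: X_def inj_on_image_mem_iff dest: inj_onD)
        from sum_pole_prod_shift_two[OF finX Xinj Xnz yX this, of u]
        show "g b * ((\<Sum>q\<in>X. - z q * (1 + u * z q) ^ card X * pole_prod z (X - {q}) (z q)
              / ((z y - z q) * (z q - z b))) + (1 + u * z b) ^ card X * pole_prod z X (z b) / (z y - z b))
          = g b * ((1 + u * z y) ^ card X * pole_prod z X (z y) / (z y - z b))" by simp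
      qed
      also have "\<dots> = (1 + u * z y) ^ card X * pole_prod z X (z y) * flag_sum z u k F y"
        unfolding fs sum_distrib_left by (intro sum.cong refl) simp
      finally show ?thesis .
    qed
    finally show ?thesis by (simp add: F_def X_def k_def)
  qed
qed

end

section \<open>Elementary symmetric functions and the degree map\<close>

lemma esym_0 [simp]:
  assumes "finite A"
  shows "esym 0 A v = 1"
proof -
  have "{S. S \<subseteq> A \<and> card S = 0} = {{}}"
    using assms by (auto simp: finite_subset[OF _ assms])
  then show ?thesis by (simp add: esym_def)
qed

lemma esym_insert:
  assumes "finite A" "a \<notin> A"
  shows "esym (Suc k) (insert a A) v = esym (Suc k) A v + v a * esym k A v"
proof -
  define P where "P k = {S. S \<subseteq> A \<and> card S = k}" for k
  have fin: "finite (P k)" for k using assms by (simp add: P_def)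
  have fS: "finite S" "a \<notin> S" if "S \<in> P k" for S k
    using that assms(2) finite_subset[OF _ assms(1), of S] by (auto simp: P_def)
  have eq: "{S. S \<subseteq> insert a A \<and> card S = Suc k} = P (Suc k) \<union> insert a ` P k"
  proof (intro equalityI subsetI)
    fix S assume S: "S \<in> {S. S \<subseteq> insert a A \<and> card S = Suc k}"
    show "S \<in> P (Suc k) \<union> insert a ` P k"
    proof (cases "a \<in> S")
      case True
      then have "S - {a} \<in> P k" using S by (auto simp: P_def)
      then show ?thesis
        by (intro UnI2 image_eqI[of _ _ "S - {a}"]) (simp_all add: insert_absorb True)
    next
      case False
      then show ?thesis using S by (auto simp: P_def)
    qed
  next
    fix S assume "S \<in> P (Suc k) \<union> insert a ` P k"
    then consider "S \<in> P (Suc k)" | S' where "S' \<in> P k" "S = insert a S'" by blast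
    then show "S \<in> {S. S \<subseteq> insert a A \<and> card S = Suc k}"
    proof cases
      case 1
      then show ?thesis by (auto simp: P_def)
    next
      case 2
      then have "card S = Suc k" using fS[OF 2(1)] by (simp add: P_def)
      then show ?thesis using 2 by (auto simp: P_def)
    qed
  qed
  have inj: "inj_on (insert a) (P k)"
  proof (rule inj_onI)
    fix S S' assume "S \<in> P k" "S' \<in> P k" and eq: "insert a S = insert a S'"
    then have "a \<notin> S" "a \<notin> S'" using fS(2) by blast+
    then show "S = S'" using eq by (rule insert_ident[THEN iffD1])
  qed
  have "esym (Suc k) (insert a A) v = (\<Sum>S\<in>P (Suc k). prod v S) + (\<Sum>S\<in>insert a ` P k. prod v S)"
    unfolding esym_def eq
  proof (rule sum.union_disjoint)
    show "P (Suc k) \<inter> insert a ` P k = {}" using fS(2)[of _ "Suc k"] by blast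
  qed (use fin in simp_all)
  also have "(\<Sum>S\<in>insert a ` P k. prod v S) = (\<Sum>S\<in>P k. v a * prod v S)"
    unfolding sum.reindex[OF inj] o_def by (rule sum.cong[OF refl]) (simp add: fS)
  finally show ?thesis unfolding esym_def P_def sum_distrib_left .
qed

lemma esym_eq_coeff:
  "finite A \<Longrightarrow> esym k A v = coeff (\<Prod>a\<in>A. [:1, v a:]) k"
proof (induction A arbitrary: k rule: finite_induct)
  case empty
  have eq: "{S. S \<subseteq> {} \<and> card S = k} = (if k = 0 then {{}} else {})" by auto
  show ?case unfolding esym_def eq
    by (cases "k = 0") simp_all
next
  case (insert a A)
  moreover have "coeff (\<Prod>a\<in>A. [:1, v a:]) 0 = 1" using insert(3)[of 0] insert(1) by simp
  ultimately show ?case by (cases k) (simp_all add: esym_insert)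
qed

lemma esym_card: "finite A \<Longrightarrow> esym (card A) A v = prod v A"
proof -
  assume "finite A"
  then have "{S. S \<subseteq> A \<and> card S = card A} = {A}" by (auto dest: card_subset_eq)
  then show ?thesis by (simp add: esym_def)
qed

text \<open>The powers of \<open>- v l\<close> are the geometric series of
  \<open>1 / (1 + v l * t)\<close>, which divides the factor of \<open>l\<close> out of the
  generating polynomial. For the last element \<open>l\<close> of an ordering, \<open>- v l\<close>
  is the class \<alpha>.\<close>

lemma esym_remove:
  assumes "finite A" "l \<in> A"
  shows "(\<Sum>j\<le>k. (- v l) ^ j * esym (k - j) A v) = esym k (A - {l}) v"
proof (induction k)
  case 0
  then show ?case using assms by simp
next
  case (Suc k)
  have "esym (Suc k) (insert l (A - {l})) v = esym (Suc k) (A - {l}) v + v l * esym k (A - {l}) v"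
    using assms by (intro esym_insert) auto
  moreover have "insert l (A - {l}) = A" using assms by auto
  ultimately have *: "esym (Suc k) A v = esym (Suc k) (A - {l}) v + v l * esym k (A - {l}) v"
    by simp
  have "(\<Sum>j\<le>Suc k. (- v l) ^ j * esym (Suc k - j) A v)
      = esym (Suc k) A v + - v l * (\<Sum>j\<le>k. (- v l) ^ j * esym (k - j) A v)"
    unfolding sum.atMost_Suc_shift sum_distrib_left by (simp add: mult.assoc)
  then show ?case using Suc * by simp
qed

section \<open>The embedding of polynomials into the fraction field\<close>

lemma frac_of_add: "frac_of (p + q) = frac_of p + frac_of q"
  and frac_of_mult: "frac_of (p * q) = frac_of p * frac_of q"
  and frac_of_minus: "frac_of (- p) = - frac_of p"
  and frac_of_diff: "frac_of (p - q) = frac_of p - frac_of q"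
  and frac_of_0: "frac_of 0 = 0"
  and frac_of_1: "frac_of 1 = 1"
  by (simp_all add: frac_of_def Zero_fract_def One_fract_def)

lemma frac_of_sum: "frac_of (\<Sum>x\<in>A. f x) = (\<Sum>x\<in>A. frac_of (f x))"
  by (induction A rule: infinite_finite_induct) (simp_all add: frac_of_0 frac_of_add)

lemma frac_of_prod: "frac_of (\<Prod>x\<in>A. f x) = (\<Prod>x\<in>A. frac_of (f x))"
  by (induction A rule: infinite_finite_induct) (simp_all add: frac_of_1 frac_of_mult)

lemma frac_of_esym: "frac_of (esym k A v) = esym k A (\<lambda>a. frac_of (v a))"
  by (simp add: esym_def frac_of_sum frac_of_prod)

lemma frac_of_inject: "frac_of p = frac_of q \<longleftrightarrow> p = q"
  by (simp add: frac_of_def eq_fract)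

lemma inj_frac_of_zvar: "inj (\<lambda>e. frac_of (zvar e))"
proof (rule injI)
  fix x y :: 'a
  assume "frac_of (zvar x) = frac_of (zvar y)"
  then have "zvar x = zvar y" by (simp add: frac_of_inject)
  then have "Poly_Mapping.single (Var x) (1::nat) = Poly_Mapping.single (Var y) 1"
    unfolding zvar_def by (metis lookup_single_eq lookup_single_not_eq one_neq_zero)
  then show "x = y" by (metis lookup_single_eq lookup_single_not_eq one_neq_zero var.inject)
qed

lemma frac_of_zvar_nonzero: "frac_of (zvar e) \<noteq> 0"
  unfolding frac_of_0[symmetric] frac_of_inject zvar_def
  by (metis lookup_single_eq lookup_zero one_neq_zero)

lemma infinite_zfrac: "infinite (UNIV :: 'a zfrac set)"
proof -
  have "inj (of_int :: int \<Rightarrow> 'a zfrac)" by (rule injI) (metis int_of_frac_of_int)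
  then have "infinite (range (of_int :: int \<Rightarrow> 'a zfrac))"
    using finite_imageD infinite_UNIV_int by blast
  then show ?thesis by (rule infinite_super[OF subset_UNIV])
qed

lemma tail_weight_eq_prod:
  "tail_weight M z u T y w =
    (\<Prod>i<length w. if rk M (T \<union> set (take (Suc i) w)) = rk M (T \<union> set (take i w))
       then - z (w ! i) * (1 + u * z (w ! i)) else 1)
    / (\<Prod>i<length w. z ((y # w) ! i) - z ((y # w) ! Suc i)) / (1 + u * z (last (y # w)))"
proof (induction w arbitrary: T y)
  case (Cons q w)
  have "insert q T \<union> set (take i w) = T \<union> set (take (Suc i) (q # w))" for i by auto
  note * = Cons[of "insert q T" q, unfolded this]
  show ?case
    unfolding tail_weight.simps * list.size(4) add_Suc_right add_0_right prod.lessThan_Suc_shift o_def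
    by (simp add: mult.assoc cong: if_cong)
qed simp

definition chain_prod :: "('a \<Rightarrow> 'k::field) \<Rightarrow> 'a list \<Rightarrow> 'k" where
  "chain_prod z w = (\<Prod>i<length w - 1. z (w ! i) - z (w ! Suc i))"

section \<open>Greedy bases and the passage from the degree map to flag sums\<close>

context matroid
begin

lemma nth_in_greedy_basis_iff:
  assumes "distinct w" "k < length w"
  shows "w ! k \<in> greedy_basis M w \<longleftrightarrow> rk M (set (take k w)) < rk M (set (take (Suc k) w))"
  unfolding greedy_basis_def using assms by (auto simp: nth_eq_iff_index_eq)

lemma greedy_basis_subset: "greedy_basis M w \<subseteq> set w"
  by (auto simp: greedy_basis_def)

lemma card_greedy_basis:
  assumes "distinct w"
  shows "card (greedy_basis M w) = rk M (set w)"
proof -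
  have "card (greedy_basis M w) = card ((!) w ` {k. k < length w \<and> rk M (set (take k w)) < rk M (set (take (Suc k) w))})"
    unfolding greedy_basis_def by (rule arg_cong[of _ _ card]) auto
  also have "\<dots> = card {k. k < length w \<and> rk M (set (take k w)) < rk M (set (take (Suc k) w))}"
    using assms by (intro card_image) (auto simp: inj_on_def nth_eq_iff_index_eq)
  also have "\<dots> = rk M (set (take (length w) w))"
  proof -
    have "m \<le> length w \<Longrightarrow>
      card {k. k < m \<and> rk M (set (take k w)) < rk M (set (take (Suc k) w))} = rk M (set (take m w))" for m
    proof (induction m)
      case (Suc m)
      define G where "G m = {k. k < m \<and> rk M (set (take k w)) < rk M (set (take (Suc k) w))}" for m
      have t: "set (take (Suc m) w) = insert (w ! m) (set (take m w))"
        using Suc by (simp add: take_Suc_conv_app_nth)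
      have G: "G (Suc m) = (if rk M (set (take m w)) < rk M (set (take (Suc m) w)) then insert m (G m) else G m)"
        by (auto simp: G_def less_Suc_eq)
      have fin: "finite (G m)" "m \<notin> G m" by (auto simp: G_def)
      have "rk M (set (take m w)) \<le> rk M (set (take (Suc m) w))"
        "rk M (set (take (Suc m) w)) \<le> Suc (rk M (set (take m w)))"
        unfolding t by (rule rk_mono[OF subset_insertI] rk_insert_le)+
      then have "card (G (Suc m)) = rk M (set (take (Suc m) w))"
        using Suc fin G unfolding G_def[symmetric] by (simp split: if_splits)
      then show ?case unfolding G_def .
    qed simp
    then show ?thesis by simp
  qed
  finally show ?thesis by simp
qed

lemma prod_greedy:
  assumes d: "distinct w"
  shows "(\<Prod>i<length w. if rk M (set (take (Suc i) w)) = rk M (set (take i w)) then f (w ! i) else 1)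
    = (\<Prod>c\<in>set w - greedy_basis M w. f c)"
proof -
  have eq: "rk M (set (take (Suc i) w)) = rk M (set (take i w)) \<longleftrightarrow> w ! i \<notin> greedy_basis M w"
    if "i < length w" for i
  proof -
    have "rk M (set (take i w)) \<le> rk M (set (take (Suc i) w))"
      by (rule rk_mono) (rule set_take_subset_set_take, simp)
    then show ?thesis using nth_in_greedy_basis_iff[OF d that] by linarith
  qed
  have "(\<Prod>i<length w. if rk M (set (take (Suc i) w)) = rk M (set (take i w)) then f (w ! i) else 1)
      = (\<Prod>i<length w. if w ! i \<notin> greedy_basis M w then f (w ! i) else 1)"
    using eq by (intro prod.cong) auto
  also have "\<dots> = (\<Prod>c\<in>set w. if c \<notin> greedy_basis M w then f c else 1)"
    by (rule prod.reindex_bij_betw[OF bij_betw_nth]) (use d in auto)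
  also have "\<dots> = (\<Prod>c\<in>set w - greedy_basis M w. f c)"
    by (rule prod.mono_neutral_cong_right) auto
  finally show ?thesis .
qed


definition nongreedy :: "'a list \<Rightarrow> 'a set" where
  "nongreedy w = ground M - greedy_basis M w"

lemma last_nongreedy:
  assumes w: "w \<in> permutations_of_set (ground M)" "w \<noteq> []"
    and nc: "rk M (ground M - {last w}) = matroid_rank M"
  shows "last w \<in> nongreedy w"
proof -
  have d: "distinct w" "set w = ground M" using w by (auto simp: permutations_of_set_def)
  define k where "k = length w - 1"
  have k: "k < length w" "w ! k = last w" "take (Suc k) w = w" "take k w = butlast w"
    using w by (auto simp: k_def last_conv_nth butlast_conv_take)
  have "butlast w @ [last w] = w" using w(2) by simp
  then have "distinct (butlast w @ [last w])" "set (butlast w @ [last w]) = ground M"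
    using d by simp_all
  then have "set (butlast w) = ground M - {last w}" by auto
  then have "last w \<notin> greedy_basis M w"
    using nth_in_greedy_basis_iff[OF d(1) k(1)] nc d(2) unfolding k by (simp add: matroid_rank_def)
  then show ?thesis using last_in_set[OF w(2)] unfolding d(2) by (simp add: nongreedy_def)
qed

text \<open>Without loops the first element \<open>b\<close> of an ordering always lies in the
  greedy basis and contributes the factor 1, so \<open>sum_tail_weight\<close> is applied with
  \<open>T\<close> equal to \<open>{b}\<close>.\<close>

lemma sum_greedy_eq_flag_sum:
  fixes z :: "'a \<Rightarrow> 'k::field"
  assumes inj: "inj_on z (ground M)" and nz: "0 \<notin> z ` ground M"
    and nu: "\<And>e. e \<in> ground M \<Longrightarrow> 1 + u * z e \<noteq> 0"
    and loopless: "closure {} = {}" and ne: "ground M \<noteq> {}"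
    and nc: "\<And>e. e \<in> ground M \<Longrightarrow> rk M (ground M - {e}) = matroid_rank M"
  shows "(\<Sum>w\<in>permutations_of_set (ground M).
      (\<Prod>c\<in>nongreedy w. - z c) * (\<Prod>c\<in>nongreedy w - {last w}. 1 + u * z c) / chain_prod z w)
    = (\<Sum>b\<in>ground M. (1 + u * z b) ^ card (closure {b} - {b}) * pole_prod z (closure {b} - {b}) (z b)
        * flag_sum z u (matroid_rank M - 1) (closure {b}) b)"
proof -
  have rk1: "rk M {b} = 1" if "b \<in> ground M" for b
    using rk_insert_cases[OF that, of "{}"] loopless by simp
  have tail: "(\<Prod>c\<in>nongreedy (b # w). - z c) * (\<Prod>c\<in>nongreedy (b # w) - {last (b # w)}. 1 + u * z c)
      / chain_prod z (b # w) = tail_weight M z u {b} b w"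
    if b: "b \<in> ground M" and w: "w \<in> permutations_of_set (ground M - {b})" for b w
  proof -
    define C where "C = nongreedy (b # w)"
    define l where "l = last (b # w)"
    have p: "b # w \<in> permutations_of_set (ground M)" and d: "distinct (b # w)" "set (b # w) = ground M"
      using b w by (auto simp: permutations_of_set_def)
    have "l \<in> ground M" using last_in_set[of "b # w"] unfolding d(2) l_def by simp
    then have lC: "l \<in> C" unfolding l_def C_def by (intro last_nongreedy[OF p] nc) simp_all
    have fC: "finite C" using finite_ground by (simp add: C_def nongreedy_def)
    have "1 + u * z l \<noteq> 0" using nu lC by (simp add: C_def nongreedy_def)
    have "(\<Prod>i<length (b # w). if rk M (set (take (Suc i) (b # w))) = rk M (set (take i (b # w)))
          then - z ((b # w) ! i) * (1 + u * z ((b # w) ! i)) else 1)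
        = (\<Prod>c\<in>set (b # w) - greedy_basis M (b # w). - z c * (1 + u * z c))"
      by (rule prod_greedy[OF d(1)])
    also have "set (b # w) - greedy_basis M (b # w) = C"
      unfolding d(2) C_def nongreedy_def ..
    \<comment> \<open>The factor of the last element \<open>l\<close> is split off so that it
      cancels the final division in \<open>tail_weight\<close>.\<close>
    also have "(\<Prod>c\<in>C. - z c * (1 + u * z c))
        = (\<Prod>c\<in>C. - z c) * ((\<Prod>c\<in>C - {l}. 1 + u * z c) * (1 + u * z l))"
      unfolding prod.distrib using prod.remove[OF fC lC, of "\<lambda>c. 1 + u * z c"] by (simp add: mult.commute)
    finally have num: "(\<Prod>i<length w. if rk M ({b} \<union> set (take (Suc i) w)) = rk M ({b} \<union> set (take i w))
          then - z (w ! i) * (1 + u * z (w ! i)) else 1)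
        = (\<Prod>c\<in>C. - z c) * ((\<Prod>c\<in>C - {l}. 1 + u * z c) * (1 + u * z l))"
      unfolding list.size(4) add_Suc_right add_0_right prod.lessThan_Suc_shift o_def
      using rk1[OF b] by (simp cong: if_cong)
    show ?thesis
      unfolding tail_weight_eq_prod num C_def[symmetric] l_def[symmetric] chain_prod_def
      using \<open>1 + u * z l \<noteq> 0\<close> by simp
  qed
  have "(\<Sum>w\<in>permutations_of_set (ground M).
      (\<Prod>c\<in>nongreedy w. - z c) * (\<Prod>c\<in>nongreedy w - {last w}. 1 + u * z c) / chain_prod z w)
    = (\<Sum>b\<in>ground M. \<Sum>w\<in>permutations_of_set (ground M - {b}). tail_weight M z u {b} b w)"
    unfolding sum_permutations_of_set_Cons[OF finite_ground ne]
    by (intro sum.cong refl tail)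
  also have "\<dots> = (\<Sum>b\<in>ground M. (1 + u * z b) ^ card (closure {b} - {b}) * pole_prod z (closure {b} - {b}) (z b)
        * flag_sum z u (matroid_rank M - 1) (closure {b}) b)"
  proof (rule sum.cong[OF refl])
    fix b assume "b \<in> ground M"
    then show "(\<Sum>w\<in>permutations_of_set (ground M - {b}). tail_weight M z u {b} b w)
      = (1 + u * z b) ^ card (closure {b} - {b}) * pole_prod z (closure {b} - {b}) (z b)
        * flag_sum z u (matroid_rank M - 1) (closure {b}) b"
      using sum_tail_weight[OF inj nz nu, of "{b}" b] rk1 by simp
  qed
  finally show ?thesis .
qed

lemma card_nongreedy:
  assumes "w \<in> permutations_of_set (ground M)"
  shows "card (nongreedy w) = card (ground M) - matroid_rank M"
proof -
  have d: "distinct w" "set w = ground M" using assms by (auto simp: permutations_of_set_def)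
  then show ?thesis
    unfolding nongreedy_def
    using greedy_basis_subset[of w] finite_subset[OF greedy_basis_subset[of w]] finite_ground
    by (simp add: card_Diff_subset card_greedy_basis matroid_rank_def)
qed

text \<open>For \<open>i = r\<close> the factor in the x-list is the zeroth elementary symmetric
  polynomial, hence 1, and the one in the y-list is the full product because
  \<open>nongreedy w\<close> has exactly \<open>n - r\<close> elements. What is left of the sum over
  \<open>j\<close> is \<open>esym_remove\<close>.\<close>

lemma sum_degree_g_class:
  fixes z :: "'a \<Rightarrow> 'a zfrac"
  defines "z \<equiv> \<lambda>e. frac_of (zvar e)"
  assumes ne: "ground M \<noteq> {}"
    and nc: "\<And>e. e \<in> ground M \<Longrightarrow> rk M (ground M - {e}) = matroid_rank M"
    and r: "r = matroid_rank M" "r > 0"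
  shows "(\<Sum>j = 0..r - 1. degree_of_family (ground M) (g_class M r j))
    = (\<Sum>w\<in>permutations_of_set (ground M).
        coeff (smult ((\<Prod>c\<in>nongreedy w. - z c) / chain_prod z w) (\<Prod>c\<in>nongreedy w - {last w}. [:1, z c:])) (r - 1))"
proof -
  have sumj: "(\<Sum>j\<le>r - 1. frac_of (g_class M r j w) / (\<Prod>i<card (ground M) - 1. frac_of (zvar (w ! i) - zvar (w ! Suc i))))
      = coeff (smult ((\<Prod>c\<in>nongreedy w. - z c) / chain_prod z w) (\<Prod>c\<in>nongreedy w - {last w}. [:1, z c:])) (r - 1)"
    if w: "w \<in> permutations_of_set (ground M)" for w
  proof -
    define C where "C = nongreedy w"
    have fC: "finite C" using finite_ground by (simp add: C_def nongreedy_def)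
    have fB: "finite (greedy_basis M w)" using finite_subset[OF greedy_basis_subset] by simp
    have cC: "card C = card (ground M) - r" using card_nongreedy[OF w] r by (simp add: C_def)
    have d: "distinct w" "set w = ground M" using w by (auto simp: permutations_of_set_def)
    then have wne: "w \<noteq> []" and len: "length w = card (ground M)"
      using ne distinct_card[OF d(1)] by auto
    have "last w \<in> ground M" using last_in_set[OF wne] d(2) by simp
    then have lC: "last w \<in> C" unfolding C_def by (intro last_nongreedy[OF w wne] nc)
    have cp: "(\<Prod>i<card (ground M) - 1. frac_of (zvar (w ! i) - zvar (w ! Suc i))) = chain_prod z w"
      by (simp add: chain_prod_def len z_def frac_of_diff)
    have "g_class M r j w = (- zvar (last w)) ^ j * esym (r - 1 - j) C zvar * (\<Prod>c\<in>C. - zvar c)" for j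
      using esym_card[OF fC, of "\<lambda>c. - zvar c"] fB
      by (simp add: g_class_def Let_def r(1)[symmetric] nongreedy_def[symmetric] C_def[symmetric] cC)
    then have "(\<Sum>j\<le>r - 1. g_class M r j w)
        = (\<Sum>j\<le>r - 1. (- zvar (last w)) ^ j * esym (r - 1 - j) C zvar) * (\<Prod>c\<in>C. - zvar c)"
      by (simp add: sum_distrib_right)
    also have "\<dots> = esym (r - 1) (C - {last w}) zvar * (\<Prod>c\<in>C. - zvar c)"
      unfolding esym_remove[OF fC lC] ..
    finally have sum: "(\<Sum>j\<le>r - 1. g_class M r j w)
        = esym (r - 1) (C - {last w}) zvar * (\<Prod>c\<in>C. - zvar c)" .
    have "frac_of (esym (r - 1) (C - {last w}) zvar) = coeff (\<Prod>c\<in>C - {last w}. [:1, z c:]) (r - 1)"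
      unfolding frac_of_esym z_def using fC by (intro esym_eq_coeff) simp
    then have "frac_of (\<Sum>j\<le>r - 1. g_class M r j w)
        = coeff (\<Prod>c\<in>C - {last w}. [:1, z c:]) (r - 1) * (\<Prod>c\<in>C. - z c)"
      unfolding sum by (simp add: frac_of_mult frac_of_prod frac_of_minus z_def)
    then show ?thesis
      unfolding cp sum_divide_distrib[symmetric] frac_of_sum[symmetric] coeff_smult C_def[symmetric]
      by (simp only: mult.commute times_divide_eq_right times_divide_eq_left)
  qed
  show ?thesis
    unfolding degree_of_family_def atLeast0AtMost
    by (subst sum.swap) (rule sum.cong[OF refl sumj])
qed

end

section \<open>Matroids of rank 3\<close>

lemma coeff_linear_power:
  fixes b :: "'k::comm_ring_1"
  shows "coeff ([:1, b:] ^ m) 0 = 1" "coeff ([:1, b:] ^ m) (Suc 0) = of_nat m * b"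
    "coeff ([:1, b:] ^ m) 2 = of_nat (m choose 2) * b\<^sup>2"
proof -
  have "coeff ([:1, b:] ^ m) 0 = 1 \<and> coeff ([:1, b:] ^ m) (Suc 0) = of_nat m * b
    \<and> coeff ([:1, b:] ^ m) 2 = of_nat (m choose 2) * b\<^sup>2"
  proof (induction m)
    case (Suc m)
    have "Suc m choose 2 = (m choose 2) + m" by (simp add: numeral_2_eq_2)
    then show ?case using Suc
      by (simp add: numeral_2_eq_2 algebra_simps)
  qed (simp add: numeral_2_eq_2)
  then show "coeff ([:1, b:] ^ m) 0 = 1" "coeff ([:1, b:] ^ m) (Suc 0) = of_nat m * b"
    "coeff ([:1, b:] ^ m) 2 = of_nat (m choose 2) * b\<^sup>2" by simp_all
qed

locale rank3_matroid = matroid M for M :: "'a set_system" +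
  assumes rank3: "matroid_rank M = 3"
    and loopless: "closure {} = {}"
begin

abbreviation E :: "'a set" where "E \<equiv> ground M"

definition lines :: "'a set set" where
  "lines = {L. is_flat M L \<and> rk M L = 2}"

text \<open>In the absence of loops this is the parallel class of \<open>b\<close>, that is, the
  point of the geometry on which \<open>b\<close> lies.\<close>

abbreviation pt :: "'a \<Rightarrow> 'a set" where "pt b \<equiv> closure {b}"

definition lines_at :: "'a \<Rightarrow> 'a set set" where
  "lines_at b = {L \<in> lines. b \<in> L}"

lemma rk_singleton [simp]: "b \<in> E \<Longrightarrow> rk M {b} = 1"
  using rk_insert_cases[of b "{}"] loopless by simp

lemma mem_pt: "b \<in> E \<Longrightarrow> b \<in> pt b"
  using subset_closure[of "{b}"] by simp

lemma pt_subset: "pt b \<subseteq> E"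
  by (rule closure_subset_ground)

lemma pt_flat: "b \<in> E \<Longrightarrow> is_flat M (pt b)"
  unfolding is_flat_iff_closure by (simp add: pt_subset)

lemma pt_eq: "b \<in> E \<Longrightarrow> a \<in> pt b \<Longrightarrow> pt a = pt b"
  using closure_eq_flat[OF pt_flat, of b "{a}"] pt_subset[of b] by auto

lemma mem_pt_commute: "a \<in> E \<Longrightarrow> b \<in> E \<Longrightarrow> a \<in> pt b \<longleftrightarrow> b \<in> pt a"
  using pt_eq mem_pt by metis

lemma rk_pair: "b \<in> E \<Longrightarrow> c \<in> E \<Longrightarrow> rk M {b, c} = (if c \<in> pt b then 1 else 2)"
  using rk_insert_cases[of c "{b}"] by (auto simp: insert_commute)

lemma lines_flat: "L \<in> lines \<Longrightarrow> is_flat M L"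
  and rk_line: "L \<in> lines \<Longrightarrow> rk M L = 2"
  by (simp_all add: lines_def)

lemma line_subset: "L \<in> lines \<Longrightarrow> L \<subseteq> E"
  using lines_flat[of L] by (simp add: is_flat_def)

lemma line_closure: "L \<in> lines \<Longrightarrow> closure L = L"
  using lines_flat[of L] by (simp add: is_flat_iff_closure)

lemma finite_line: "L \<in> lines \<Longrightarrow> finite L"
  using finite_subset[OF line_subset finite_ground] .

lemma finite_lines: "finite lines"
proof (rule finite_subset)
  show "lines \<subseteq> Pow E" using line_subset by blast
qed (use finite_ground in simp)

lemma finite_lines_at: "finite (lines_at b)"
  using finite_lines by (simp add: lines_at_def)

lemma closure_pair_line:
  assumes "b \<in> E" "c \<in> E" "c \<notin> pt b"
  shows "closure {b, c} \<in> lines"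
  unfolding lines_def is_flat_iff_closure using assms by (simp add: closure_subset_ground rk_pair)

lemma line_eq_closure:
  assumes "L \<in> lines" "b \<in> L" "c \<in> L" "c \<notin> pt b"
  shows "closure {b, c} = L"
proof (rule closure_eq_flat[OF lines_flat])
  have "b \<in> E" "c \<in> E" using assms line_subset by blast+
  then show "rk M L \<le> rk M {b, c}" using assms by (simp add: rk_pair rk_line)
qed (use assms in auto)

lemma closure_insert_pt:
  assumes "b \<in> E" "c \<in> E"
  shows "closure (insert c (pt b)) = closure {b, c}"
  using closure_insert_closure[of "{b}" c] assms by (simp add: insert_commute)

lemma pt_subset_line:
  assumes "L \<in> lines" "b \<in> L"
  shows "pt b \<subseteq> L"
  using closure_mono[of "{b}" L] assms line_closure by simp

lemma pt_subset_line_iff: "b \<in> E \<Longrightarrow> L \<in> lines \<Longrightarrow> pt b \<subseteq> L \<longleftrightarrow> b \<in> L"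
  using pt_subset_line[of L b] mem_pt[of b] by blast

lemma line_diff_pt_nonempty:
  assumes "L \<in> lines" "b \<in> E"
  shows "L - pt b \<noteq> {}"
proof
  assume "L - pt b = {}"
  then have "rk M L \<le> rk M (pt b)" by (intro rk_mono) auto
  then show False using assms rk_line by simp
qed

lemma closure_insert_line:
  assumes "L \<in> lines" "b \<in> E - L"
  shows "closure (insert b L) = E"
proof (rule closure_eq_ground)
  show "rk M (insert b L) = matroid_rank M"
    using rk_insert_cases[of b L] assms rank3 by (simp add: line_closure rk_line)
  show "insert b L \<subseteq> E" using assms line_subset by auto
qed

lemma UN_lines_at_diff_pt:
  assumes "b \<in> E"
  shows "(\<Union>L\<in>lines_at b. L - pt b) = E - pt b"
proof
  show "(\<Union>L\<in>lines_at b. L - pt b) \<subseteq> E - pt b"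
    using line_subset by (auto simp: lines_at_def)
  show "E - pt b \<subseteq> (\<Union>L\<in>lines_at b. L - pt b)"
  proof
    fix c assume c: "c \<in> E - pt b"
    then have "closure {b, c} \<in> lines" using assms by (intro closure_pair_line) auto
    moreover have "{b, c} \<subseteq> closure {b, c}" using assms c by (intro subset_closure) auto
    ultimately show "c \<in> (\<Union>L\<in>lines_at b. L - pt b)" using c by (auto simp: lines_at_def)
  qed
qed

lemma disjoint_lines_at:
  assumes "L \<in> lines_at b" "L' \<in> lines_at b" "L \<noteq> L'"
  shows "(L - pt b) \<inter> (L' - pt b) = {}"
proof (rule ccontr)
  assume "(L - pt b) \<inter> (L' - pt b) \<noteq> {}"
  then obtain c where "c \<in> L" "c \<in> L'" "c \<notin> pt b" by auto
  then have "closure {b, c} = L" "closure {b, c} = L'"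
    using line_eq_closure[of L b c] line_eq_closure[of L' b c] assms(1,2)
    unfolding lines_at_def by blast+
  then show False using assms(3) by simp
qed

text \<open>Two distinct points span a unique line, so the lines through \<open>b\<close> partition
  the elements not parallel to \<open>b\<close>.\<close>

lemma sum_diff_pt:
  assumes "b \<in> E"
  shows "(\<Sum>c\<in>E - pt b. f c) = (\<Sum>L\<in>lines_at b. \<Sum>c\<in>L - pt b. f c)"
  unfolding UN_lines_at_diff_pt[OF assms, symmetric]
  using finite_lines_at disjoint_lines_at finite_line
  by (intro sum.UNION_disjoint) (auto simp: lines_at_def)

lemma card_diff_pt:
  assumes "b \<in> E"
  shows "card (E - pt b) = (\<Sum>L\<in>lines_at b. card (L - pt b))"
  using sum_diff_pt[OF assms, of "\<lambda>_. 1::nat"] by simp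

lemma lines_at_nonempty:
  assumes "b \<in> E"
  shows "lines_at b \<noteq> {}"
proof
  assume "lines_at b = {}"
  then have "E \<subseteq> pt b" using UN_lines_at_diff_pt[OF assms] by auto
  then have "rk M E \<le> rk M (pt b)" by (rule rk_mono)
  then show False using rank3 assms by (simp add: matroid_rank_def)
qed

end

locale rank3_coloopless = rank3_matroid M for M :: "'a set_system" +
  assumes coloopless: "e \<in> E \<Longrightarrow> rk M (E - {e}) = 3"
begin

text \<open>A single element outside a rank 2 flat would be a coloop. The bound makes the
  natural-number subtraction in exponents such as \<open>card (E - L) - 2\<close> exact.\<close>

lemma card_compl_line:
  assumes "L \<in> lines"
  shows "2 \<le> card (E - L)"
proof (rule ccontr)
  assume "\<not> 2 \<le> card (E - L)"
  then have "card (E - L) = 0 \<or> card (E - L) = 1" by linarith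
  then consider "E - L = {}" | e where "E - L = {e}"
    using finite_ground by (auto simp: card_1_singleton_iff)
  then show False
  proof cases
    case 1
    then have "rk M E \<le> rk M L" by (intro rk_mono) auto
    then show False using assms rank3 rk_line by (simp add: matroid_rank_def)
  next
    case 2
    then have "e \<in> E" "E - {e} \<subseteq> L" by auto
    then have "rk M (E - {e}) \<le> rk M L" by (intro rk_mono)
    then show False using coloopless[OF \<open>e \<in> E\<close>] assms rk_line by simp
  qed
qed

lemma card_split_line:
  assumes "b \<in> E" "L \<in> lines_at b"
  shows "card (E - pt b) = card (L - pt b) + card (E - L)" "card (L - pt b) \<ge> 1" "card (E - L) \<ge> 2"
    "card L = card (pt b) + card (L - pt b)"
proof -
  have L: "L \<in> lines" "b \<in> L" using assms by (auto simp: lines_at_def)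
  have P: "pt b \<subseteq> L" using L by (rule pt_subset_line)
  have LE: "L \<subseteq> E" using L(1) by (rule line_subset)
  have f: "finite L" "finite (E - L)" using finite_line L finite_ground by auto
  have "E - pt b = (L - pt b) \<union> (E - L)" "(L - pt b) \<inter> (E - L) = {}" using P LE by auto
  then show "card (E - pt b) = card (L - pt b) + card (E - L)"
    using f by (simp add: card_Un_disjoint)
  have "card (L - pt b) > 0" using line_diff_pt_nonempty[OF L(1) assms(1)] f by (simp add: card_gt_0_iff)
  then show "card (L - pt b) \<ge> 1" by simp
  show "card (E - L) \<ge> 2" using L(1) by (rule card_compl_line)
  show "card L = card (pt b) + card (L - pt b)"
    using card_Diff_subset[OF _ P] card_mono[OF f(1) P] by simp
qed

lemma card_compl_pt:
  assumes "b \<in> E"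
  shows "card (E - pt b) \<ge> 3"
proof -
  obtain L where "L \<in> lines_at b" using lines_at_nonempty[OF assms] by auto
  from card_split_line(1-3)[OF assms this] show ?thesis by linarith
qed

section \<open>Flag sums above a line and above a point\<close>

context
  fixes z :: "'a \<Rightarrow> 'k::field" and u :: 'k
  assumes inj: "inj_on z E" and nz: "0 \<notin> z ` E"
    and nu: "\<And>e. e \<in> E \<Longrightarrow> 1 + u * z e \<noteq> 0"
begin

lemma subset_generic:
  assumes "A \<subseteq> E" "b \<in> E" "b \<notin> A"
  shows "finite A" "inj_on z A" "0 \<notin> z ` A" "z b \<notin> z ` A" "z b \<noteq> 0"
proof -
  show "finite A" using assms(1) finite_ground by (rule finite_subset)
  show "inj_on z A" using inj assms(1) by (rule inj_on_subset)
  show "0 \<notin> z ` A" "z b \<noteq> 0" using nz assms by auto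
  show "z b \<notin> z ` A" using inj_on_image_mem_iff[OF inj assms(2,1)] assms(3) by simp
qed

text \<open>The only flat above a line is \<open>E\<close>. The exponent is
  \<open>card (E - L) - 1\<close> for the elements absorbed by the generator \<open>c\<close>, less
  one for the factor removed at the end of the flag; the sum over \<open>c\<close> then has a simple
  pole at 0.\<close>

lemma flag_sum_1:
  assumes L: "L \<in> lines" and b: "b \<in> L"
  shows "flag_sum z u 1 L b
    = (1 - (1 + u * z b) ^ (card (E - L) - 2) * pole_prod z (E - L) (z b)) / z b"
proof -
  define s where "s = card (E - L)"
  have s: "s \<ge> 2" unfolding s_def using L by (rule card_compl_line)
  have bE: "b \<in> E" "b \<notin> E - L" using b line_subset[OF L] by auto
  note gen = subset_generic[OF Diff_subset bE]
  have "flag_sum z u 1 L b = (\<Sum>c\<in>E - L. poly ([:1, u:] ^ (s - 2)) (z c) * pole_prod z (E - L - {c}) (z c) / (z b - z c))"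
    unfolding One_nat_def flag_sum.simps
  proof (rule sum.cong[OF refl])
    fix c assume c: "c \<in> E - L"
    have "card (E - L - {c}) = Suc (s - 2)" using c s finite_ground by (simp add: s_def)
    then show "(1 + u * z c) ^ card (closure (insert c L) - L - {c}) * pole_prod z (closure (insert c L) - L - {c}) (z c)
        * (1 / (1 + u * z c)) / (z b - z c)
      = poly ([:1, u:] ^ (s - 2)) (z c) * pole_prod z (E - L - {c}) (z c) / (z b - z c)"
      using nu[of c] c by (simp add: closure_insert_line[OF L c] mult.commute[of u])
  qed
  also have "\<dots> = (poly ([:1, u:] ^ (s - 2)) 0 - poly ([:1, u:] ^ (s - 2)) (z b) * pole_prod z (E - L) (z b)) / z b"
    using degree_linear_power[of u "s - 2"] by (intro sum_pole_prod_pole gen) (simp add: s_def)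
  finally show ?thesis by (simp add: s_def mult.commute[of u])
qed

text \<open>The generators \<open>c\<close> are grouped by the line they span with \<open>b\<close>.
  Since \<open>flag_sum_1\<close> brings in \<open>1 / z c\<close>, the sums are of the double-pole
  type. Its first term gives one sum for each line; its second terms join into a single sum over
  \<open>E - pt b\<close>.\<close>

lemma flag_sum_2:
  assumes b: "b \<in> E"
  shows "flag_sum z u 2 (pt b) b
    = (of_nat (card (lines_at b)) - 1 + u * z b * (3 - of_nat (card (lines_at b)))
      - (\<Sum>L\<in>lines_at b. (1 + u * z b) ^ (card (L - pt b) - 1) * pole_prod z (L - pt b) (z b))
      + (1 + u * z b) ^ (card (E - pt b) - 3) * pole_prod z (E - pt b) (z b)) / (z b)\<^sup>2"
proof -
  define P where "P = pt b"
  define k where "k = card (lines_at b)"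
  define H where "H A = (\<Sum>c\<in>A. 1 / z c)" for A
  define \<phi> where "\<phi> A m = (\<Sum>c\<in>A. poly ([:1, u:] ^ m) (z c) * pole_prod z (A - {c}) (z c) / (z c * (z b - z c)))" for A m
  define g where "g c = (1 + u * z c) ^ card (closure (insert c P) - P - {c})
     * pole_prod z (closure (insert c P) - P - {c}) (z c)
     * flag_sum z u 1 (closure (insert c P)) c / (z b - z c)" for c
  have PE: "P \<subseteq> E" "b \<in> P" using pt_subset mem_pt b by (auto simp: P_def)
  have \<phi>: "\<phi> A m = (1 - (1 + u * z b) ^ m * pole_prod z A (z b)) / (z b)\<^sup>2 + (of_nat m * u + H A) / z b"
    if A: "A \<subseteq> E - P" and m: "m \<le> Suc (card A)" for A m
  proof -
    have "A \<subseteq> E" "b \<notin> A" using A PE by auto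
    note gen = subset_generic[OF this(1) b this(2)]
    have "degree ([:1, u:] ^ m) \<le> Suc (card A)"
      using degree_linear_power[of u m] m by simp
    from sum_pole_prod_double_pole[OF gen(1-5) this] show ?thesis
      unfolding \<phi>_def H_def by (simp add: coeff_linear_power mult.commute[of u])
  qed
  have gc: "g c = poly ([:1, u:] ^ (card (L - P) - 1)) (z c) * pole_prod z (L - P - {c}) (z c) / (z c * (z b - z c))
      - poly ([:1, u:] ^ (card (E - P) - 3)) (z c) * pole_prod z (E - P - {c}) (z c) / (z c * (z b - z c))"
    if L: "L \<in> lines_at b" and c: "c \<in> L - P" for L c
  proof -
    have L': "L \<in> lines" "b \<in> L" "L \<subseteq> E" using L line_subset by (auto simp: lines_at_def)
    have cE: "c \<in> E" using c L' by auto
    have cl: "closure (insert c P) = L"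
      unfolding P_def closure_insert_pt[OF b cE] using c L' by (intro line_eq_closure) (auto simp: P_def)
    have fin: "finite (L - P - {c})" "finite (E - L)" using finite_line[OF L'(1)] finite_ground by auto
    have dis: "E - P - {c} = (L - P - {c}) \<union> (E - L)" "(L - P - {c}) \<inter> (E - L) = {}"
      using L' c pt_subset_line[OF L'(1,2)] by (auto simp: P_def)
    \<comment> \<open>The exponents add up to a number independent of \<open>L\<close>, which is
      what lets the second terms of all lines be merged into one sum.\<close>
    have e: "card (E - P) - 3 = (card (L - P) - 1) + (card (E - L) - 2)"
      using card_split_line[OF b L] by (simp add: P_def)
    have q: "card (L - P - {c}) = card (L - P) - 1" using c finite_line[OF L'(1)] by simp
    have "poly ([:1, u:] ^ (card (E - P) - 3)) (z c) * pole_prod z (E - P - {c}) (z c)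
      = (1 + u * z c) ^ (card (L - P) - 1) * pole_prod z (L - P - {c}) (z c)
        * ((1 + u * z c) ^ (card (E - L) - 2) * pole_prod z (E - L) (z c))"
      unfolding e dis(1) pole_prod_Un_disjoint[OF fin dis(2)] power_add by (simp add: mult_ac)
    moreover have "flag_sum z u 1 L c
        = (1 - (1 + u * z c) ^ (card (E - L) - 2) * pole_prod z (E - L) (z c)) / z c"
      using c by (intro flag_sum_1[OF L'(1)]) auto
    ultimately show ?thesis
      unfolding g_def cl q by (simp add: diff_divide_distrib right_diff_distrib mult.commute[of u])
  qed
  have "flag_sum z u 2 (pt b) b = (\<Sum>c\<in>E - P. g c)"
    unfolding numeral_2_eq_2 flag_sum.simps(2)[of z u "Suc 0"] g_def P_def One_nat_def ..
  also have "\<dots> = (\<Sum>L\<in>lines_at b. \<Sum>c\<in>L - P. g c)"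
    unfolding P_def by (rule sum_diff_pt[OF b])
  also have "\<dots> = (\<Sum>L\<in>lines_at b. \<Sum>c\<in>L - P.
        poly ([:1, u:] ^ (card (L - P) - 1)) (z c) * pole_prod z (L - P - {c}) (z c) / (z c * (z b - z c))
      - poly ([:1, u:] ^ (card (E - P) - 3)) (z c) * pole_prod z (E - P - {c}) (z c) / (z c * (z b - z c)))"
    by (intro sum.cong refl gc)
  also have "\<dots> = (\<Sum>L\<in>lines_at b. \<phi> (L - P) (card (L - P) - 1)) - \<phi> (E - P) (card (E - P) - 3)"
    unfolding sum_subtractf \<phi>_def using sum_diff_pt[OF b, symmetric] by (simp add: P_def)
  also have "\<phi> (E - P) (card (E - P) - 3)
      = (1 - (1 + u * z b) ^ (card (E - P) - 3) * pole_prod z (E - P) (z b)) / (z b)\<^sup>2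
        + (of_nat (card (E - P) - 3) * u + H (E - P)) / z b"
    by (rule \<phi>) auto
  also have "(\<Sum>L\<in>lines_at b. \<phi> (L - P) (card (L - P) - 1))
     = (\<Sum>L\<in>lines_at b. (1 - (1 + u * z b) ^ (card (L - P) - 1) * pole_prod z (L - P) (z b)) / (z b)\<^sup>2
        + (of_nat (card (L - P) - 1) * u + H (L - P)) / z b)"
    using line_subset by (intro sum.cong refl \<phi>) (auto simp: lines_at_def)
  also have "\<dots> = (of_nat k - (\<Sum>L\<in>lines_at b. (1 + u * z b) ^ (card (L - P) - 1) * pole_prod z (L - P) (z b))) / (z b)\<^sup>2
     + ((\<Sum>L\<in>lines_at b. of_nat (card (L - P) - 1)) * u + (\<Sum>L\<in>lines_at b. H (L - P))) / z b"
    by (simp add: sum.distrib sum_subtractf sum_divide_distrib[symmetric] sum_distrib_right k_def)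
  also have "(\<Sum>L\<in>lines_at b. H (L - P)) = H (E - P)"
    unfolding H_def P_def by (rule sum_diff_pt[OF b, symmetric])
  also have "(\<Sum>L\<in>lines_at b. of_nat (card (L - P) - 1)) = (of_nat (card (E - P)) - of_nat k :: 'k)"
  proof -
    have "(\<Sum>L\<in>lines_at b. of_nat (card (L - P) - 1)) = (\<Sum>L\<in>lines_at b. of_nat (card (L - P)) - 1 :: 'k)"
      using card_split_line(2)[OF b] by (intro sum.cong refl) (simp add: P_def of_nat_diff)
    then show ?thesis
      using card_diff_pt[OF b] by (simp add: sum_subtractf k_def P_def)
  qed
  also have "of_nat (card (E - P) - 3) = (of_nat (card (E - P)) - 3 :: 'k)"
    using card_compl_pt[OF b] by (simp add: P_def of_nat_diff)
  finally have "flag_sum z u 2 (pt b) b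
    = (of_nat k - (\<Sum>L\<in>lines_at b. (1 + u * z b) ^ (card (L - P) - 1) * pole_prod z (L - P) (z b))) / (z b)\<^sup>2
      + ((of_nat (card (E - P)) - of_nat k) * u + H (E - P)) / z b
      - ((1 - (1 + u * z b) ^ (card (E - P) - 3) * pole_prod z (E - P) (z b)) / (z b)\<^sup>2
        + ((of_nat (card (E - P)) - 3) * u + H (E - P)) / z b)" .
  \<comment> \<open>\<open>N\<close> is the number of elements outside \<open>pt b\<close> and
    \<open>h\<close> the sum of their reciprocals. Both occur once through the lines and once
    through the whole complement, and cancel; the constant 3 is left over from the exponent
    \<open>card (E - P) - 3\<close>.\<close>
  also have "(K - S) / (z b)\<^sup>2 + ((N - K) * u + h) / z b - ((1 - R) / (z b)\<^sup>2 + ((N - 3) * u + h) / z b)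
      = (K - 1 + u * z b * (3 - K) - S + R) / (z b)\<^sup>2" for K S N h R
    using subset_generic(5)[of "{}" b] b by (simp add: field_simps power2_eq_square)
  finally show ?thesis unfolding P_def k_def .
qed

end

section \<open>The coefficient of the square of u as an explicit integer\<close>

definition points :: "'a set set" where
  "points = pt ` E"

definition lines_through :: "'a set \<Rightarrow> 'a set set" where
  "lines_through P = {L \<in> lines. P \<subseteq> L}"

text \<open>The sum over the points corrects for parallel elements; it vanishes if \<open>M\<close> is simple.\<close>

definition omega_value :: int where
  "omega_value = int ((card E - 4) choose 2) - (\<Sum>L\<in>lines. int ((card L - 2) choose 2))
    + (\<Sum>P\<in>points. int ((card P - 1) choose 2) * (int (card (lines_through P)) - 1)
        + (int (card P) - 1) * (3 - int (card (lines_through P))))"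

lemma lines_through_pt: "b \<in> E \<Longrightarrow> lines_through (pt b) = lines_at b"
  unfolding lines_through_def lines_at_def using pt_subset_line_iff by auto

lemma card_pt_pos: "b \<in> E \<Longrightarrow> card (pt b) \<ge> 1"
  using mem_pt[of b] card_gt_0_iff[of "pt b"] by (simp add: Suc_le_eq) blast

text \<open>The contribution of the orderings beginning with \<open>b\<close>, as a polynomial in
  \<open>u\<close>. The other \<open>card (pt b) - 1\<close> elements parallel to \<open>b\<close>
  raise the exponents \<open>card (L - pt b) - 1\<close> and \<open>card (E - pt b) - 3\<close> of
  \<open>flag_sum_2\<close> to \<open>card L - 2\<close> and \<open>card E - 4\<close>, the origin
  of these numbers in \<open>omega_value\<close>.\<close>

definition flag_poly :: "('a \<Rightarrow> 'k::field) \<Rightarrow> 'a \<Rightarrow> 'k poly" where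
  "flag_poly z b = smult (1 / (z b)\<^sup>2)
    (smult (pole_prod z (pt b - {b}) (z b)) ([:1, z b:] ^ (card (pt b) - 1)
        * [:of_nat (card (lines_at b)) - 1, z b * (3 - of_nat (card (lines_at b))):])
      - (\<Sum>L\<in>lines_at b. smult (pole_prod z (L - {b}) (z b)) ([:1, z b:] ^ (card L - 2)))
      + smult (pole_prod z (E - {b}) (z b)) ([:1, z b:] ^ (card E - 4)))"

lemma flag_sum_eq_flag_poly:
  fixes z :: "'a \<Rightarrow> 'k::field"
  assumes inj: "inj_on z E" and nz: "0 \<notin> z ` E"
    and nu: "\<And>e. e \<in> E \<Longrightarrow> 1 + u * z e \<noteq> 0" and b: "b \<in> E"
  shows "(1 + u * z b) ^ card (pt b - {b}) * pole_prod z (pt b - {b}) (z b) * flag_sum z u 2 (pt b) b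
    = poly (flag_poly z b) u"
proof -
  define P where "P = pt b"
  have bP: "b \<in> P" "P \<subseteq> E" "finite P" using mem_pt[OF b] pt_subset by (auto simp: P_def)
  have cP: "card (P - {b}) = card P - 1" "card P \<ge> 1"
    using bP card_pt_pos[OF b] by (simp_all add: P_def)
  have comb: "(1 + u * z b) ^ (card P - 1) * pole_prod z (P - {b}) (z b) * ((1 + u * z b) ^ m * pole_prod z A (z b))
      = (1 + u * z b) ^ m' * pole_prod z A' (z b)"
    if "m' = card P - 1 + m" "A' = (P - {b}) \<union> A" "finite A" "(P - {b}) \<inter> A = {}" for m m' A A'
    using that bP by (simp add: power_add pole_prod_Un_disjoint mult_ac)
  have L: "(1 + u * z b) ^ (card P - 1) * pole_prod z (P - {b}) (z b)
      * ((1 + u * z b) ^ (card (L - P) - 1) * pole_prod z (L - P) (z b))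
      = poly (smult (pole_prod z (L - {b}) (z b)) ([:1, z b:] ^ (card L - 2))) u" if "L \<in> lines_at b" for L
  proof -
    have LL: "L \<in> lines" "b \<in> L" using that by (auto simp: lines_at_def)
    have PL: "P \<subseteq> L" using pt_subset_line[OF LL] by (simp add: P_def)
    have "(1 + u * z b) ^ (card P - 1) * pole_prod z (P - {b}) (z b)
      * ((1 + u * z b) ^ (card (L - P) - 1) * pole_prod z (L - P) (z b))
      = (1 + u * z b) ^ (card L - 2) * pole_prod z (L - {b}) (z b)"
      using card_split_line(2,4)[OF b that] cP PL bP finite_line[OF LL(1)] LL
      by (intro comb) (auto simp: P_def)
    then show ?thesis by simp
  qed
  have R: "(1 + u * z b) ^ (card P - 1) * pole_prod z (P - {b}) (z b)
      * ((1 + u * z b) ^ (card (E - P) - 3) * pole_prod z (E - P) (z b))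
      = poly (smult (pole_prod z (E - {b}) (z b)) ([:1, z b:] ^ (card E - 4))) u"
  proof -
    have "card E = card P + card (E - P)"
      using card_Diff_subset[OF bP(3,2)] card_mono[OF finite_ground bP(2)] by simp
    then have "(1 + u * z b) ^ (card P - 1) * pole_prod z (P - {b}) (z b)
      * ((1 + u * z b) ^ (card (E - P) - 3) * pole_prod z (E - P) (z b))
      = (1 + u * z b) ^ (card E - 4) * pole_prod z (E - {b}) (z b)"
      using card_compl_pt[OF b] cP bP finite_ground b
      by (intro comb) (auto simp: P_def)
    then show ?thesis by simp
  qed
  have fs: "flag_sum z u 2 P b
    = (of_nat (card (lines_at b)) - 1 + u * z b * (3 - of_nat (card (lines_at b)))
      - (\<Sum>L\<in>lines_at b. (1 + u * z b) ^ (card (L - P) - 1) * pole_prod z (L - P) (z b))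
      + (1 + u * z b) ^ (card (E - P) - 3) * pole_prod z (E - P) (z b)) / (z b)\<^sup>2"
    unfolding P_def using inj nz nu b by (rule flag_sum_2)
  have "(1 + u * z b) ^ (card P - 1) * pole_prod z (P - {b}) (z b) * flag_sum z u 2 P b
    = ((1 + u * z b) ^ (card P - 1) * pole_prod z (P - {b}) (z b)
        * (of_nat (card (lines_at b)) - 1 + u * z b * (3 - of_nat (card (lines_at b))))
      - (\<Sum>L\<in>lines_at b. (1 + u * z b) ^ (card P - 1) * pole_prod z (P - {b}) (z b)
          * ((1 + u * z b) ^ (card (L - P) - 1) * pole_prod z (L - P) (z b)))
      + (1 + u * z b) ^ (card P - 1) * pole_prod z (P - {b}) (z b)
          * ((1 + u * z b) ^ (card (E - P) - 3) * pole_prod z (E - P) (z b))) / (z b)\<^sup>2"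
    unfolding fs sum_distrib_left[symmetric]
    by (simp only: distrib_left right_diff_distrib times_divide_eq_right)
  also have "(1 + u * z b) ^ (card P - 1) * pole_prod z (P - {b}) (z b)
        * (of_nat (card (lines_at b)) - 1 + u * z b * (3 - of_nat (card (lines_at b))))
      = poly (smult (pole_prod z (P - {b}) (z b)) ([:1, z b:] ^ (card P - 1)
        * [:of_nat (card (lines_at b)) - 1, z b * (3 - of_nat (card (lines_at b))):])) u"
    by (simp add: algebra_simps)
  also have "(\<Sum>L\<in>lines_at b. (1 + u * z b) ^ (card P - 1) * pole_prod z (P - {b}) (z b)
          * ((1 + u * z b) ^ (card (L - P) - 1) * pole_prod z (L - P) (z b)))
      = poly (\<Sum>L\<in>lines_at b. smult (pole_prod z (L - {b}) (z b)) ([:1, z b:] ^ (card L - 2))) u"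
    unfolding poly_sum by (rule sum.cong[OF refl L])
  also note R
  finally show ?thesis
    unfolding cP(1)[unfolded P_def] P_def flag_poly_def by simp
qed

lemma coeff_linear_power_mult:
  fixes b :: "'k::comm_ring_1"
  shows "coeff ([:1, b:] ^ m * [:p, q:]) 2 = of_nat (m choose 2) * b\<^sup>2 * p + of_nat m * b * q"
  using coeff_linear_power[of b m] by (simp add: coeff_mult numeral_2_eq_2 algebra_simps)

text \<open>In every term the coefficient of degree 2 carries the square of \<open>z b\<close>,
  which cancels the denominator; afterwards \<open>z\<close> enters only through pole
  products.\<close>

lemma coeff_flag_poly:
  fixes z :: "'a \<Rightarrow> 'k::field"
  assumes nz: "0 \<notin> z ` E" and b: "b \<in> E"
  shows "coeff (flag_poly z b) 2
    = of_int (int ((card (pt b) - 1) choose 2) * (int (card (lines_at b)) - 1)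
        + (int (card (pt b)) - 1) * (3 - int (card (lines_at b)))) * pole_prod z (pt b - {b}) (z b)
      - (\<Sum>L\<in>lines_at b. of_nat ((card L - 2) choose 2) * pole_prod z (L - {b}) (z b))
      + of_nat ((card E - 4) choose 2) * pole_prod z (E - {b}) (z b)"
proof -
  define k where "k = card (lines_at b)"
  have zb: "z b \<noteq> 0" using nz b by auto
  have m: "of_nat (card (pt b) - 1) = (of_nat (card (pt b)) - 1 :: 'k)"
    using card_pt_pos[OF b] by (simp add: of_nat_diff)
  have p: "coeff ([:1, z b:] ^ (card (pt b) - 1) * [:of_nat k - 1, z b * (3 - of_nat k):]) 2
    = of_int (int ((card (pt b) - 1) choose 2) * (int k - 1) + (int (card (pt b)) - 1) * (3 - int k)) * (z b)\<^sup>2"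
    unfolding coeff_linear_power_mult m by (simp add: algebra_simps power2_eq_square)
  have S: "(\<Sum>L\<in>lines_at b. pole_prod z (L - {b}) (z b) * (of_nat ((card L - 2) choose 2) * (z b)\<^sup>2))
     = (\<Sum>L\<in>lines_at b. of_nat ((card L - 2) choose 2) * pole_prod z (L - {b}) (z b)) * (z b)\<^sup>2"
    unfolding sum_distrib_right by (intro sum.cong refl) (simp add: mult_ac)
  have "coeff (flag_poly z b) 2 = 1 / (z b)\<^sup>2 *
    (pole_prod z (pt b - {b}) (z b) * (of_int (int ((card (pt b) - 1) choose 2) * (int k - 1) + (int (card (pt b)) - 1) * (3 - int k)) * (z b)\<^sup>2)
      - (\<Sum>L\<in>lines_at b. of_nat ((card L - 2) choose 2) * pole_prod z (L - {b}) (z b)) * (z b)\<^sup>2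
      + pole_prod z (E - {b}) (z b) * (of_nat ((card E - 4) choose 2) * (z b)\<^sup>2))"
    unfolding flag_poly_def coeff_smult coeff_add coeff_diff coeff_sum k_def[symmetric] p coeff_linear_power(3) S ..
  also have "1 / (z b)\<^sup>2 * (r * (c * (z b)\<^sup>2) - s * (z b)\<^sup>2 + r' * (c' * (z b)\<^sup>2)) = c * r - s + c' * r'" for c r s c' r'
    using zb by (simp add: field_simps)
  finally show ?thesis unfolding k_def .
qed

text \<open>After regrouping the sum by lines and by parallel classes, \<open>sum_pole_prod\<close>
  is applied to \<open>E\<close>, to each line and to each parallel class, and replaces every sum of
  pole products by 1.\<close>

lemma sum_coeff_flag_poly:
  fixes z :: "'a \<Rightarrow> 'k::field"
  assumes inj: "inj_on z E" and nz: "0 \<notin> z ` E"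
  shows "(\<Sum>b\<in>E. coeff (flag_poly z b) 2) = of_int omega_value"
proof -
  define c where "c P = int ((card P - 1) choose 2) * (int (card (lines_through P)) - 1)
        + (int (card P) - 1) * (3 - int (card (lines_through P)))" for P
  have one: "(\<Sum>b\<in>F. pole_prod z (F - {b}) (z b)) = 1" if "F \<subseteq> E" "F \<noteq> {}" for F
    using that finite_subset[OF that(1) finite_ground] inj_on_subset[OF inj that(1)] nz
    by (intro sum_pole_prod) auto
  have Ene: "E \<noteq> {}" using rank3 rk_empty unfolding matroid_rank_def by (metis zero_neq_numeral)
  have "(\<Sum>b\<in>E. of_nat ((card E - 4) choose 2) * pole_prod z (E - {b}) (z b)) = of_nat ((card E - 4) choose 2)"
    unfolding sum_distrib_left[symmetric] one[OF subset_refl Ene] by simp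
  moreover have "(\<Sum>b\<in>E. \<Sum>L\<in>lines_at b. of_nat ((card L - 2) choose 2) * pole_prod z (L - {b}) (z b))
      = (\<Sum>L\<in>lines. of_nat ((card L - 2) choose 2))"
  proof -
    have "(\<Sum>b\<in>E. \<Sum>L\<in>lines_at b. of_nat ((card L - 2) choose 2) * pole_prod z (L - {b}) (z b))
        = (\<Sum>L\<in>lines. \<Sum>b | b \<in> E \<and> b \<in> L. of_nat ((card L - 2) choose 2) * pole_prod z (L - {b}) (z b))"
      unfolding lines_at_def by (rule sum.swap_restrict[OF finite_ground finite_lines])
    also have "\<dots> = (\<Sum>L\<in>lines. of_nat ((card L - 2) choose 2))"
    proof (rule sum.cong[OF refl])
      fix L assume L: "L \<in> lines"
      then have "{b. b \<in> E \<and> b \<in> L} = L" using line_subset by auto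
      moreover have "L \<noteq> {}" using rk_line[OF L] by auto
      ultimately show "(\<Sum>b | b \<in> E \<and> b \<in> L. of_nat ((card L - 2) choose 2) * pole_prod z (L - {b}) (z b))
          = of_nat ((card L - 2) choose 2)"
        using one[OF line_subset[OF L]] by (simp add: sum_distrib_left[symmetric])
    qed
    finally show ?thesis .
  qed
  moreover have "(\<Sum>b\<in>E. of_int (c (pt b)) * pole_prod z (pt b - {b}) (z b)) = (\<Sum>P\<in>points. of_int (c P))"
  proof -
    have "(\<Sum>b\<in>E. of_int (c (pt b)) * pole_prod z (pt b - {b}) (z b))
        = (\<Sum>P\<in>points. \<Sum>b | b \<in> E \<and> pt b = P. of_int (c (pt b)) * pole_prod z (pt b - {b}) (z b))"
      unfolding points_def by (rule sum.image_gen[OF finite_ground])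
    also have "\<dots> = (\<Sum>P\<in>points. of_int (c P))"
    proof (rule sum.cong[OF refl])
      fix P assume "P \<in> points"
      then obtain a where a: "a \<in> E" "P = pt a" by (auto simp: points_def)
      have *: "{b. b \<in> E \<and> pt b = P} = P"
      proof (intro equalityI subsetI)
        fix x assume "x \<in> {b. b \<in> E \<and> pt b = P}"
        then show "x \<in> P" using mem_pt[of x] by simp
      next
        fix x assume "x \<in> P"
        then show "x \<in> {b. b \<in> E \<and> pt b = P}"
          using pt_eq[OF a(1), of x] pt_subset[of a] a(2) by auto
      qed
      have PE: "P \<subseteq> E" "P \<noteq> {}" using mem_pt[OF a(1)] pt_subset[of a] a(2) by auto
      have "(\<Sum>b | b \<in> E \<and> pt b = P. of_int (c (pt b)) * pole_prod z (pt b - {b}) (z b))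
          = (\<Sum>b\<in>P. of_int (c P) * pole_prod z (P - {b}) (z b))"
      proof (rule sum.cong[OF *])
        fix b assume "b \<in> P"
        then have "pt b = P" using pt_eq[OF a(1)] a(2) by simp
        then show "of_int (c (pt b)) * pole_prod z (pt b - {b}) (z b) = of_int (c P) * pole_prod z (P - {b}) (z b)"
          by simp
      qed
      also have "\<dots> = of_int (c P)"
        unfolding sum_distrib_left[symmetric] one[OF PE] by simp
      finally show "(\<Sum>b | b \<in> E \<and> pt b = P. of_int (c (pt b)) * pole_prod z (pt b - {b}) (z b)) = of_int (c P)" .
    qed
    finally show ?thesis .
  qed
  moreover have "(\<Sum>b\<in>E. coeff (flag_poly z b) 2) =
      (\<Sum>b\<in>E. of_int (c (pt b)) * pole_prod z (pt b - {b}) (z b)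
      - (\<Sum>L\<in>lines_at b. of_nat ((card L - 2) choose 2) * pole_prod z (L - {b}) (z b))
      + of_nat ((card E - 4) choose 2) * pole_prod z (E - {b}) (z b))"
    by (intro sum.cong refl) (simp add: coeff_flag_poly[OF nz] c_def lines_through_pt)
  moreover have "omega_value = int ((card E - 4) choose 2)
      - (\<Sum>L\<in>lines. int ((card L - 2) choose 2)) + (\<Sum>P\<in>points. c P)"
    unfolding omega_value_def c_def ..
  ultimately show ?thesis
    by (simp add: sum.distrib sum_subtractf)
qed

lemma sum_coeff_greedy:
  fixes z :: "'a \<Rightarrow> 'k::field"
  assumes inj: "inj_on z E" and nz: "0 \<notin> z ` E" and inf: "infinite (UNIV :: 'k set)"
  shows "(\<Sum>w\<in>permutations_of_set E. coeff (smult ((\<Prod>c\<in>nongreedy w. - z c) / chain_prod z w)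
      (\<Prod>c\<in>nongreedy w - {last w}. [:1, z c:])) 2) = of_int omega_value"
proof -
  define A where "A = (\<Sum>w\<in>permutations_of_set E. smult ((\<Prod>c\<in>nongreedy w. - z c) / chain_prod z w)
      (\<Prod>c\<in>nongreedy w - {last w}. [:1, z c:]))"
  define B where "B = (\<Sum>b\<in>E. flag_poly z b)"
  have Ene: "E \<noteq> {}" using rank3 rk_empty unfolding matroid_rank_def by (metis zero_neq_numeral)
  \<comment> \<open>The excluded values are those at which some \<open>1 + u * z e\<close> vanishes.
    They are finitely many, so the two polynomials agree at infinitely many points.\<close>
  have eq: "poly A u = poly B u" if "u \<notin> (\<lambda>e. - 1 / z e) ` E" for u
  proof -
    have nu: "1 + u * z e \<noteq> 0" if e: "e \<in> E" for e
    proof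
      assume "1 + u * z e = 0"
      then have "u * z e = - 1" by (simp add: add_eq_0_iff)
      moreover have "z e \<noteq> 0" using nz e by auto
      ultimately have "u = - 1 / z e" by (metis nonzero_mult_div_cancel_right)
      then show False using \<open>u \<notin> _\<close> e by blast
    qed
    have "poly A u = (\<Sum>w\<in>permutations_of_set E.
      (\<Prod>c\<in>nongreedy w. - z c) * (\<Prod>c\<in>nongreedy w - {last w}. 1 + u * z c) / chain_prod z w)"
      unfolding A_def poly_sum by (intro sum.cong refl) (simp add: poly_prod)
    also have "\<dots> = (\<Sum>b\<in>E. (1 + u * z b) ^ card (pt b - {b}) * pole_prod z (pt b - {b}) (z b)
        * flag_sum z u (matroid_rank M - 1) (pt b) b)"
      using coloopless rank3 by (intro sum_greedy_eq_flag_sum inj nz nu loopless Ene) auto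
    also have "\<dots> = poly B u"
      unfolding B_def poly_sum
    proof (rule sum.cong[OF refl])
      fix b assume "b \<in> E"
      then show "(1 + u * z b) ^ card (pt b - {b}) * pole_prod z (pt b - {b}) (z b)
          * flag_sum z u (matroid_rank M - 1) (pt b) b = poly (flag_poly z b) u"
        using flag_sum_eq_flag_poly[OF inj nz nu] rank3 by simp
    qed
    finally show ?thesis .
  qed
  have "A = B"
  proof (rule ccontr)
    assume "A \<noteq> B"
    then have "finite {u. poly (A - B) u = 0}" by (intro poly_roots_finite) simp
    then have "finite ({u. poly (A - B) u = 0} \<union> (\<lambda>e. - 1 / z e) ` E)"
      by (intro finite_UnI finite_imageI finite_ground)
    moreover have "UNIV \<subseteq> {u. poly (A - B) u = 0} \<union> (\<lambda>e. - 1 / z e) ` E"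
    proof
      fix u
      show "u \<in> {u. poly (A - B) u = 0} \<union> (\<lambda>e. - 1 / z e) ` E"
        using eq[of u] by (cases "u \<in> (\<lambda>e. - 1 / z e) ` E") simp_all
    qed
    ultimately show False using inf infinite_super by blast
  qed
  then have "coeff A 2 = coeff B 2" by simp
  then show ?thesis
    unfolding A_def B_def coeff_sum sum_coeff_flag_poly[OF inj nz] .
qed

end

lemma coeff_sum_uminus_pow:
  fixes a :: "nat \<Rightarrow> int"
  assumes "finite I" "r \<in> I"
  shows "coeff ((- 1) ^ c * (\<Sum>i\<in>I. (- [:0, 1:]) ^ i * [:a i:])) r = (- 1) ^ (c + r) * a r"
proof -
  have "(- [:0, 1:]) ^ i * [:a i:] = monom ((- 1) ^ i * a i) i" for i
  proof -
    have "(- [:0, 1 :: int:]) ^ i = (- 1) ^ i * [:0, 1:] ^ i" by (rule power_minus)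
    then show ?thesis
      by (cases "even i") (simp_all add: monom_altdef mult.commute)
  qed
  then have "coeff (\<Sum>i\<in>I. (- [:0, 1:]) ^ i * [:a i:]) r = (\<Sum>i\<in>I. if i = r then (- 1) ^ r * a r else 0)"
    unfolding coeff_sum by (intro sum.cong) auto
  then have "coeff (\<Sum>i\<in>I. (- [:0, 1:]) ^ i * [:a i:]) r = (- 1) ^ r * a r"
    using assms by simp
  then show ?thesis by (cases "even c") (simp_all add: power_add)
qed

text \<open>The sign is that of \<open>g_poly\<close> times the cube of -1 coming from the third
  power of the negated variable; the exponent 3 is reduced to 1 by parity.\<close>

lemma (in rank3_coloopless) omega_eq_omega_value:
  assumes "\<And>e. \<not> is_loop M e" "\<And>e. \<not> is_coloop M e"
  shows "omega M = (- 1) ^ (num_components M + 1) * omega_value"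
proof -
  have Ene: "E \<noteq> {}" using rank3 rk_empty unfolding matroid_rank_def by (metis zero_neq_numeral)
  let ?z = "\<lambda>e. frac_of (zvar e)"
  have "(\<Sum>j = 0..3 - 1. degree_of_family E (g_class M 3 j))
    = (\<Sum>w\<in>permutations_of_set E.
        coeff (smult ((\<Prod>c\<in>nongreedy w. - ?z c) / chain_prod ?z w) (\<Prod>c\<in>nongreedy w - {last w}. [:1, ?z c:])) (3 - 1))"
    using rank3 coloopless by (intro sum_degree_g_class Ene) auto
  also have "\<dots> = of_int omega_value"
    using sum_coeff_greedy[OF inj_on_subset[OF inj_frac_of_zvar subset_UNIV] _ infinite_zfrac]
      frac_of_zvar_nonzero by fastforce
  finally have "int_of_frac (\<Sum>j = 0..3 - 1. degree_of_family E (g_class M 3 j)) = omega_value"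
    by (simp only: int_of_frac_of_int)
  moreover have g: "g_poly M = (- 1) ^ num_components M * (\<Sum>i = 1..3. (- [:0, 1:]) ^ i *
           [: int_of_frac (\<Sum>j = 0..i - 1. degree_of_family E (g_class M i j)) :])"
  proof -
    have "\<not> ((\<exists>e. is_loop M e) \<or> (\<exists>e. is_coloop M e))" using assms by blast
    then show ?thesis unfolding g_poly_def rank3 using Ene by (simp only: if_False)
  qed
  moreover have "omega M = (- 1) ^ (num_components M + 3)
      * int_of_frac (\<Sum>j = 0..3 - 1. degree_of_family E (g_class M 3 j))"
    unfolding omega_def rank3 g
    by (rule coeff_sum_uminus_pow[of "{1..3}" 3 _
        "\<lambda>i. int_of_frac (\<Sum>j = 0..i - 1. degree_of_family E (g_class M i j))"]) auto
  ultimately show ?thesis by (simp add: power_add)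
qed

section \<open>Linear spaces\<close>

locale linear_space =
  fixes S :: "'a set" and B :: "'a set set"
  assumes finite_points: "finite S"
    and block_subset: "b \<in> B \<Longrightarrow> b \<subseteq> S"
    and block_ge_2: "b \<in> B \<Longrightarrow> 2 \<le> card b"
    and unique_block: "s \<in> S \<Longrightarrow> t \<in> S \<Longrightarrow> s \<noteq> t \<Longrightarrow> \<exists>!b. b \<in> B \<and> s \<in> b \<and> t \<in> b"
begin

lemma finite_block: "b \<in> B \<Longrightarrow> finite b"
  using finite_subset[OF block_subset finite_points] .

lemma finite_blocks: "finite B"
proof (rule finite_subset)
  show "B \<subseteq> Pow S" using block_subset by blast
qed (use finite_points in simp)

definition rep :: "'a \<Rightarrow> nat" where
  "rep s = card {b \<in> B. s \<in> b}"

lemma card_blocks_pair: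
  assumes "s \<in> S" "t \<in> S" "s \<noteq> t"
  shows "card {b \<in> B. s \<in> b \<and> t \<in> b} = 1"
proof -
  obtain b where b: "b \<in> B" "s \<in> b" "t \<in> b" and "\<And>b'. b' \<in> B \<and> s \<in> b' \<and> t \<in> b' \<Longrightarrow> b' = b"
    using unique_block[OF assms] by (elim ex1E) blast
  then have "{b \<in> B. s \<in> b \<and> t \<in> b} = {b}" by blast
  then show ?thesis by simp
qed

lemma sum_block_eq:
  fixes f :: "'a \<Rightarrow> int"
  assumes "b \<in> B"
  shows "(\<Sum>s\<in>b. f s) = (\<Sum>s\<in>S. if s \<in> b then f s else 0)"
proof -
  have "S \<inter> b = b" using block_subset[OF assms] by auto
  then show ?thesis using sum.inter_restrict[OF finite_points, of f b] by simp
qed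

lemma sum_blocks_sum:
  fixes x :: "'a \<Rightarrow> int"
  shows "(\<Sum>b\<in>B. \<Sum>s\<in>b. x s) = (\<Sum>s\<in>S. int (rep s) * x s)"
proof -
  have "(\<Sum>b\<in>B. \<Sum>s\<in>b. x s) = (\<Sum>b\<in>B. \<Sum>s\<in>S. if s \<in> b then x s else 0)"
    by (intro sum.cong refl sum_block_eq)
  also have "\<dots> = (\<Sum>s\<in>S. \<Sum>b\<in>B. if s \<in> b then x s else 0)" by (rule sum.swap)
  also have "\<dots> = (\<Sum>s\<in>S. int (rep s) * x s)"
  proof (rule sum.cong[OF refl])
    fix s
    have "(\<Sum>b\<in>B. if s \<in> b then x s else 0) = (\<Sum>b\<in>{b \<in> B. s \<in> b}. x s)"
      using sum.inter_filter[OF finite_blocks, of "\<lambda>_. x s" "\<lambda>b. s \<in> b"] by simp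
    then show "(\<Sum>b\<in>B. if s \<in> b then x s else 0) = int (rep s) * x s" by (simp add: rep_def)
  qed
  finally show ?thesis .
qed

text \<open>Expanding the squares, the product of \<open>x s\<close> and \<open>x t\<close> is
  counted once for each block through both points: once if \<open>s\<close> and \<open>t\<close>
  differ, and \<open>rep s\<close> times on the diagonal.\<close>

lemma sum_blocks_square:
  fixes x :: "'a \<Rightarrow> int"
  shows "(\<Sum>b\<in>B. (\<Sum>s\<in>b. x s)\<^sup>2) = (\<Sum>s\<in>S. x s)\<^sup>2 + (\<Sum>s\<in>S. (int (rep s) - 1) * (x s)\<^sup>2)"
proof -
  have sq: "(\<Sum>s\<in>b. x s)\<^sup>2 = (\<Sum>s\<in>S. \<Sum>t\<in>S. if s \<in> b \<and> t \<in> b then x s * x t else 0)" if "b \<in> B" for b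
    unfolding sum_block_eq[OF that] power2_eq_square sum_product
    by (intro sum.cong refl) simp
  have pair: "(\<Sum>b\<in>B. if s \<in> b \<and> t \<in> b then x s * x t else 0)
      = x s * x t + (if s = t then (int (rep s) - 1) * (x s)\<^sup>2 else 0)" if st: "s \<in> S" "t \<in> S" for s t
  proof -
    have "(\<Sum>b\<in>B. if s \<in> b \<and> t \<in> b then x s * x t else 0) = (\<Sum>b\<in>{b \<in> B. s \<in> b \<and> t \<in> b}. x s * x t)"
      using sum.inter_filter[OF finite_blocks, of "\<lambda>_. x s * x t" "\<lambda>b. s \<in> b \<and> t \<in> b"] by simp
    then have "(\<Sum>b\<in>B. if s \<in> b \<and> t \<in> b then x s * x t else 0)
        = int (card {b \<in> B. s \<in> b \<and> t \<in> b}) * (x s * x t)" by simp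
    then show ?thesis
      using card_blocks_pair[OF st] by (cases "s = t") (simp_all add: rep_def power2_eq_square algebra_simps)
  qed
  have "(\<Sum>b\<in>B. (\<Sum>s\<in>b. x s)\<^sup>2)
      = (\<Sum>b\<in>B. \<Sum>s\<in>S. \<Sum>t\<in>S. if s \<in> b \<and> t \<in> b then x s * x t else 0)"
    by (intro sum.cong refl sq)
  also have "\<dots> = (\<Sum>s\<in>S. \<Sum>b\<in>B. \<Sum>t\<in>S. if s \<in> b \<and> t \<in> b then x s * x t else 0)"
    by (rule sum.swap)
  also have "\<dots> = (\<Sum>s\<in>S. \<Sum>t\<in>S. \<Sum>b\<in>B. if s \<in> b \<and> t \<in> b then x s * x t else 0)"
    by (intro sum.cong refl sum.swap)
  also have "\<dots> = (\<Sum>s\<in>S. \<Sum>t\<in>S. x s * x t + (if s = t then (int (rep s) - 1) * (x s)\<^sup>2 else 0))"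
    by (intro sum.cong refl pair)
  also have "\<dots> = (\<Sum>s\<in>S. x s)\<^sup>2 + (\<Sum>s\<in>S. (int (rep s) - 1) * (x s)\<^sup>2)"
    using finite_points by (simp add: sum.distrib power2_eq_square sum_product)
  finally show ?thesis .
qed

text \<open>Twice the integer in question, written with integer products: this form remains correct
  for three points, where it is 2 although the truncated binomial coefficient would be 0.\<close>

definition excess :: int where
  "excess = (int (card S) - 4) * (int (card S) - 5) - (\<Sum>b\<in>B. (int (card b) - 2) * (int (card b) - 3))"

text \<open>This is why the sizes \<open>x\<close> of the parallel classes do not affect \<open>\<omega>\<close>: unit weights give \<open>excess\<close>.\<close>

lemma weighted_excess_const:
  fixes x :: "'a \<Rightarrow> int"
  shows "((\<Sum>s\<in>S. x s) - 4) * ((\<Sum>s\<in>S. x s) - 5) - (\<Sum>b\<in>B. ((\<Sum>s\<in>b. x s) - 2) * ((\<Sum>s\<in>b. x s) - 3))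
      + (\<Sum>s\<in>S. (x s - 1) * (x s - 2) * (int (rep s) - 1) + 2 * (x s - 1) * (3 - int (rep s)))
    = 20 - 6 * int (card B) + (\<Sum>s\<in>S. 4 * int (rep s) - 8)"
proof -
  define X where "X = (\<Sum>s\<in>S. x s)"
  have "(\<Sum>b\<in>B. ((\<Sum>s\<in>b. x s) - 2) * ((\<Sum>s\<in>b. x s) - 3))
      = (\<Sum>b\<in>B. (\<Sum>s\<in>b. x s)\<^sup>2 - 5 * (\<Sum>s\<in>b. x s) + 6)"
    by (intro sum.cong refl) (simp add: power2_eq_square algebra_simps)
  also have "\<dots> = (X\<^sup>2 + (\<Sum>s\<in>S. (int (rep s) - 1) * (x s)\<^sup>2)) - 5 * (\<Sum>s\<in>S. int (rep s) * x s) + 6 * int (card B)"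
    by (simp add: sum.distrib sum_subtractf sum_distrib_left[symmetric] sum_blocks_square sum_blocks_sum X_def)
  finally have B: "(\<Sum>b\<in>B. ((\<Sum>s\<in>b. x s) - 2) * ((\<Sum>s\<in>b. x s) - 3))
      = (X\<^sup>2 + (\<Sum>s\<in>S. (int (rep s) - 1) * (x s)\<^sup>2)) - 5 * (\<Sum>s\<in>S. int (rep s) * x s) + 6 * int (card B)" .
  have "(X - 4) * (X - 5) = X\<^sup>2 - (\<Sum>s\<in>S. 9 * x s) + 20"
    unfolding sum_distrib_left[symmetric] X_def[symmetric]
    by (simp add: power2_eq_square algebra_simps)
  \<comment> \<open>A pointwise identity: the coefficients of \<open>x s\<close> and of its square
    cancel for every value of \<open>rep s\<close>, and only the constant part remains.\<close>
  moreover have "(\<Sum>s\<in>S. 4 * int (rep s) - 8)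
      = (\<Sum>s\<in>S. - (9 * x s) - (int (rep s) - 1) * (x s)\<^sup>2 + 5 * (int (rep s) * x s)
        + ((x s - 1) * (x s - 2) * (int (rep s) - 1) + 2 * (x s - 1) * (3 - int (rep s))))"
    by (intro sum.cong refl) (simp add: power2_eq_square algebra_simps)
  moreover have "\<dots> = - (\<Sum>s\<in>S. 9 * x s) - (\<Sum>s\<in>S. (int (rep s) - 1) * (x s)\<^sup>2)
      + 5 * (\<Sum>s\<in>S. int (rep s) * x s)
      + (\<Sum>s\<in>S. (x s - 1) * (x s - 2) * (int (rep s) - 1) + 2 * (x s - 1) * (3 - int (rep s)))"
    unfolding sum_distrib_left sum_negf[symmetric] sum_subtractf[symmetric] sum.distrib[symmetric] ..
  ultimately show ?thesis unfolding B X_def[symmetric] by linarith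
qed

lemma weighted_excess:
  fixes x :: "'a \<Rightarrow> int"
  shows "((\<Sum>s\<in>S. x s) - 4) * ((\<Sum>s\<in>S. x s) - 5) - (\<Sum>b\<in>B. ((\<Sum>s\<in>b. x s) - 2) * ((\<Sum>s\<in>b. x s) - 3))
      + (\<Sum>s\<in>S. (x s - 1) * (x s - 2) * (int (rep s) - 1) + 2 * (x s - 1) * (3 - int (rep s)))
    = excess"
  using weighted_excess_const[of x] weighted_excess_const[of "\<lambda>_. 1"] by (simp add: excess_def)

section \<open>Lower bound and special values of the excess\<close>

lemma card_Int_block_le_1:
  assumes "b \<in> B" "b' \<in> B" "b \<noteq> b'"
  shows "card (b \<inter> b') \<le> 1"
proof (rule ccontr)
  assume "\<not> card (b \<inter> b') \<le> 1"
  then obtain s t where "s \<in> b \<inter> b'" "t \<in> b \<inter> b'" "s \<noteq> t"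
    using card_le_Suc0_iff_eq[of "b \<inter> b'"] finite_block[OF assms(1)] by auto
  then show False using unique_block[of s t] assms block_subset[OF assms(1)] by blast
qed

lemma card_block_split:
  assumes "b \<in> B" "b' \<in> B" "b \<noteq> b'"
  shows "card b = card (b - b') + card (b \<inter> b')" "card (b - b') \<ge> 1" "card b \<le> Suc (card (b - b'))"
    "card (b - b') \<le> card (S - b')"
proof -
  have f: "finite b" using assms(1) by (rule finite_block)
  show 1: "card b = card (b - b') + card (b \<inter> b')"
    using card_Int_Diff[OF f, of b'] by simp
  show 2: "card b \<le> Suc (card (b - b'))" using 1 card_Int_block_le_1[OF assms] by simp
  then show "card (b - b') \<ge> 1" using block_ge_2[OF assms(1)] by simp
  show "card (b - b') \<le> card (S - b')"
    using block_subset[OF assms(1)] finite_points by (intro card_mono) auto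
qed

text \<open>Each ordered pair of distinct points off \<open>b0\<close> lies in exactly one block,
  necessarily different from \<open>b0\<close>. Formally this is \<open>sum_blocks_square\<close>
  for the indicator function of the complement of \<open>b0\<close>.\<close>

lemma sum_pairs_outside:
  assumes b0: "b0 \<in> B"
  shows "(\<Sum>b\<in>B - {b0}. int (card (b - b0)) * (int (card (b - b0)) - 1))
    = int (card (S - b0)) * (int (card (S - b0)) - 1)"
proof -
  define x :: "'a \<Rightarrow> int" where "x s = (if s \<in> b0 then 0 else 1)" for s
  have xs: "(\<Sum>s\<in>A. x s) = int (card (A - b0))" if "finite A" for A
  proof -
    have "(\<Sum>s\<in>A. x s) = (\<Sum>s\<in>A - b0. 1)"
      unfolding x_def using that by (intro sum.mono_neutral_cong_right) auto
    then show ?thesis by simp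
  qed
  have xx: "(x s)\<^sup>2 = x s" for s by (simp add: x_def)
  have "(\<Sum>b\<in>B. (\<Sum>s\<in>b. x s)\<^sup>2 - (\<Sum>s\<in>b. x s)) = (\<Sum>s\<in>S. x s)\<^sup>2 - (\<Sum>s\<in>S. x s)"
    unfolding sum_subtractf sum_blocks_square sum_blocks_sum xx
    by (simp add: left_diff_distrib sum_subtractf)
  moreover have "(\<Sum>b\<in>B. (\<Sum>s\<in>b. x s)\<^sup>2 - (\<Sum>s\<in>b. x s))
      = (\<Sum>b\<in>B. int (card (b - b0)) * (int (card (b - b0)) - 1))"
    by (intro sum.cong refl) (simp add: xs finite_block power2_eq_square algebra_simps)
  moreover have "\<dots> = (\<Sum>b\<in>B - {b0}. int (card (b - b0)) * (int (card (b - b0)) - 1))"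
    unfolding sum.remove[OF finite_blocks b0] by simp
  ultimately show ?thesis
    by (simp add: xs finite_points power2_eq_square algebra_simps)
qed

text \<open>Every other block is charged in proportion to the pairs of points off \<open>b0\<close>
  that it contains. The resulting bound \<open>(Q - 1) * (Q - 2)\<close> for \<open>T\<close> is the
  contribution of a single block of size \<open>Q + 1\<close>, which would contain all points off
  \<open>b0\<close> and one point of \<open>b0\<close>.\<close>

lemma excess_ge:
  assumes b0: "b0 \<in> B" and q: "card (S - b0) \<ge> 1"
  shows "excess \<ge> 2 * (int (card b0) - 3) * (int (card (S - b0)) - 2)"
proof -
  define Q where "Q = int (card (S - b0))"
  define m where "m = int (card b0)"
  define T where "T = (\<Sum>b\<in>B - {b0}. (int (card b) - 2) * (int (card b) - 3))"
  have Q: "Q \<ge> 1" using q by (simp add: Q_def)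
  have p: "int (card S) = m + Q"
    using card_Diff_subset[OF finite_block[OF b0] block_subset[OF b0]]
      card_mono[OF finite_points block_subset[OF b0]] by (simp add: m_def Q_def)
  \<comment> \<open>With \<open>a\<close> points off \<open>b0\<close> the block has at most
    \<open>a + 1\<close> points. The loss in the comparison is \<open>2 * (a - 1) * (Q - a)\<close>,
    which vanishes at both ends of the range of \<open>a\<close>; this fixes the multiplier
    \<open>Q - 2\<close>.\<close>
  have term_le: "Q * ((int (card b) - 2) * (int (card b) - 3))
      \<le> (Q - 2) * (int (card (b - b0)) * (int (card (b - b0)) - 1))" if b: "b \<in> B - {b0}" for b
  proof -
    define a where "a = int (card (b - b0))"
    define c where "c = int (card b)"
    have "b \<in> B" "b \<noteq> b0" using b by auto
    note sp = card_block_split[OF this(1) b0 this(2)]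
    have a: "1 \<le> a" "a \<le> Q" "c \<le> a + 1" "2 \<le> c" and ca: "a \<le> c"
      using sp block_ge_2[OF \<open>b \<in> B\<close>] by (simp_all add: a_def Q_def c_def)
    have "(c - 2) * (c - 3) \<le> (a - 1) * (a - 2)"
    proof (cases "c = a + 1")
      case False
      then have "c = a" using a ca by simp
      moreover have "(c - 2) * (c - 3) \<le> (c - 2) * (c - 1)" using a(4) by (intro mult_left_mono) auto
      ultimately show ?thesis by (simp add: mult.commute)
    qed simp
    then have "Q * ((c - 2) * (c - 3)) \<le> Q * ((a - 1) * (a - 2))" using Q by (intro mult_left_mono) auto
    also have "\<dots> = (Q - 2) * (a * (a - 1)) - 2 * ((a - 1) * (Q - a))"
      by (simp add: algebra_simps)
    also have "\<dots> \<le> (Q - 2) * (a * (a - 1))" using a by simp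
    finally show ?thesis unfolding a_def c_def .
  qed
  have "Q * T = (\<Sum>b\<in>B - {b0}. Q * ((int (card b) - 2) * (int (card b) - 3)))"
    unfolding T_def by (rule sum_distrib_left)
  also have "\<dots> \<le> (\<Sum>b\<in>B - {b0}. (Q - 2) * (int (card (b - b0)) * (int (card (b - b0)) - 1)))"
    by (intro sum_mono term_le)
  also have "\<dots> = (Q - 2) * (Q * (Q - 1))"
    unfolding sum_distrib_left[symmetric] sum_pairs_outside[OF b0] Q_def ..
  also have "\<dots> = Q * ((Q - 1) * (Q - 2))" by (simp add: algebra_simps)
  finally have "T \<le> (Q - 1) * (Q - 2)" using Q by simp
  moreover have "excess = (m + Q - 4) * (m + Q - 5) - ((m - 2) * (m - 3) + T)"
    unfolding excess_def p T_def m_def sum.remove[OF finite_blocks b0] ..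
  moreover have "(m + Q - 4) * (m + Q - 5) - ((m - 2) * (m - 3) + (Q - 1) * (Q - 2)) = 2 * (m - 3) * (Q - 2)"
    by (simp add: algebra_simps)
  ultimately show ?thesis unfolding Q_def[symmetric] m_def[symmetric] by linarith
qed

lemma excess_small_blocks:
  assumes "\<And>b. b \<in> B \<Longrightarrow> card b \<le> 3"
  shows "excess = (int (card S) - 4) * (int (card S) - 5)"
proof -
  have "(int (card b) - 2) * (int (card b) - 3) = 0" if "b \<in> B" for b
    using assms[OF that] block_ge_2[OF that] by (cases "card b = 2") auto
  then have "(\<Sum>b\<in>B. (int (card b) - 2) * (int (card b) - 3)) = 0" by (rule sum.neutral[OF ballI])
  then show ?thesis by (simp add: excess_def)
qed

text \<open>Any other block has at most one point on \<open>b0\<close> and two off it, hence size 2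
  or 3, and for these sizes its term is zero.\<close>

lemma excess_near_pencil:
  assumes b0: "b0 \<in> B" and q: "card (S - b0) \<le> 2"
  shows "excess = (int (card S) - 4) * (int (card S) - 5) - (int (card b0) - 2) * (int (card b0) - 3)"
proof -
  have "(int (card b) - 2) * (int (card b) - 3) = 0" if b: "b \<in> B - {b0}" for b
  proof -
    have "b \<in> B" "b \<noteq> b0" using b by auto
    note card_block_split[OF this(1) b0 this(2)]
    then have "card b \<le> 3" using q by linarith
    then show ?thesis using block_ge_2[OF \<open>b \<in> B\<close>] by (cases "card b = 2") auto
  qed
  then have "(\<Sum>b\<in>B - {b0}. (int (card b) - 2) * (int (card b) - 3)) = 0" by (rule sum.neutral[OF ballI])
  then show ?thesis
    unfolding excess_def sum.remove[OF finite_blocks b0] by simp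
qed

lemma excess_cases:
  assumes p: "2 \<le> card S" and small: "\<And>b. b \<in> B \<Longrightarrow> card b + 2 \<le> card S"
  shows "excess \<ge> 0"
    and "excess = 0 \<longleftrightarrow> (card S = 5 \<and> (\<forall>b\<in>B. card b = 2)) \<or> (\<exists>b\<in>B. card b + 2 = card S)"
proof -
  have cS: "card (S - b) = card S - card b" if "b \<in> B" for b
    using card_Diff_subset[OF finite_block block_subset] that by blast
  obtain s t where "s \<in> S" "t \<in> S" "s \<noteq> t"
    using p card_le_Suc0_iff_eq[OF finite_points] by auto
  then obtain b1 where b1: "b1 \<in> B" using unique_block by blast
  have near: "excess = 0" if "b \<in> B" "card b + 2 = card S" for b
  proof -
    have "excess = (int (card S) - 4) * (int (card S) - 5) - (int (card b) - 2) * (int (card b) - 3)"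
      using that cS by (intro excess_near_pencil) auto
    then show ?thesis unfolding that(2)[symmetric] by (simp add: algebra_simps)
  qed
  have "excess \<ge> 0 \<and>
    (excess = 0 \<longleftrightarrow> (card S = 5 \<and> (\<forall>b\<in>B. card b = 2)) \<or> (\<exists>b\<in>B. card b + 2 = card S))"
  proof (cases "\<exists>b\<in>B. 4 \<le> card b")
    case True
    then obtain b where b: "b \<in> B" "4 \<le> card b" by blast
    have q: "card S = card b + card (S - b)" "card (S - b) \<ge> 2" using cS[OF b(1)] small[OF b(1)] by auto
    have ge: "excess \<ge> 2 * (int (card b) - 3) * (int (card (S - b)) - 2)"
      using q by (intro excess_ge[OF b(1)]) auto
    have pos: "2 * (int (card b) - 3) * (int (card (S - b)) - 2) \<ge> 0" using b q by simp
    have "card b + 2 = card S" if "excess = 0"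
    proof (rule ccontr)
      assume "card b + 2 \<noteq> card S"
      then have "2 * (int (card b) - 3) * (int (card (S - b)) - 2) > 0" using b q by simp
      then show False using ge that by linarith
    qed
    moreover have "\<not> (\<forall>b\<in>B. card b = 2)" using b by force
    ultimately show ?thesis using ge pos near b(1) by (smt (verit, best))
  next
    case False
    then have le3: "card b \<le> 3" if "b \<in> B" for b using that by force
    have e: "excess = (int (card S) - 4) * (int (card S) - 5)" using le3 by (rule excess_small_blocks)
    have p4: "card S \<ge> 4" using small[OF b1] block_ge_2[OF b1] by linarith
    have "excess \<ge> 0"
    proof (cases "card S = 4")
      case False
      then show ?thesis unfolding e using p4 by simp
    qed (simp add: e)
    moreover have "excess = 0 \<longleftrightarrow> card S = 4 \<or> card S = 5" unfolding e by auto
    \<comment> \<open>For four points the size hypothesis forces blocks of size 2, that is, two less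
      than the number of points; for five points a block of size 3 is of that kind, and otherwise
      all blocks have size 2.\<close>
    moreover have "card b1 + 2 = card S" if "card S = 4"
      using small[OF b1] block_ge_2[OF b1] that by linarith
    moreover have "card b = 2 \<or> card b + 2 = card S" if "card S = 5" "b \<in> B" for b
      using block_ge_2[OF that(2)] le3[OF that(2)] that(1) by linarith
    ultimately show ?thesis using near b1 by metis
  qed
  then show "excess \<ge> 0"
    and "excess = 0 \<longleftrightarrow> (card S = 5 \<and> (\<forall>b\<in>B. card b = 2)) \<or> (\<exists>b\<in>B. card b + 2 = card S)"
    by blast+
qed

end

section \<open>Connected components in rank 3\<close>

context rank3_matroid
begin

section \<open>Circuits joining two given elements\<close>

lemma is_circuitI:
  assumes "C \<subseteq> E" "C \<notin> indeps M" "\<And>x. x \<in> C \<Longrightarrow> C - {x} \<in> indeps M"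
  shows "is_circuit M C"
  unfolding is_circuit_def
proof (intro conjI allI impI)
  fix D assume "D \<subset> C"
  then obtain x where "x \<in> C" "D \<subseteq> C - {x}" by blast
  then show "D \<in> indeps M" using assms(3) indep_mono by blast
qed (use assms in auto)

lemma singleton_indep: "a \<in> E \<Longrightarrow> {a} \<in> indeps M"
  using indep_iff_rk[of "{a}"] by simp

lemma pair_indep_iff:
  assumes "a \<in> E" "b \<in> E" "a \<noteq> b"
  shows "{a, b} \<in> indeps M \<longleftrightarrow> b \<notin> pt a"
  using indep_iff_rk[of "{a, b}"] assms rk_pair[of a b] by simp

lemma pair_indep: "a \<in> E \<Longrightarrow> b \<in> E \<Longrightarrow> b \<notin> pt a \<Longrightarrow> {a, b} \<in> indeps M"
  using pair_indep_iff[of a b] mem_pt[of a] by blast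

lemma rk_triple:
  assumes "a \<in> E" "b \<in> E" "b \<notin> pt a" "c \<in> E" "c \<notin> closure {a, b}"
  shows "rk M {a, b, c} = 3"
proof -
  have "{a, b, c} = insert c {a, b}" by auto
  then show ?thesis using rk_insert_cases[of c "{a, b}"] rk_pair[of a b] assms by simp
qed

lemma triple_indep:
  assumes "a \<in> E" "b \<in> E" "b \<notin> pt a" "c \<in> E" "c \<notin> closure {a, b}"
  shows "{a, b, c} \<in> indeps M"
proof -
  have "a \<in> closure {a, b}" "b \<in> closure {a, b}" using subset_closure[of "{a, b}"] assms by auto
  then have "c \<noteq> a" "c \<noteq> b" using assms(5) by auto
  moreover have "a \<noteq> b" using mem_pt[OF assms(1)] assms(3) by auto
  ultimately have "card {a, b, c} = 3" by simp
  then show ?thesis using indep_iff_rk[of "{a, b, c}"] rk_triple[OF assms] assms by simp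
qed

lemma triple_indep_line:
  assumes "L \<in> lines" "a \<in> L" "b \<in> L" "b \<notin> pt a" "c \<in> E - L"
  shows "{a, b, c} \<in> indeps M"
  using assms line_subset[OF assms(1)] line_eq_closure[OF assms(1-4)] by (intro triple_indep) auto

lemma circuit_parallel:
  assumes "e \<in> E" "f \<in> E" "f \<in> pt e" "e \<noteq> f"
  shows "is_circuit M {e, f}"
proof (rule is_circuitI)
  show "{e, f} \<notin> indeps M" using pair_indep_iff[of e f] assms by simp
  fix x assume "x \<in> {e, f}"
  then have "{e, f} - {x} = {e} \<or> {e, f} - {x} = {f}" using assms(4) by auto
  then show "{e, f} - {x} \<in> indeps M" using singleton_indep assms(1,2) by auto
qed (use assms in auto)

lemma circuit_collinear:
  assumes "L \<in> lines" "e \<in> L" "f \<in> L" "g \<in> L" "f \<notin> pt e" "g \<notin> pt e" "g \<notin> pt f"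
  shows "is_circuit M {e, f, g}"
proof (rule is_circuitI)
  have E: "e \<in> E" "f \<in> E" "g \<in> E" using assms line_subset by auto
  have d: "e \<noteq> f" "e \<noteq> g" "f \<noteq> g" using mem_pt[OF E(1)] mem_pt[OF E(2)] assms by auto
  show "{e, f, g} \<subseteq> E" using E by simp
  have "rk M {e, f, g} \<le> rk M L" using assms by (intro rk_mono) auto
  moreover have "card {e, f, g} = 3" using d by simp
  ultimately show "{e, f, g} \<notin> indeps M" using rk_line[OF assms(1)] rk_indep[of "{e, f, g}"] by auto
  have p: "{f, g} \<in> indeps M" "{e, g} \<in> indeps M" "{e, f} \<in> indeps M"
    using E assms by (simp_all add: pair_indep)
  fix x assume "x \<in> {e, f, g}"
  then have "{e, f, g} - {x} = {f, g} \<or> {e, f, g} - {x} = {e, g} \<or> {e, f, g} - {x} = {e, f}"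
    using d by auto
  then show "{e, f, g} - {x} \<in> indeps M"
    by (elim disjE) (simp_all only: p)
qed

text \<open>Four elements are dependent in rank 3, and the four triples being independent makes the
  set minimal.\<close>

lemma circuit_quadrangle:
  assumes i: "{e, f, g} \<in> indeps M" "{e, f, h} \<in> indeps M" "{e, g, h} \<in> indeps M" "{f, g, h} \<in> indeps M"
    and d: "card {e, f, g, h} = 4"
  shows "is_circuit M {e, f, g, h}"
proof (rule is_circuitI)
  show E: "{e, f, g, h} \<subseteq> E" using indeps_subset[OF i(1)] indeps_subset[OF i(2)] by auto
  show "{e, f, g, h} \<notin> indeps M"
    using rk_le_matroid_rank[OF E] rk_indep[of "{e, f, g, h}"] d rank3 by auto
  fix x assume "x \<in> {e, f, g, h}"
  then have "{e, f, g, h} - {x} \<subseteq> {f, g, h} \<or> {e, f, g, h} - {x} \<subseteq> {e, g, h}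
    \<or> {e, f, g, h} - {x} \<subseteq> {e, f, h} \<or> {e, f, g, h} - {x} \<subseteq> {e, f, g}" by blast
  then show "{e, f, g, h} - {x} \<in> indeps M" using i indep_mono by blast
qed

lemma connected_relI: "is_circuit M C \<Longrightarrow> e \<in> C \<Longrightarrow> f \<in> C \<Longrightarrow> (e, f) \<in> connected_rel M"
  unfolding connected_rel_def is_circuit_def by auto

lemma connected_rel_refl: "e \<in> E \<Longrightarrow> (e, e) \<in> connected_rel M"
  by (simp add: connected_rel_def)

lemma connected_rel_parallel: "e \<in> E \<Longrightarrow> f \<in> pt e \<Longrightarrow> (e, f) \<in> connected_rel M"
  using circuit_parallel[of e f] connected_relI[of "{e, f}" e f] connected_rel_refl[of e] pt_subset[of e]
  by (cases "e = f") auto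

lemma connected_rel_collinear:
  assumes "L \<in> lines" "e \<in> L" "f \<in> L" "g \<in> L" "g \<notin> pt e" "g \<notin> pt f"
  shows "(e, f) \<in> connected_rel M"
proof (cases "f \<in> pt e")
  case True
  then show ?thesis using assms line_subset by (intro connected_rel_parallel) auto
next
  case False
  then show ?thesis using circuit_collinear[of L e f g] assms
    by (intro connected_relI[of "{e, f, g}"]) auto
qed

text \<open>The hypotheses make \<open>M\<close> the direct sum of the line and the point. The
  circuit minus \<open>x\<close> contains nothing parallel to \<open>x\<close>, so it is an
  independent subset of \<open>G\<close>; as \<open>x\<close> is outside the closed set
  \<open>G\<close>, adding it preserves independence.\<close>

lemma connected_rel_line_point:
  assumes G: "G \<in> lines" and x: "x \<in> E - G" and cover: "E \<subseteq> G \<union> pt x"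
    and e: "e \<in> G" and C: "is_circuit M C" "e \<in> C" "x \<in> C"
  shows False
proof -
  have CE: "C \<subseteq> E" "C \<notin> indeps M" and CD: "\<And>D. D \<subset> C \<Longrightarrow> D \<in> indeps M"
    using C(1) by (auto simp: is_circuit_def)
  have xE: "x \<in> E" using x by simp
  have i: "C - {x} \<in> indeps M" using C(3) by (intro CD) auto
  have "C - {x} \<subseteq> G"
  proof
    fix y assume y: "y \<in> C - {x}"
    show "y \<in> G"
    proof (rule ccontr)
      assume "y \<notin> G"
      then have "y \<in> pt x" "y \<in> E" using y CE cover by auto
      moreover have "{x, y} \<subset> C" using y C e x \<open>y \<notin> G\<close> by auto
      then have "{x, y} \<in> indeps M" by (rule CD)
      ultimately show False using pair_indep_iff[of x y] xE y by auto
    qed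
  qed
  then have "closure (C - {x}) \<subseteq> G" using closure_mono[of _ G] line_closure[OF G] by metis
  then have "x \<notin> closure (C - {x})" using x by auto
  then have "rk M (insert x (C - {x})) = Suc (rk M (C - {x}))"
    using rk_insert_cases[OF xE, of "C - {x}"] by simp
  moreover have "insert x (C - {x}) = C" using C(3) by auto
  ultimately have "rk M C = Suc (card (C - {x}))" using rk_indep[OF i] by simp
  moreover have "card C = Suc (card (C - {x}))"
    using C(3) finite_subset[OF CE(1) finite_ground] by (intro card.remove) auto
  ultimately show False using indep_iff_rk[OF CE(1)] CE(2) by simp
qed

text \<open>If no circuit joins \<open>e\<close> and \<open>f\<close>, their line \<open>L\<close>
  contains no third point, and every line spanned by two points off \<open>L\<close> passes through
  \<open>e\<close> or \<open>f\<close>, as otherwise these four elements form a circuit. This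
  rigidity forces all of \<open>E\<close> into one such line and one further point.\<close>

lemma connected_rel_if_no_line_point:
  assumes no: "\<And>G x. G \<in> lines \<Longrightarrow> x \<in> E \<Longrightarrow> \<not> E \<subseteq> G \<union> pt x"
    and e: "e \<in> E" and f: "f \<in> E"
  shows "(e, f) \<in> connected_rel M"
proof (rule ccontr)
  assume nc: "(e, f) \<notin> connected_rel M"
  have fe: "f \<notin> pt e" using nc connected_rel_parallel[OF e] by blast
  have ef: "e \<notin> pt f" using fe mem_pt_commute[OF e f] by simp
  define L where "L = closure {e, f}"
  have L: "L \<in> lines" unfolding L_def using e f fe by (rule closure_pair_line)
  have eL: "e \<in> L" "f \<in> L" unfolding L_def using subset_closure[of "{e, f}"] e f by auto
  have L2: "L \<subseteq> pt e \<union> pt f"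
  proof
    fix g assume g: "g \<in> L"
    show "g \<in> pt e \<union> pt f"
      using connected_rel_collinear[OF L eL(1,2) g] nc by blast
  qed
  have quad: "e \<in> closure {g, h} \<or> f \<in> closure {g, h}"
    if g: "g \<in> E - L" and h: "h \<in> E - L" "h \<notin> pt g" for g h
  proof (rule ccontr)
    assume n: "\<not> (e \<in> closure {g, h} \<or> f \<in> closure {g, h})"
    have E: "g \<in> E" "h \<in> E" using g h by auto
    have "{g, h} \<subseteq> closure {g, h}" using E by (intro subset_closure) auto
    then have d: "e \<noteq> g" "e \<noteq> h" "f \<noteq> g" "f \<noteq> h" using n by auto
    have d2: "g \<noteq> h" "e \<noteq> f" using mem_pt[OF E(1)] h mem_pt[OF e] fe by auto
    have "{e, f, g} \<in> indeps M" "{e, f, h} \<in> indeps M"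
      using L eL fe g h by (auto intro: triple_indep_line)
    moreover have "{g, h, e} \<in> indeps M" "{g, h, f} \<in> indeps M"
      using E h(2) e f n by (auto intro: triple_indep)
    ultimately have "is_circuit M {e, f, g, h}"
      using d d2 by (intro circuit_quadrangle) (simp_all add: insert_commute)
    then show False using nc connected_relI[of "{e, f, g, h}" e f] by simp
  qed
  obtain g where g: "g \<in> E" "g \<notin> L" using no[OF L e] mem_pt[OF e] by blast
  obtain h where h: "h \<in> E" "h \<notin> L" "h \<notin> pt g" using no[OF L g(1)] by blast
  define G where "G = closure {g, h}"
  have G: "G \<in> lines" unfolding G_def using g(1) h(1,3) by (rule closure_pair_line)
  have gG: "g \<in> G" "h \<in> G" unfolding G_def using subset_closure[of "{g, h}"] g h by auto
  have ptL: "a \<notin> pt b" if "a \<in> L" "b \<in> E - L" for a b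
    using mem_pt_commute[of a b] pt_subset_line[OF L that(1)] that line_subset[OF L] by auto
  \<comment> \<open>\<open>a\<close> is whichever of \<open>e\<close> and \<open>f\<close> lies on
    \<open>G\<close>, and \<open>b\<close> is the other one; the contradiction sought is that
    \<open>G\<close> and \<open>pt b\<close> cover \<open>E\<close>.\<close>
  have main: False if a: "a \<in> L" "a \<in> G" and b: "b \<in> L" and ab: "L \<subseteq> pt a \<union> pt b"
    and q: "\<And>g h. g \<in> E - L \<Longrightarrow> h \<in> E - L \<Longrightarrow> h \<notin> pt g \<Longrightarrow> a \<in> closure {g, h} \<or> b \<in> closure {g, h}"
    for a b
  proof -
    have bE: "b \<in> E" using b line_subset[OF L] by auto
    have "E \<subseteq> G \<union> pt b"
    proof
      fix k assume k: "k \<in> E"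
      show "k \<in> G \<union> pt b"
      proof (cases "k \<in> L")
        case True
        then show ?thesis using ab pt_subset_line[OF G a(2)] by blast
      next
        case False
        show ?thesis
        proof (rule ccontr)
          assume "k \<notin> G \<union> pt b"
          then have kG: "k \<notin> G" by simp
          \<comment> \<open>The line through \<open>c\<close> and \<open>k\<close> cannot contain
            \<open>a\<close>, since it would then be \<open>G\<close>; so it contains
            \<open>b\<close> and is the line through \<open>b\<close> and \<open>k\<close>. Used for
            \<open>c = g\<close> and \<open>c = h\<close>, this puts both on that line, which is
            therefore \<open>G\<close>, although \<open>k\<close> is not on
            \<open>G\<close>.\<close>
          have on: "closure {b, k} \<in> lines \<and> c \<in> closure {b, k}" if c: "c \<in> G" "c \<in> E - L" for c
          proof -
            have kc: "k \<notin> pt c" using pt_subset_line[OF G c(1)] kG by auto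
            have cE: "c \<in> E" using c by simp
            have ck: "closure {c, k} \<in> lines" using cE k kc by (rule closure_pair_line)
            have mem: "c \<in> closure {c, k}" "k \<in> closure {c, k}"
              using subset_closure[of "{c, k}"] cE k by auto
            have "a \<notin> closure {c, k}"
            proof
              assume "a \<in> closure {c, k}"
              then have "closure {c, a} = closure {c, k}"
                using ck mem ptL[OF a(1) c(2)] by (intro line_eq_closure) auto
              moreover have "closure {c, a} = G"
                using G c(1) a(2) ptL[OF a(1) c(2)] by (intro line_eq_closure) auto
              ultimately show False using mem kG by simp
            qed
            then have bc: "b \<in> closure {c, k}" using q[OF c(2), of k] k False kc by blast
            have "k \<notin> pt b" using pt_subset_line[OF L b] False by auto
            then have "closure {b, k} = closure {c, k}"
              using ck bc mem by (intro line_eq_closure) auto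
            then show ?thesis using ck mem by simp
          qed
          have g': "g \<in> closure {b, k}" "closure {b, k} \<in> lines" using on[of g] gG g by auto
          have h': "h \<in> closure {b, k}" using on[of h] gG h by auto
          have "closure {b, k} = G"
            using line_eq_closure[OF g'(2,1) h' h(3)] by (simp add: G_def)
          moreover have "k \<in> closure {b, k}" using subset_closure[of "{b, k}"] bE k by auto
          ultimately show False using kG by simp
        qed
      qed
    qed
    then show False using no[OF G bE] by simp
  qed
  have "e \<in> G \<or> f \<in> G" unfolding G_def using g h by (intro quad) auto
  then show False
  proof
    assume "e \<in> G"
    then show False using main[of e f] eL L2 quad by blast
  next
    assume "f \<in> G"
    then show False using main[of f e] eL L2 quad by blast
  qed
qed

lemma num_components_eq_1:
  assumes "\<And>e f. e \<in> E \<Longrightarrow> f \<in> E \<Longrightarrow> (e, f) \<in> connected_rel M" and ne: "E \<noteq> {}"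
  shows "num_components M = 1"
proof -
  have cls: "connected_rel M `` {e} = E" if "e \<in> E" for e
    using assms(1)[OF that] by (auto simp: connected_rel_def)
  have "E // connected_rel M = {E}"
    unfolding quotient_def using cls ne by auto
  then show ?thesis by (simp add: num_components_def)
qed

lemma mem_connected_relD: "(e, f) \<in> connected_rel M \<Longrightarrow> e \<in> E \<and> f \<in> E \<and> (e = f \<or> (\<exists>C. is_circuit M C \<and> e \<in> C \<and> f \<in> C))"
  by (auto simp: connected_rel_def)

lemma connected_rel_subset_point:
  assumes "G \<in> lines" "x \<in> E - G" "E \<subseteq> G \<union> pt x" "(e, x) \<in> connected_rel M \<or> (x, e) \<in> connected_rel M"
  shows "e \<in> pt x"
proof (rule ccontr)
  assume n: "e \<notin> pt x"
  have xE: "x \<in> E" using assms(2) by simp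
  obtain C where "is_circuit M C" "e \<in> C" "x \<in> C" and "e \<in> E"
    using assms(4) mem_connected_relD[of e x] mem_connected_relD[of x e] n mem_pt[OF xE] by blast
  then show False using connected_rel_line_point[OF assms(1-3), of e C] assms(3) n by blast
qed

end

section \<open>Simplification\<close>

lemma two_times_choose_two: "2 * int ((n - k) choose 2) = (int n - int k) * (int n - int k - 1)" if "k \<le> n"
proof -
  have "even ((n - k) * (n - k - 1))" by (cases "n - k") auto
  then have "2 * ((n - k) choose 2) = (n - k) * (n - k - 1)" by (simp add: choose_two)
  then have "2 * int ((n - k) choose 2) = int (n - k) * int (n - k - 1)"
    by (metis of_nat_mult of_nat_numeral)
  also have "\<dots> = (int n - int k) * (int n - int k - 1)"
    using that by (cases "n = k") (auto simp: of_nat_diff)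
  finally show ?thesis .
qed

text \<open>\<open>S\<close> is the ground set of a simplification, with parallelism expressed
  through closures of single elements.\<close>

locale rank3_transversal = rank3_coloopless M for M :: "'a set_system" +
  fixes S :: "'a set"
  assumes S_subset: "S \<subseteq> E"
    and transversal: "e \<in> E \<Longrightarrow> \<exists>!s. s \<in> S \<and> e \<in> pt s"
begin

definition blocks :: "'a set set" where
  "blocks = (\<lambda>L. L \<inter> S) ` lines"

lemma obtain_rep:
  assumes "e \<in> E"
  obtains s where "s \<in> S" "s \<in> E" "pt s = pt e" "e \<in> pt s"
proof -
  obtain s where s: "s \<in> S" "e \<in> pt s" using transversal[OF assms] by blast
  moreover have "s \<in> E" using s S_subset by auto
  moreover have "pt s = pt e" using pt_eq[OF \<open>s \<in> E\<close> s(2)] by simp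
  ultimately show ?thesis using that by blast
qed

lemma rep_notin_pt: "s \<in> S \<Longrightarrow> t \<in> S \<Longrightarrow> s \<noteq> t \<Longrightarrow> t \<notin> pt s"
  using transversal[of t] mem_pt[of t] S_subset by blast

lemma finite_S: "finite S"
  using finite_subset[OF S_subset finite_ground] .

lemma inj_on_pt: "inj_on pt S"
  by (rule inj_onI) (use rep_notin_pt mem_pt S_subset in blast)

lemma line_block_pair:
  assumes L: "L \<in> lines"
  obtains s t where "s \<in> L \<inter> S" "t \<in> L \<inter> S" "s \<noteq> t" "t \<notin> pt s"
proof -
  obtain b where b: "b \<in> L" using rk_line[OF L] by (cases "L = {}") auto
  then have bE: "b \<in> E" using line_subset[OF L] by auto
  obtain c where c: "c \<in> L" "c \<notin> pt b" using line_diff_pt_nonempty[OF L bE] by auto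
  then have cE: "c \<in> E" using line_subset[OF L] by auto
  obtain s where s: "s \<in> S" "s \<in> E" "pt s = pt b" using obtain_rep[OF bE] by blast
  obtain t where t: "t \<in> S" "t \<in> E" "pt t = pt c" using obtain_rep[OF cE] by blast
  have "s \<in> L" using pt_subset_line[OF L b] mem_pt[OF s(2)] s(3) by auto
  moreover have "t \<in> L" using pt_subset_line[OF L c(1)] mem_pt[OF t(2)] t(3) by auto
  moreover have "s \<noteq> t" using s(3) t(3) c(2) mem_pt[OF cE] by auto
  ultimately show ?thesis using that[of s t] s(1) t(1) rep_notin_pt[of s t] by blast
qed

lemma closure_line_block: "L \<in> lines \<Longrightarrow> closure (L \<inter> S) = L"
proof -
  assume L: "L \<in> lines"
  obtain s t where st: "s \<in> L \<inter> S" "t \<in> L \<inter> S" "t \<notin> pt s" using line_block_pair[OF L] by metis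
  have "L = closure {s, t}" using line_eq_closure[OF L, of s t] st by simp
  also have "\<dots> \<subseteq> closure (L \<inter> S)" using st by (intro closure_mono) auto
  finally show ?thesis using closure_mono[of "L \<inter> S" L] line_closure[OF L] by auto
qed

lemma inj_on_block: "inj_on (\<lambda>L. L \<inter> S) lines"
  by (rule inj_onI) (metis closure_line_block)

sublocale ls: linear_space S blocks
proof
  show "finite S" by (rule finite_S)
  fix b assume "b \<in> blocks"
  then obtain L where L: "L \<in> lines" "b = L \<inter> S" by (auto simp: blocks_def)
  show "b \<subseteq> S" using L by simp
  obtain s t where st: "s \<in> L \<inter> S" "t \<in> L \<inter> S" "s \<noteq> t" using line_block_pair[OF L(1)] by metis
  have "card {s, t} \<le> card b" using st finite_S unfolding L(2) by (intro card_mono) auto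
  then show "2 \<le> card b" using st by simp
next
  fix s t assume st: "s \<in> S" "t \<in> S" "s \<noteq> t"
  have E: "s \<in> E" "t \<in> E" using st S_subset by auto
  have nt: "t \<notin> pt s" using st by (rule rep_notin_pt)
  define L where "L = closure {s, t}"
  have L: "L \<in> lines" unfolding L_def using E nt by (rule closure_pair_line)
  have "{s, t} \<subseteq> L" unfolding L_def using E by (intro subset_closure) auto
  then have mem: "L \<inter> S \<in> blocks" "s \<in> L \<inter> S" "t \<in> L \<inter> S" using L st by (auto simp: blocks_def)
  show "\<exists>!b. b \<in> blocks \<and> s \<in> b \<and> t \<in> b"
  proof (rule ex1I[of _ "L \<inter> S"])
    fix b assume b: "b \<in> blocks \<and> s \<in> b \<and> t \<in> b"
    then obtain L' where L': "L' \<in> lines" "b = L' \<inter> S" by (auto simp: blocks_def)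
    have "closure {s, t} = L'" using b L' nt by (intro line_eq_closure) auto
    then show "b = L \<inter> S" using L' by (simp add: L_def)
  qed (use mem in blast)
qed

lemma card_eq_sum_pt:
  assumes A: "A \<subseteq> E" and sat: "\<And>a. a \<in> A \<Longrightarrow> pt a \<subseteq> A"
  shows "card A = (\<Sum>s\<in>A \<inter> S. card (pt s))"
proof -
  have "A = (\<Union>s\<in>A \<inter> S. pt s)"
  proof
    show "A \<subseteq> (\<Union>s\<in>A \<inter> S. pt s)"
    proof
      fix a assume a: "a \<in> A"
      then have aE: "a \<in> E" using A by auto
      obtain s where s: "s \<in> S" "s \<in> E" "pt s = pt a" "a \<in> pt s" by (rule obtain_rep[OF aE])
      have "s \<in> pt a" using mem_pt[OF s(2)] s(3) by simp
      then have "s \<in> A \<inter> S" using sat[OF a] s(1) by auto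
      then show "a \<in> (\<Union>s\<in>A \<inter> S. pt s)" using s(4) by blast
    qed
  qed (use sat in auto)
  then have "card A = card (\<Union>s\<in>A \<inter> S. pt s)" by (rule arg_cong)
  also have "\<dots> = (\<Sum>s\<in>A \<inter> S. card (pt s))"
  proof (rule card_UN_disjoint)
    show "finite (A \<inter> S)" using finite_S by simp
    show "\<forall>i\<in>A \<inter> S. finite (pt i)" by simp
    show "\<forall>i\<in>A \<inter> S. \<forall>j\<in>A \<inter> S. i \<noteq> j \<longrightarrow> pt i \<inter> pt j = {}"
    proof (intro ballI impI equals0I)
      fix i j x assume "i \<in> A \<inter> S" "j \<in> A \<inter> S" "i \<noteq> j" "x \<in> pt i \<inter> pt j"
      moreover from this have "x \<in> E" using pt_subset[of i] by auto
      ultimately show False using transversal[of x] by blast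
    qed
  qed
  finally show ?thesis .
qed

text \<open>With the size of its parallel class as the weight of each representative,
  \<open>E\<close>, the lines and the points of \<open>M\<close> have weighted cardinalities;
  \<open>weighted_excess\<close> then shows that the weights do not influence the result.\<close>

lemma two_times_omega_value: "2 * omega_value = ls.excess"
proof -
  define x where "x s = int (card (pt s))" for s
  have ES: "E \<inter> S = S" using S_subset by auto
  have cE: "int (card E) = (\<Sum>s\<in>S. x s)"
    using card_eq_sum_pt[of E] pt_subset by (simp add: ES x_def)
  have cL: "int (card L) = (\<Sum>s\<in>L \<inter> S. x s)" if L: "L \<in> lines" for L
    using card_eq_sum_pt[OF line_subset[OF L] pt_subset_line[OF L]] by (simp add: x_def)
  have pts: "points = pt ` S"
  proof
    show "points \<subseteq> pt ` S"
    proof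
      fix P assume "P \<in> points"
      then obtain e where e: "e \<in> E" "P = pt e" by (auto simp: points_def)
      obtain s where "s \<in> S" "pt s = pt e" using obtain_rep[OF e(1)] by metis
      then show "P \<in> pt ` S" using e(2) by blast
    qed
    show "pt ` S \<subseteq> points" using S_subset by (auto simp: points_def)
  qed
  have rep: "card (lines_through (pt s)) = ls.rep s" if s: "s \<in> S" for s
  proof -
    have sE: "s \<in> E" using s S_subset by auto
    have "{b \<in> blocks. s \<in> b} = (\<lambda>L. L \<inter> S) ` lines_at s"
      using s by (auto simp: blocks_def lines_at_def)
    moreover have "inj_on (\<lambda>L. L \<inter> S) (lines_at s)"
      by (rule inj_on_subset[OF inj_on_block]) (auto simp: lines_at_def)
    ultimately show ?thesis by (simp add: ls.rep_def card_image lines_through_pt[OF sE])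
  qed
  \<comment> \<open>This makes the truncated subtraction \<open>card E - 4\<close> in
    \<open>omega_value\<close> agree with the integer one.\<close>
  have E4: "card E \<ge> 4"
  proof -
    obtain s where s: "s \<in> E" using lines_at_nonempty rank3 rk_empty
      unfolding matroid_rank_def by (metis equals0I zero_neq_numeral)
    have "card E = card (pt s) + card (E - pt s)"
      using card_Diff_subset[OF finite_closure pt_subset, of s] card_mono[OF finite_ground pt_subset[of s]] by simp
    then show ?thesis using card_compl_pt[OF s] card_pt_pos[OF s] by simp
  qed
  have L: "2 * (\<Sum>L\<in>lines. int ((card L - 2) choose 2))
      = (\<Sum>b\<in>blocks. ((\<Sum>s\<in>b. x s) - 2) * ((\<Sum>s\<in>b. x s) - 3))"
    unfolding blocks_def sum.reindex[OF inj_on_block] o_def sum_distrib_left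
  proof (rule sum.cong[OF refl])
    fix L assume L: "L \<in> lines"
    have "rk M L \<le> card L" by (rule rk_le_card[OF finite_line[OF L]])
    then show "2 * int ((card L - 2) choose 2) = ((\<Sum>s\<in>L \<inter> S. x s) - 2) * ((\<Sum>s\<in>L \<inter> S. x s) - 3)"
      using two_times_choose_two[of 2 "card L"] rk_line[OF L] by (simp add: cL[OF L] algebra_simps)
  qed
  have P: "2 * (\<Sum>P\<in>points. int ((card P - 1) choose 2) * (int (card (lines_through P)) - 1)
        + (int (card P) - 1) * (3 - int (card (lines_through P))))
      = (\<Sum>s\<in>S. (x s - 1) * (x s - 2) * (int (ls.rep s) - 1) + 2 * (x s - 1) * (3 - int (ls.rep s)))"
    unfolding pts sum.reindex[OF inj_on_pt] o_def sum_distrib_left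
  proof (rule sum.cong[OF refl])
    fix s assume s: "s \<in> S"
    then have sE: "s \<in> E" using S_subset by auto
    have "2 * int ((card (pt s) - 1) choose 2) = (x s - 1) * (x s - 2)"
      using two_times_choose_two[of 1 "card (pt s)"] card_pt_pos[OF sE] by (simp add: x_def)
    then show "2 * (int ((card (pt s) - 1) choose 2) * (int (card (lines_through (pt s))) - 1)
        + (int (card (pt s)) - 1) * (3 - int (card (lines_through (pt s)))))
      = (x s - 1) * (x s - 2) * (int (ls.rep s) - 1) + 2 * (x s - 1) * (3 - int (ls.rep s))"
      unfolding rep[OF s] distrib_left mult.assoc[symmetric] by (simp add: x_def)
  qed
  have E: "2 * int ((card E - 4) choose 2) = ((\<Sum>s\<in>S. x s) - 4) * ((\<Sum>s\<in>S. x s) - 5)"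
    using two_times_choose_two[OF E4] by (simp add: cE)
  have "2 * (a - b + c) = 2 * a - 2 * b + 2 * c" for a b c :: int by simp
  then show ?thesis
    unfolding omega_value_def using E L P ls.weighted_excess[of x] by presburger
qed

lemma block_subset_card: "L \<in> lines \<Longrightarrow> card (L \<inter> S) < card S"
proof -
  assume L: "L \<in> lines"
  have "\<not> S \<subseteq> L"
  proof
    assume S: "S \<subseteq> L"
    have "E \<subseteq> L"
    proof
      fix e assume e: "e \<in> E"
      obtain s where "s \<in> S" "e \<in> pt s" by (rule obtain_rep[OF e])
      then show "e \<in> L" using S pt_subset_line[OF L] by blast
    qed
    then have "card (E - L) = 0" by (simp add: Diff_eq_empty_iff[THEN iffD2])
    then show False using card_compl_line[OF L] by linarith
  qed
  then show ?thesis using finite_S by (intro psubset_card_mono) auto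
qed

lemma line_point_cover:
  assumes L: "L \<in> lines" and c: "card S = Suc (card (L \<inter> S))"
  obtains x where "x \<in> S" "x \<in> E - L" "E \<subseteq> L \<union> pt x"
proof -
  have "card (S - L) = 1"
    using c card_Int_Diff[OF finite_S, of L] by (simp add: Int_commute)
  then obtain x where x: "S - L = {x}" by (auto simp: card_1_singleton_iff)
  have "E \<subseteq> L \<union> pt x"
  proof
    fix e assume e: "e \<in> E"
    obtain s where s: "s \<in> S" "e \<in> pt s" by (rule obtain_rep[OF e])
    show "e \<in> L \<union> pt x"
    proof (cases "s \<in> L")
      case True
      then show ?thesis using pt_subset_line[OF L] s(2) by blast
    next
      case False
      then have "s = x" using s(1) x by blast
      then show ?thesis using s(2) by blast
    qed
  qed
  moreover have "x \<in> S" "x \<in> E - L" using x S_subset by auto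
  ultimately show ?thesis using that by blast
qed

lemma num_components_connected:
  assumes "\<And>L. L \<in> lines \<Longrightarrow> card (L \<inter> S) + 2 \<le> card S"
  shows "num_components M = 1"
proof (rule num_components_eq_1)
  show "E \<noteq> {}" using rank3 rk_empty unfolding matroid_rank_def by (metis zero_neq_numeral)
  fix e f assume "e \<in> E" "f \<in> E"
  moreover have "\<not> E \<subseteq> G \<union> pt x" if G: "G \<in> lines" and x: "x \<in> E" for G x
  proof
    assume "E \<subseteq> G \<union> pt x"
    obtain s where s: "s \<in> S" "pt s = pt x" using obtain_rep[OF x] by metis
    have "S \<subseteq> insert s (G \<inter> S)"
    proof
      fix t assume t: "t \<in> S"
      then have "t \<in> G \<or> t \<in> pt s" using \<open>E \<subseteq> G \<union> pt x\<close> s(2) S_subset by auto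
      then show "t \<in> insert s (G \<inter> S)" using t rep_notin_pt[of s t] s(1) by blast
    qed
    then have "card S \<le> card (insert s (G \<inter> S))" using finite_S by (intro card_mono) auto
    also have "\<dots> \<le> Suc (card (G \<inter> S))" by (simp add: card_insert_if finite_S)
    finally show False using assms[OF G] by simp
  qed
  ultimately show "(e, f) \<in> connected_rel M" by (intro connected_rel_if_no_line_point) auto
qed

lemma connected_rel_class_point:
  assumes G: "G \<in> lines" "x \<in> E - G" "E \<subseteq> G \<union> pt x"
  shows "connected_rel M `` {x} = pt x"
proof (intro equalityI subsetI)
  fix y assume "y \<in> connected_rel M `` {x}"
  then show "y \<in> pt x" using connected_rel_subset_point[OF G, of y] by blast
next
  fix y assume "y \<in> pt x"
  then show "y \<in> connected_rel M `` {x}" using connected_rel_parallel[of x y] G(2) by blast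
qed

text \<open>Each of the three points is complementary to the line through the other two, so by
  \<open>connected_rel_class_point\<close> it is a component.\<close>

lemma num_components_3:
  assumes "card S = 3"
  shows "num_components M = 3"
proof -
  have cls: "connected_rel M `` {x} = pt x" if x: "x \<in> E" for x
  proof -
    obtain s where s: "s \<in> S" "s \<in> E" "pt s = pt x" "x \<in> pt s" by (rule obtain_rep[OF x])
    have "card (S - {s}) = 2" using assms s(1) finite_S by simp
    then obtain t t' where t: "S - {s} = {t, t'}" "t \<noteq> t'" by (auto simp: card_2_iff)
    then have tS: "t \<in> S" "t' \<in> S" "S = {s, t, t'}" using s(1) by auto
    have tE: "t \<in> E" "t' \<in> E" using tS S_subset by auto
    define G where "G = closure {t, t'}"
    have G: "G \<in> lines" unfolding G_def
      using tE rep_notin_pt[OF tS(1,2) t(2)] by (rule closure_pair_line)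
    have tG: "{t, t'} \<subseteq> G" unfolding G_def using tE by (intro subset_closure) auto
    have "s \<notin> G"
    proof
      assume "s \<in> G"
      then have "G \<inter> S = S" using tG tS(3) by auto
      then show False using block_subset_card[OF G] by simp
    qed
    have xG: "x \<in> E - G"
    proof -
      have "s \<in> pt x" using mem_pt[OF s(2)] s(3) by simp
      then have "x \<notin> G" using pt_subset_line[OF G, of x] \<open>s \<notin> G\<close> by auto
      then show ?thesis using x by simp
    qed
    have "E \<subseteq> G \<union> pt x"
    proof
      fix e assume e: "e \<in> E"
      obtain r where r: "r \<in> S" "e \<in> pt r" by (rule obtain_rep[OF e])
      show "e \<in> G \<union> pt x"
      proof (cases "r = s")
        case True
        then show ?thesis using r(2) s(3) by simp
      next
        case False
        then have "r \<in> G" using r(1) tS(3) tG by auto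
        then show ?thesis using pt_subset_line[OF G] r(2) by blast
      qed
    qed
    then show ?thesis by (rule connected_rel_class_point[OF G xG])
  qed
  have "E // connected_rel M = pt ` S"
  proof
    show "E // connected_rel M \<subseteq> pt ` S"
    proof
      fix A assume "A \<in> E // connected_rel M"
      then obtain x where x: "x \<in> E" "A = pt x" using cls by (auto simp: quotient_def)
      obtain s where "s \<in> S" "pt s = pt x" using obtain_rep[OF x(1)] by metis
      then show "A \<in> pt ` S" using x(2) by blast
    qed
    show "pt ` S \<subseteq> E // connected_rel M"
    proof
      fix A assume "A \<in> pt ` S"
      then obtain s where s: "s \<in> S" "A = pt s" by blast
      then have "s \<in> E" using S_subset by auto
      then show "A \<in> E // connected_rel M" using quotientI[of s E "connected_rel M"] cls s(2) by simp
    qed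
  qed
  then show ?thesis using assms by (simp add: num_components_def card_image[OF inj_on_pt])
qed

text \<open>The components are the line and the one point off it: no circuit crosses between them,
  and inside each of them any two elements are joined.\<close>

lemma num_components_2:
  assumes L: "L \<in> lines" and c: "card S = Suc (card (L \<inter> S))" and p: "card S \<ge> 4"
  shows "num_components M = 2"
proof -
  obtain x where x: "x \<in> S" "x \<in> E - L" "E \<subseteq> L \<union> pt x" by (rule line_point_cover[OF L c])
  have xE: "x \<in> E" using x by simp
  have clx: "connected_rel M `` {y} = pt x" if y: "y \<in> pt x" for y
  proof -
    have yx: "pt y = pt x" using y by (rule pt_eq[OF xE])
    have yE: "y \<in> E" using y pt_subset[of x] by auto
    have "x \<in> pt y" using mem_pt[OF xE] yx by simp
    then have "y \<in> E - L" using pt_subset_line[OF L, of y] x(2) yE by blast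
    then have "connected_rel M `` {y} = pt y" using x(3) yx by (intro connected_rel_class_point[OF L]) auto
    then show ?thesis using yx by simp
  qed
  have clL: "connected_rel M `` {y} = L" if y: "y \<in> L" for y
  proof (intro equalityI subsetI)
    fix w assume "w \<in> connected_rel M `` {y}"
    then have yw: "(y, w) \<in> connected_rel M" by simp
    then have wE: "w \<in> E" using mem_connected_relD by blast
    show "w \<in> L"
    proof (rule ccontr)
      assume "w \<notin> L"
      then have w: "w \<in> pt x" "w \<in> E - L" using wE x(3) by auto
      have "E \<subseteq> L \<union> pt w" using x(3) pt_eq[OF xE w(1)] by simp
      then have "y \<in> pt w" using connected_rel_subset_point[OF L w(2), of y] yw by blast
      moreover have "w \<notin> pt y" using pt_subset_line[OF L y] w(2) by blast
      ultimately show False using mem_pt_commute[of y w] y line_subset[OF L] wE by blast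
    qed
  next
    fix w assume w: "w \<in> L"
    have yE: "y \<in> E" and wE: "w \<in> E" using y w line_subset[OF L] by auto
    obtain s where s: "s \<in> S" "pt s = pt y" using obtain_rep[OF yE] by metis
    obtain t where t: "t \<in> S" "pt t = pt w" using obtain_rep[OF wE] by metis
    \<comment> \<open>With at least four points in all, the line has at least three, so some point
      \<open>g\<close> on it differs from those of \<open>y\<close> and \<open>w\<close>;
      collinearity with \<open>g\<close> connects these two.\<close>
    have "\<not> L \<inter> S \<subseteq> {s, t}"
    proof
      assume "L \<inter> S \<subseteq> {s, t}"
      then have "card (L \<inter> S) \<le> card {s, t}" by (intro card_mono) auto
      also have "\<dots> \<le> 2" by (simp add: card_insert_if)
      finally show False using c p by simp
    qed
    then obtain g where g: "g \<in> L" "g \<in> S" "g \<noteq> s" "g \<noteq> t" by blast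
    have "g \<notin> pt y" "g \<notin> pt w" using rep_notin_pt[OF s(1) g(2)] rep_notin_pt[OF t(1) g(2)] g s t by auto
    then show "w \<in> connected_rel M `` {y}" using connected_rel_collinear[OF L y w g(1)] by simp
  qed
  have Lne: "\<exists>y. y \<in> L" using rk_line[OF L] by (cases "L = {}") auto
  then obtain y where y: "y \<in> L" by blast
  then have yE: "y \<in> E" using line_subset[OF L] by auto
  have "E // connected_rel M = {L, pt x}"
  proof
    show "E // connected_rel M \<subseteq> {L, pt x}"
    proof
      fix A assume "A \<in> E // connected_rel M"
      then obtain e where e: "e \<in> E" "A = connected_rel M `` {e}" by (auto simp: quotient_def)
      then show "A \<in> {L, pt x}" using clx[of e] clL[of e] x(3) by blast
    qed
    show "{L, pt x} \<subseteq> E // connected_rel M"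
      using quotientI[OF yE, of "connected_rel M"] quotientI[OF xE, of "connected_rel M"]
        clL[OF y] clx[OF mem_pt[OF xE]] by simp
  qed
  moreover have "L \<noteq> pt x" using mem_pt[OF xE] x(2) by blast
  ultimately show ?thesis by (simp add: num_components_def)
qed

end

section \<open>Rank conditions from the absence of loops and coloops\<close>

context matroid
begin

lemma closure_empty:
  assumes "\<And>e. \<not> is_loop M e"
  shows "closure {} = {}"
proof -
  have False if e: "e \<in> closure {}" for e
  proof -
    have "e \<in> ground M" "rk M {e} = 0" using e by (auto simp: closure_def)
    moreover from this have "{e} \<in> indeps M" using assms[of e] by (auto simp: is_loop_def)
    ultimately show False using rk_indep[of "{e}"] by simp
  qed
  then show ?thesis by blast
qed

text \<open>A basis avoiding \<open>e\<close> is maximal, hence of full rank, and lies in the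
  complement of \<open>e\<close>.\<close>

lemma rk_remove_not_coloop:
  assumes e: "e \<in> ground M" and nc: "\<not> is_coloop M e"
  shows "rk M (ground M - {e}) = matroid_rank M"
proof -
  obtain B where B: "is_basis M B" "e \<notin> B" using e nc by (auto simp: is_coloop_def)
  have i: "B \<in> indeps M" "B \<subseteq> ground M" using B indeps_subset by (auto simp: is_basis_def)
  obtain J where J: "J \<in> indeps M" "B \<subseteq> J" "J \<subseteq> ground M" "card J = rk M (ground M)"
    by (rule indep_extend[OF i])
  then have "card B = matroid_rank M" using B(1) by (auto simp: is_basis_def matroid_rank_def)
  moreover have "card B \<le> rk M (ground M - {e})" using B(2) i by (intro card_le_rk) auto
  ultimately show ?thesis
    using rk_le_matroid_rank[of "ground M - {e}"] by simp
qed

end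

lemma (in rank3_matroid) parallel_iff_pt:
  assumes "e \<in> E" "s \<in> E"
  shows "parallel M e s \<longleftrightarrow> e \<in> pt s"
proof
  assume p: "parallel M e s"
  show "e \<in> pt s"
  proof (cases "e = s")
    case True
    then show ?thesis using mem_pt[OF assms(2)] by simp
  next
    case False
    then have "{e, s} \<notin> indeps M" using p by (simp add: parallel_def is_circuit_def)
    then show ?thesis using pair_indep[OF assms(2,1)] by (auto simp: insert_commute)
  qed
next
  assume "e \<in> pt s"
  then show "parallel M e s"
    using circuit_parallel[OF assms(2,1)] by (auto simp: parallel_def insert_commute)
qed

context rank3_transversal
begin

section \<open>Flats and isomorphism type of the simplification\<close>

abbreviation N :: "'a set_system" where
  "N \<equiv> matroid_restrict M S"

lemma ground_N: "ground N = S"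
  by (simp add: matroid_restrict_def)

lemma indeps_N: "X \<in> indeps N \<longleftrightarrow> X \<in> indeps M \<and> X \<subseteq> S"
  by (simp add: matroid_restrict_def)

lemma rk_N:
  assumes "X \<subseteq> S"
  shows "rk N X = rk M X"
proof -
  have "{I \<in> indeps N. I \<subseteq> X} = {I \<in> indeps M. I \<subseteq> X}" using assms by (auto simp: indeps_N)
  then show ?thesis by (simp add: rk_def)
qed

text \<open>Closure in \<open>M\<close> and intersection with \<open>S\<close> translate between the
  rank 2 flats of the simplification and the lines of \<open>M\<close>, so these flats are exactly
  the blocks.\<close>

lemma ex_flat_N_iff:
  "(\<exists>F. is_flat N F \<and> rk N F = 2 \<and> card (ground N - F) = 2) \<longleftrightarrow> (\<exists>b\<in>blocks. card b + 2 = card S)"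
proof
  assume "\<exists>F. is_flat N F \<and> rk N F = 2 \<and> card (ground N - F) = 2"
  then obtain F where F: "is_flat N F" "rk N F = 2" "card (S - F) = 2" by (auto simp: ground_N)
  have FS: "F \<subseteq> S" using F(1) by (simp add: is_flat_def ground_N)
  then have FE: "F \<subseteq> E" using S_subset by auto
  have r: "rk M F = 2" using F(2) rk_N[OF FS] by simp
  have L: "closure F \<in> lines"
    unfolding lines_def is_flat_iff_closure using FE r by (simp add: closure_subset_ground)
  have "closure F \<inter> S = F"
  proof
    show "closure F \<inter> S \<subseteq> F"
    proof
      fix e assume e: "e \<in> closure F \<inter> S"
      show "e \<in> F"
      proof (rule ccontr)
        assume "e \<notin> F"
        then have "rk N F < rk N (insert e F)" using F(1) e by (simp add: is_flat_def ground_N)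
        then have "rk M F < rk M (insert e F)" using rk_N[of F] rk_N[of "insert e F"] FS e by simp
        then show False using e by (simp add: closure_def)
      qed
    qed
    show "F \<subseteq> closure F \<inter> S" using subset_closure[OF FE] FS by simp
  qed
  then have "F \<in> blocks" using L unfolding blocks_def by (metis image_eqI)
  moreover have "card F + 2 = card S"
    using F(3) card_Diff_subset[OF finite_subset[OF FS finite_S] FS] card_mono[OF finite_S FS] by simp
  ultimately show "\<exists>b\<in>blocks. card b + 2 = card S" by blast
next
  assume "\<exists>b\<in>blocks. card b + 2 = card S"
  then obtain L where L: "L \<in> lines" and c: "card (L \<inter> S) + 2 = card S" by (auto simp: blocks_def)
  define F where "F = L \<inter> S"
  have FS: "F \<subseteq> S" "F \<subseteq> E" using S_subset by (auto simp: F_def)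
  have r: "rk M F = 2"
    using rk_closure[OF FS(2)] closure_line_block[OF L] rk_line[OF L] by (simp add: F_def)
  have "is_flat N F"
    unfolding is_flat_def ground_N
  proof (intro conjI ballI)
    fix e assume e: "e \<in> S - F"
    then have eL: "e \<notin> closure F" "e \<in> E" using closure_line_block[OF L] S_subset by (auto simp: F_def)
    have "rk M F < rk M (insert e F)" using rk_insert_cases[OF eL(2), of F] eL(1) by simp
    then show "rk N F < rk N (insert e F)" using rk_N[of F] rk_N[of "insert e F"] FS e by simp
  qed (rule FS)
  moreover have "rk N F = 2" using r rk_N[OF FS(1)] by simp
  moreover have "card (ground N - F) = 2"
    using c card_Diff_subset[OF finite_subset[OF FS(1) finite_S] FS(1)]
    by (simp add: ground_N F_def)
  ultimately show "\<exists>F. is_flat N F \<and> rk N F = 2 \<and> card (ground N - F) = 2" by blast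
qed

text \<open>All blocks having size 2 means that no three points are collinear, that is, that every
  triple of points is independent.\<close>

lemma iso_uniform_iff:
  "matroid_iso N (uniform_matroid 3 5) \<longleftrightarrow> card S = 5 \<and> (\<forall>b\<in>blocks. card b = 2)"
proof
  assume "matroid_iso N (uniform_matroid 3 5)"
  then obtain \<phi> where bij: "bij_betw \<phi> S {..<5 :: nat}"
    and iso: "\<And>X. X \<subseteq> S \<Longrightarrow> X \<in> indeps N \<longleftrightarrow> \<phi> ` X \<in> indeps (uniform_matroid 3 5)"
    by (auto simp: matroid_iso_def ground_N uniform_matroid_def)
  have "card b = 2" if b: "b \<in> blocks" for b
  proof (rule ccontr)
    assume "card b \<noteq> 2"
    then have "3 \<le> card b" using ls.block_ge_2[OF b] by simp
    then obtain X where X: "X \<subseteq> b" "card X = 3" by (rule obtain_subset_with_card_n) auto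
    obtain L where L: "L \<in> lines" "b = L \<inter> S" using b by (auto simp: blocks_def)
    have XS: "X \<subseteq> S" using X L by auto
    have "card (\<phi> ` X) = 3" using X(2) card_image[OF inj_on_subset[OF bij_betw_imp_inj_on[OF bij] XS]] by simp
    moreover have "\<phi> ` X \<subseteq> {..<5}" using bij_betw_imp_surj_on[OF bij] XS by auto
    ultimately have "X \<in> indeps M" using iso[OF XS] by (simp add: uniform_matroid_def indeps_N)
    then have "rk M X = 3" using rk_indep X(2) by simp
    moreover have "rk M X \<le> rk M L" using X L by (intro rk_mono) auto
    ultimately show False using rk_line[OF L(1)] by simp
  qed
  moreover have "card S = 5" using bij_betw_same_card[OF bij] by simp
  ultimately show "card S = 5 \<and> (\<forall>b\<in>blocks. card b = 2)" by blast
next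
  assume a: "card S = 5 \<and> (\<forall>b\<in>blocks. card b = 2)"
  have three: "X \<in> indeps M" if X: "X \<subseteq> S" "card X = 3" for X
  proof -
    obtain p q r where pqr: "X = {p, q, r}" "p \<noteq> q" "p \<noteq> r" "q \<noteq> r"
      using X(2) by (auto simp: card_3_iff)
    have S: "p \<in> S" "q \<in> S" "r \<in> S" and E: "p \<in> E" "q \<in> E" "r \<in> E"
      using X(1) pqr(1) S_subset by auto
    have nq: "q \<notin> pt p" using S(1,2) pqr(2) by (rule rep_notin_pt)
    have L: "closure {p, q} \<in> lines" using E(1,2) nq by (rule closure_pair_line)
    have pq: "{p, q} \<subseteq> closure {p, q}" using E by (intro subset_closure) auto
    have "r \<notin> closure {p, q}"
    proof
      assume "r \<in> closure {p, q}"
      then have "X \<subseteq> closure {p, q} \<inter> S" using pq S pqr(1) by auto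
      then have "card X \<le> card (closure {p, q} \<inter> S)" using finite_S by (intro card_mono) auto
      moreover have "card (closure {p, q} \<inter> S) = 2" using a L by (auto simp: blocks_def)
      ultimately show False using X(2) by simp
    qed
    then show ?thesis unfolding pqr(1) using E nq by (intro triple_indep)
  qed
  have ind: "X \<in> indeps M \<longleftrightarrow> card X \<le> 3" if X: "X \<subseteq> S" for X
  proof
    assume "X \<in> indeps M"
    then show "card X \<le> 3" using rk_indep rk_le_matroid_rank[of X] rank3 X S_subset by force
  next
    assume le: "card X \<le> 3"
    have fX: "finite X" using finite_subset[OF X finite_S] .
    \<comment> \<open>A smaller set is enlarged to a triple inside \<open>S\<close> and inherits
      independence from it.\<close>
    have "3 - card X \<le> card (S - X)" using a card_Diff_subset[OF fX X] by simp
    then obtain Y where Y: "Y \<subseteq> S - X" "card Y = 3 - card X" by (rule obtain_subset_with_card_n) auto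
    have "card (X \<union> Y) = 3"
      using Y le fX finite_subset[OF Y(1)] finite_S by (subst card_Un_disjoint) auto
    then have "X \<union> Y \<in> indeps M" using X Y by (intro three) auto
    then show "X \<in> indeps M" using indep_mono by blast
  qed
  obtain \<phi> where bij: "bij_betw \<phi> S {..<5 :: nat}"
    using finite_same_card_bij[OF finite_S, of "{..<5 :: nat}"] a by auto
  show "matroid_iso N (uniform_matroid 3 5)"
    unfolding matroid_iso_def
  proof (intro exI conjI allI impI)
    show "bij_betw \<phi> (ground N) (ground (uniform_matroid 3 5))"
      using bij by (simp add: ground_N uniform_matroid_def)
    fix X assume "X \<subseteq> ground N"
    then have X: "X \<subseteq> S" by (simp add: ground_N)
    have "card (\<phi> ` X) = card X"
      by (rule card_image[OF inj_on_subset[OF bij_betw_imp_inj_on[OF bij] X]])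
    moreover have "\<phi> ` X \<subseteq> {..<5}" using bij_betw_imp_surj_on[OF bij] X by auto
    ultimately show "X \<in> indeps N \<longleftrightarrow> \<phi> ` X \<in> indeps (uniform_matroid 3 5)"
      using ind[OF X] X by (simp add: uniform_matroid_def indeps_N)
  qed
qed

text \<open>The excess equals \<open>2 * omega M\<close> when every line misses at least two points.
  If some line misses just one point and there are at least four points, it is
  \<open>- 2 * (card S - 4)\<close>, and the two components reverse the sign; with three points it
  is 2, and three components leave the sign unchanged.\<close>

lemma omega_cases:
  assumes nl: "\<And>e. \<not> is_loop M e" and nc: "\<And>e. \<not> is_coloop M e"
  shows "0 \<le> omega M \<and> (omega M = 0 \<longleftrightarrow>
    (card S = 5 \<and> (\<forall>b\<in>blocks. card b = 2)) \<or> (\<exists>b\<in>blocks. card b + 2 = card S))"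
proof -
  have om: "omega M = (- 1) ^ (num_components M + 1) * omega_value"
    using nl nc by (rule omega_eq_omega_value)
  obtain e where e: "e \<in> E"
    using rank3 rk_empty unfolding matroid_rank_def by (metis equals0I zero_neq_numeral)
  then obtain L0 where L0: "L0 \<in> lines" using lines_at_nonempty[OF e] by (auto simp: lines_at_def)
  show ?thesis
  proof (cases "\<forall>L\<in>lines. card (L \<inter> S) + 2 \<le> card S")
    case True
    then have "num_components M = 1" by (intro num_components_connected) auto
    then have 2: "2 * omega M = ls.excess" using om two_times_omega_value by simp
    have "card b + 2 \<le> card S" if "b \<in> blocks" for b using that True by (auto simp: blocks_def)
    moreover have "2 \<le> card S" using True L0 by fastforce
    ultimately have "ls.excess \<ge> 0" and
      "ls.excess = 0 \<longleftrightarrow> (card S = 5 \<and> (\<forall>b\<in>blocks. card b = 2)) \<or> (\<exists>b\<in>blocks. card b + 2 = card S)"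
      by (intro ls.excess_cases; simp)+
    moreover have "omega M = 0 \<longleftrightarrow> ls.excess = 0" "omega M \<ge> 0 \<longleftrightarrow> ls.excess \<ge> 0" using 2 by linarith+
    ultimately show ?thesis by simp
  next
    case False
    then obtain L where L: "L \<in> lines" "\<not> card (L \<inter> S) + 2 \<le> card S" by blast
    define b where "b = L \<inter> S"
    have b: "b \<in> blocks" using L(1) by (auto simp: blocks_def b_def)
    have cS: "card S = Suc (card b)" using L block_subset_card[OF L(1)] by (simp add: b_def)
    have c1: "card (S - b) = 1"
      using card_Diff_subset[OF ls.finite_block[OF b] ls.block_subset[OF b]] cS by simp
    have other: "card b' = 2" if b': "b' \<in> blocks" "b' \<noteq> b" for b'
      using ls.card_block_split[OF b'(1) b b'(2)] ls.block_ge_2[OF b'(1)] c1 by linarith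
    have ex: "ls.excess = (int (card S) - 4) * (int (card S) - 5) - (int (card b) - 2) * (int (card b) - 3)"
      using c1 by (intro ls.excess_near_pencil[OF b]) simp
    show ?thesis
    proof (cases "card S = 3")
      case True
      then have "ls.excess = 2" using ex cS by simp
      then have "omega M = 1" using om two_times_omega_value num_components_3[OF True] by simp
      moreover have "card b' + 2 \<noteq> card S" if "b' \<in> blocks" for b'
        using True ls.block_ge_2[OF that] by simp
      ultimately show ?thesis using True by auto
    next
      case False
      then have p: "card S \<ge> 4" using cS ls.block_ge_2[OF b] by simp
      have "num_components M = 2"
        using L(1) cS p unfolding b_def by (rule num_components_2)
      moreover have "ls.excess = - 2 * (int (card S) - 4)"
      proof -
        have cb: "int (card b) = int (card S) - 1" using cS by simp
        show ?thesis unfolding ex cb by (simp add: algebra_simps)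
      qed
      ultimately have o4: "omega M = int (card S) - 4" using om two_times_omega_value by simp
      have "\<not> (card S = 5 \<and> (\<forall>b\<in>blocks. card b = 2))" using b cS by force
      moreover have "(\<exists>b\<in>blocks. card b + 2 = card S) \<longleftrightarrow> card S = 4"
      proof
        assume "\<exists>b\<in>blocks. card b + 2 = card S"
        then obtain b' where b': "b' \<in> blocks" "card b' + 2 = card S" by blast
        then have "b' \<noteq> b" using cS by auto
        then show "card S = 4" using other[OF b'(1)] b'(2) by simp
      next
        \<comment> \<open>Here \<open>b\<close> has three of the four points. A block through the
          remaining point \<open>x\<close> has size 2, which is two less than the number of
          points.\<close>
        assume S4: "card S = 4"
        obtain x where x: "S - b = {x}" using c1 by (auto simp: card_1_singleton_iff)
        obtain y where y: "y \<in> b" using ls.block_ge_2[OF b] by (cases "b = {}") auto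
        have "x \<in> S" "y \<in> S" "x \<noteq> y" using x y ls.block_subset[OF b] by auto
        then obtain b' where b': "b' \<in> blocks" "x \<in> b'" using ls.unique_block by blast
        then have "b' \<noteq> b" using x by auto
        then have "card b' + 2 = card S" using other[OF b'(1)] S4 by simp
        then show "\<exists>b\<in>blocks. card b + 2 = card S" using b'(1) by blast
      qed
      moreover have "0 \<le> omega M" "omega M = 0 \<longleftrightarrow> card S = 4" using o4 p by auto
      ultimately show ?thesis by blast
    qed
  qed
qed

end

section \<open>Combination of the cases\<close>

lemma omega_eq_0:
  assumes "ground M \<noteq> {}" "(\<exists>e. is_loop M e) \<or> (\<exists>e. is_coloop M e)"
  shows "omega M = 0"
proof -
  have "g_poly M = 0" unfolding g_poly_def using assms by (simp only: if_True if_False)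
  then show ?thesis by (simp add: omega_def)
qed

lemma rank3_transversal_simplification:
  assumes "matroid M" "matroid_rank M = 3" "\<And>e. \<not> is_loop M e" "\<And>e. \<not> is_coloop M e"
    and N: "is_simplification M N"
  obtains S where "rank3_transversal M S" "N = matroid_restrict M S"
proof -
  interpret matroid M by fact
  interpret rank3_coloopless M
  proof
    show "matroid_rank M = 3" by fact
    show "closure {} = {}" using assms(3) by (rule closure_empty)
    show "rk M (ground M - {e}) = 3" if "e \<in> ground M" for e
      using rk_remove_not_coloop[OF that assms(4)] assms(2) by simp
  qed
  obtain S where S: "S \<subseteq> E" "\<forall>e\<in>E. \<exists>!s. s \<in> S \<and> parallel M e s" "N = matroid_restrict M S"
    using N assms(3) by (auto simp: is_simplification_def)
  have "rank3_transversal M S"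
  proof
    show "S \<subseteq> E" by fact
    show "\<exists>!s. s \<in> S \<and> e \<in> pt s" if e: "e \<in> E" for e
    proof -
      have "s \<in> S \<and> e \<in> pt s \<longleftrightarrow> s \<in> S \<and> parallel M e s" for s
        using parallel_iff_pt[OF e, of s] S(1) by auto
      then show ?thesis using S(2) e by simp
    qed
  qed
  then show ?thesis using S(3) by (rule that)
qed

theorem corollary11p2:
  fixes M :: "'a set_system"
  assumes "matroid M"
    and "matroid_rank M = 3"
  shows "0 \<le> omega M \<and>
    (loop_free M \<longrightarrow>
      (\<forall>N. is_simplification M N \<longrightarrow>
        (omega M = 0 \<longleftrightarrow>
          (\<exists>e. is_coloop M e) \<or>
          matroid_iso N (uniform_matroid 3 5) \<or>
          (\<exists>F. is_flat N F \<and> rk N F = 2 \<and> card (ground N - F) = 2))))"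
proof -
  interpret matroid M by fact
  have ne: "ground M \<noteq> {}" using assms(2) rk_empty unfolding matroid_rank_def by (metis zero_neq_numeral)
  show ?thesis
  proof (cases "(\<exists>e. is_loop M e) \<or> (\<exists>e. is_coloop M e)")
    case True
    \<comment> \<open>By convention the invariant is 0 here, and for loop-free \<open>M\<close> the
      disjunct about coloops holds, so the equivalence is true for every \<open>N\<close>.\<close>
    then show ?thesis using omega_eq_0[OF ne True] by (auto simp: loop_free_def)
  next
    case False
    then have nl: "\<And>e. \<not> is_loop M e" and nc: "\<And>e. \<not> is_coloop M e" by blast+
    have main: "0 \<le> omega M \<and> (omega M = 0 \<longleftrightarrow> matroid_iso N (uniform_matroid 3 5) \<or>
          (\<exists>F. is_flat N F \<and> rk N F = 2 \<and> card (ground N - F) = 2))"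
      if sN: "is_simplification M N" for N
    proof -
      obtain S where S: "rank3_transversal M S" "N = matroid_restrict M S"
        by (rule rank3_transversal_simplification[OF assms nl nc sN])
      interpret rank3_transversal M S by fact
      show ?thesis
        unfolding S(2) iso_uniform_iff ex_flat_N_iff using nl nc by (rule omega_cases)
    qed
    \<comment> \<open>Nonnegativity does not refer to a simplification, so one has to be chosen in
      order to apply the case analysis.\<close>
    obtain N0 where "is_simplification M N0" using simplification_exists by blast
    then have "0 \<le> omega M" using main by blast
    then show ?thesis using main nc by blast
  qed
qed

end
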